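(* Let $d\ge2$, let $a=\{a_{i,j}\}_{i,j=1}^d\in C^1(\mathbb R^d)$ be a symmetric positive definite matrix-valued function and let $Q\in C^1(\mathbb R^d)$. Let $$H_D=-\frac12\nabla\cdot a\nabla-a\nabla Q\cdot\nabla=-\frac12e^{-2Q}\nabla\cdot a\,e^{2Q}\nabla$$ be the corresponding self-adjoint operator on $L^2(\mathbb R^d,e^{2Q}dx)$, and for $l>0$ let $H_D^l$ be the corresponding self-adjoint operator on $\mathbb R^d\setminus\overline{B_l(0)}$ with the Dirichlet boundary condition at $\partial B_l(0)$. Let the one-dimensional operators $H_{\text{rad-har};\phi}$, $H^{(l,\infty)}_{\text{rad-har};\phi}$ ($\phi\in S^{d-1}$), $H_{\text{rad-avg}}$, $H^{(l,\infty)}_{\text{rad-avg}}$ be as defined in the context. Then $$\inf_{\phi\in S^{d-1}}\inf\sigma(H_{\text{rad-har};\phi})\le\inf\sigma(H_D)\le\inf\sigma(H_{\text{rad-avg}})$$ and, for every $l>0$, $$\inf_{\phi\in S^{d-1}}\inf\sigma(H^{(l,\infty)}_{\text{rad-har};\phi})\le\inf\sigma(H_D^{l})\le\inf\sigma(H^{(l,\infty)}_{\text{rad-avg}}).$$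
   Context: $H_D$ is the non-negative self-adjoint operator associated (Friedrichs extension) with the closure of the form $\frac12\int_{\mathbb R^d}(\nabla f\cdot a\nabla g)e^{2Q}dx$, $f,g\in C_0^1(\mathbb R^d)$, in $L^2(\mathbb R^d,e^{2Q}dx)$. $H_D^l$ is the one associated with the closure of $\frac12\int_{\mathbb R^d\setminus\overline{B_l(0)}}(\nabla f\cdot a\nabla g)e^{2Q}dx$, $f,g\in C_0^1(\mathbb R^d\setminus\overline{B_l(0)})$, where $B_l(0)$ is the open ball of radius $l$ about the origin. $C_0^1$ denotes compactly supported $C^1$ functions. $\sigma$ denotes spectrum. Write $x=r\phi$ with $r=|x|>0$, $\phi=x/|x|\in S^{d-1}$, and write functions of $x$ as functions of $(r,\phi)$; $d\phi$ is surface measure on $S^{d-1}$. Put $$A_{\text{rad-har}}(r,\phi)=\Big(\frac{x}{|x|}\cdot a^{-1}(x)\frac{x}{|x|}\Big)^{-1},\qquad A_{\text{rad-avg}}(r)=\frac{\int_{S^{d-1}}\big(\frac{x}{|x|}\cdot a(x)\frac{x}{|x|}\big)(r,\phi)\,e^{2Q(r,\phi)}d\phi}{\int_{S^{d-1}}e^{2Q(r,\phi)}d\phi},$$ $$\beta(r)=\frac{d-1}{2}\log r+\frac12\log\int_{S^{d-1}}e^{2Q(r,\phi)}d\phi .$$ For $\phi\in S^{d-1}$ define on $(0,\infty)$ $$H_{\text{rad-har};\phi}=-\frac12 r^{1-d}e^{-2Q(r,\phi)}\frac{d}{dr}A_{\text{rad-har}}(r,\phi)\,r^{d-1}e^{2Q(r,\phi)}\frac{d}{dr},\qquad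 H_{\text{rad-avg}}=-\frac12e^{-2\beta(r)}\frac{d}{dr}A_{\text{rad-avg}}(r)\,e^{2\beta(r)}\frac{d}{dr}.$$ These are realized as self-adjoint operators: for an operator $-\frac12w^{-1}\frac{d}{dr}Aw\frac{d}{dr}$ (with $w=r^{d-1}e^{2Q(r,\phi)}$ and $A=A_{\text{rad-har}}(\cdot,\phi)$, respectively $w=e^{2\beta}$ and $A=A_{\text{rad-avg}}$), take the operator on $L^2((0,\infty),w\,dr)$ associated with the closure of the form $\frac12\int_0^\infty A f'g'\,w\,dr$, $f,g\in C_0^1((0,\infty))$. The superscript $(l,\infty)$ denotes the analogous operator with $(0,\infty)$ replaced by $(l,\infty)$ throughout (Dirichlet boundary condition at $r=l$). *)

theory Defs
  imports "HOL-Analysis.Analysis"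
begin

section \<open>Function spaces\<close>

definition C1_on :: "'a::real_normed_vector set \<Rightarrow> ('a \<Rightarrow> 'b::real_normed_vector) \<Rightarrow> bool" where
  "C1_on S f \<longleftrightarrow> (\<exists>D :: 'a \<Rightarrow> 'a \<Rightarrow>\<^sub>L 'b.
     (\<forall>x\<in>S. (f has_derivative blinfun_apply (D x)) (at x)) \<and> continuous_on S D)"

text \<open>Functions in \<open>C\<^sub>0\<^sup>1(U)\<close> for open \<open>U\<close> are identified with their extension by zero, which is
  \<open>C\<^sup>1\<close> on the whole space.\<close>

definition C01 :: "'a::real_normed_vector set \<Rightarrow> ('a \<Rightarrow> complex) set" where
  "C01 U = {f. C1_on UNIV f \<and> compact (closure {x. f x \<noteq> 0}) \<and> closure {x. f x \<noteq> 0} \<subseteq> U}"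

definition weighted_measure :: "('a::euclidean_space \<Rightarrow> real) \<Rightarrow> 'a set \<Rightarrow> 'a measure" where
  "weighted_measure w U = density (restrict_space lborel U) (\<lambda>x. ennreal (w x))"

text \<open>The Hilbert space \<open>L\<^sup>2(M)\<close> is represented by square-integrable functions; identification of
  functions that agree almost everywhere is left to the notions built on it.\<close>

definition L2 :: "'a measure \<Rightarrow> ('a \<Rightarrow> complex) set" where
  "L2 M = {f \<in> borel_measurable M. integrable M (\<lambda>x. (cmod (f x))\<^sup>2)}"

definition L2_inner :: "'a measure \<Rightarrow> ('a \<Rightarrow> complex) \<Rightarrow> ('a \<Rightarrow> complex) \<Rightarrow> complex" where
  "L2_inner M f g = (\<integral>x. f x * cnj (g x) \<partial>M)"

definition L2_norm :: "'a measure \<Rightarrow> ('a \<Rightarrow> complex) \<Rightarrow> real" where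
  "L2_norm M f = sqrt (\<integral>x. (cmod (f x))\<^sup>2 \<partial>M)"


section \<open>Closed forms, associated operators, spectrum\<close>

type_synonym 'a sesq_form = "('a \<Rightarrow> complex) \<Rightarrow> ('a \<Rightarrow> complex) \<Rightarrow> complex"

text \<open>\<open>form_approx M D q u f\<close>: the sequence \<open>u\<close> in the form domain \<open>D\<close> converges to \<open>f\<close> in \<open>L\<^sup>2(M)\<close>
  and is Cauchy with respect to \<open>q\<close>.\<close>

definition form_approx ::
  "'a measure \<Rightarrow> ('a \<Rightarrow> complex) set \<Rightarrow> 'a sesq_form \<Rightarrow> (nat \<Rightarrow> 'a \<Rightarrow> complex) \<Rightarrow> ('a \<Rightarrow> complex) \<Rightarrow> bool"
where
  "form_approx M D q u f \<longleftrightarrow>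
     (\<forall>n. u n \<in> D) \<and>
     (\<lambda>n. L2_norm M (\<lambda>x. u n x - f x)) \<longlonglongrightarrow> 0 \<and>
     (\<forall>e>0. \<exists>N. \<forall>m\<ge>N. \<forall>n\<ge>N. cmod (q (\<lambda>x. u m x - u n x) (\<lambda>x. u m x - u n x)) < e)"

definition closure_domain ::
  "'a measure \<Rightarrow> ('a \<Rightarrow> complex) set \<Rightarrow> 'a sesq_form \<Rightarrow> ('a \<Rightarrow> complex) set" where
  "closure_domain M D q = {f \<in> L2 M. \<exists>u. form_approx M D q u f}"

text \<open>For a closable form the limit does not depend on the approximating sequences.\<close>

definition closure_form ::
  "'a measure \<Rightarrow> ('a \<Rightarrow> complex) set \<Rightarrow> 'a sesq_form \<Rightarrow> 'a sesq_form" where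
  "closure_form M D q f g = (THE c. \<forall>u v. form_approx M D q u f \<longrightarrow> form_approx M D q v g \<longrightarrow>
     (\<lambda>n. q (u n) (v n)) \<longlonglongrightarrow> c)"

text \<open>Operators in \<open>L\<^sup>2(M)\<close> are given by their graphs. The following is the graph of the self-adjoint
  operator \<open>H\<close> associated with the closure of \<open>(q, D)\<close>: \<open>(f, h)\<close> belongs to it iff \<open>f\<close> lies in the domain
  of the closure and \<open>\<langle>h, g\<rangle>\<close> is the value of the closure at \<open>(f, g)\<close> for all \<open>g\<close> in that domain.\<close>

definition form_operator ::
  "'a measure \<Rightarrow> ('a \<Rightarrow> complex) set \<Rightarrow> 'a sesq_form \<Rightarrow> (('a \<Rightarrow> complex) \<times> ('a \<Rightarrow> complex)) set" where
  "form_operator M D q = {(f, h). f \<in> closure_domain M D q \<and> h \<in> L2 M \<and>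
     (\<forall>g\<in>closure_domain M D q. closure_form M D q f g = L2_inner M h g)}"

text \<open>\<open>z\<close> is in the resolvent set iff \<open>T - z\<close> maps the domain of \<open>T\<close> onto \<open>L\<^sup>2(M)\<close> and has a bounded
  inverse; the estimate contains injectivity.\<close>

definition resolvent_set ::
  "'a measure \<Rightarrow> (('a \<Rightarrow> complex) \<times> ('a \<Rightarrow> complex)) set \<Rightarrow> complex set" where
  "resolvent_set M T = {z.
     (\<forall>h\<in>L2 M. \<exists>(f, k)\<in>T. AE x in M. k x - z * f x = h x) \<and>
     (\<exists>C. \<forall>(f, k)\<in>T. L2_norm M f \<le> C * L2_norm M (\<lambda>x. k x - z * f x))}"

definition spectrum ::
  "'a measure \<Rightarrow> (('a \<Rightarrow> complex) \<times> ('a \<Rightarrow> complex)) set \<Rightarrow> complex set" where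
  "spectrum M T = - resolvent_set M T"

text \<open>Only used for self-adjoint operators, whose spectrum is real.\<close>

definition inf_spectrum ::
  "'a measure \<Rightarrow> (('a \<Rightarrow> complex) \<times> ('a \<Rightarrow> complex)) set \<Rightarrow> ereal" where
  "inf_spectrum M T = (INF \<mu>\<in>{\<mu>::real. complex_of_real \<mu> \<in> spectrum M T}. ereal \<mu>)"


section \<open>The operator in dimension d\<close>

definition partial_deriv :: "'n::finite \<Rightarrow> (real^'n \<Rightarrow> complex) \<Rightarrow> real^'n \<Rightarrow> complex" where
  "partial_deriv i f x = frechet_derivative f (at x) (axis i 1)"

abbreviation measure_D :: "(real^'n \<Rightarrow> real) \<Rightarrow> (real^'n) set \<Rightarrow> (real^'n) measure" where
  "measure_D Q U \<equiv> weighted_measure (\<lambda>x. exp (2 * Q x)) U"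

text \<open>The sesquilinear version of \<open>1/2 \<integral> (\<nabla>f \<sqdot> a \<nabla>g) e\<^sup>2\<^sup>Q dx\<close> over \<open>U\<close>.\<close>

definition form_D ::
  "(real^'n \<Rightarrow> real^'n^'n) \<Rightarrow> (real^'n \<Rightarrow> real) \<Rightarrow> (real^'n::finite) set \<Rightarrow> (real^'n) sesq_form" where
  "form_D a Q U f g = 1/2 * (\<integral>x. (\<Sum>i\<in>UNIV. \<Sum>j\<in>UNIV.
     partial_deriv i f x * complex_of_real (a x $ i $ j) * cnj (partial_deriv j g x)) \<partial>measure_D Q U)"

definition H_D :: "(real^'n \<Rightarrow> real^'n^'n) \<Rightarrow> (real^'n \<Rightarrow> real) \<Rightarrow> (real^'n::finite) set \<Rightarrow>
    ((real^'n \<Rightarrow> complex) \<times> (real^'n \<Rightarrow> complex)) set" where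
  "H_D a Q U = form_operator (measure_D Q U) (C01 U) (form_D a Q U)"


section \<open>The radial operators\<close>

definition form_1d :: "(real \<Rightarrow> real) \<Rightarrow> (real \<Rightarrow> real) \<Rightarrow> real set \<Rightarrow> real sesq_form" where
  "form_1d A w I f g = 1/2 * (\<integral>r. complex_of_real (A r) *
     vector_derivative f (at r) * cnj (vector_derivative g (at r)) \<partial>weighted_measure w I)"

text \<open>\<open>-1/2 w\<inverse> d/dr A w d/dr\<close> on \<open>L\<^sup>2(I, w dr)\<close>\<close>

definition H_1d :: "(real \<Rightarrow> real) \<Rightarrow> (real \<Rightarrow> real) \<Rightarrow> real set \<Rightarrow>
    ((real \<Rightarrow> complex) \<times> (real \<Rightarrow> complex)) set" where
  "H_1d A w I = form_operator (weighted_measure w I) (C01 I) (form_1d A w I)"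

text \<open>Surface measure on the unit sphere, normalised by integration in polar coordinates:
  the measure of \<open>E\<close> is \<open>d\<close> times the volume of the cone \<open>{x. 0 < |x| < 1, x/|x| \<in> E}\<close>.\<close>

definition sphere_measure :: "(real^'n::finite) measure" where
  "sphere_measure = scale_measure (of_nat CARD('n))
     (distr (restrict_space lborel (ball 0 1 - {0})) (restrict_space borel (sphere 0 1))
       (\<lambda>x. x /\<^sub>R norm x))"

definition A_rad_har :: "(real^'n \<Rightarrow> real^'n^'n) \<Rightarrow> real \<Rightarrow> real^'n::finite \<Rightarrow> real" where
  "A_rad_har a r \<phi> = inverse (\<phi> \<bullet> (matrix_inv (a (r *\<^sub>R \<phi>)) *v \<phi>))"

definition A_rad_avg :: "(real^'n \<Rightarrow> real^'n^'n) \<Rightarrow> (real^'n::finite \<Rightarrow> real) \<Rightarrow> real \<Rightarrow> real" where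
  "A_rad_avg a Q r =
     (\<integral>\<phi>. (\<phi> \<bullet> (a (r *\<^sub>R \<phi>) *v \<phi>)) * exp (2 * Q (r *\<^sub>R \<phi>)) \<partial>sphere_measure) /
     (\<integral>\<phi>. exp (2 * Q (r *\<^sub>R \<phi>)) \<partial>sphere_measure)"

definition beta :: "(real^'n::finite \<Rightarrow> real) \<Rightarrow> real \<Rightarrow> real" where
  "beta Q r = (real CARD('n) - 1) / 2 * ln r +
     1/2 * ln (\<integral>\<phi>. exp (2 * Q (r *\<^sub>R \<phi>)) \<partial>sphere_measure)"

definition w_rad_har :: "(real^'n::finite \<Rightarrow> real) \<Rightarrow> real^'n \<Rightarrow> real \<Rightarrow> real" where
  "w_rad_har Q \<phi> r = r ^ (CARD('n) - 1) * exp (2 * Q (r *\<^sub>R \<phi>))"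

definition w_rad_avg :: "(real^'n::finite \<Rightarrow> real) \<Rightarrow> real \<Rightarrow> real" where
  "w_rad_avg Q r = exp (2 * beta Q r)"

definition H_rad_har :: "(real^'n \<Rightarrow> real^'n^'n) \<Rightarrow> (real^'n::finite \<Rightarrow> real) \<Rightarrow> real^'n \<Rightarrow> real set \<Rightarrow>
    ((real \<Rightarrow> complex) \<times> (real \<Rightarrow> complex)) set" where
  "H_rad_har a Q \<phi> I = H_1d (\<lambda>r. A_rad_har a r \<phi>) (w_rad_har Q \<phi>) I"

definition H_rad_avg :: "(real^'n \<Rightarrow> real^'n^'n) \<Rightarrow> (real^'n::finite \<Rightarrow> real) \<Rightarrow> real set \<Rightarrow>
    ((real \<Rightarrow> complex) \<times> (real \<Rightarrow> complex)) set" where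
  "H_rad_avg a Q I = H_1d (A_rad_avg a Q) (w_rad_avg Q) I"

abbreviation inf_spec_D ::
  "(real^'n \<Rightarrow> real^'n^'n) \<Rightarrow> (real^'n::finite \<Rightarrow> real) \<Rightarrow> (real^'n) set \<Rightarrow> ereal" where
  "inf_spec_D a Q U \<equiv> inf_spectrum (measure_D Q U) (H_D a Q U)"

abbreviation inf_spec_rad_har ::
  "(real^'n \<Rightarrow> real^'n^'n) \<Rightarrow> (real^'n::finite \<Rightarrow> real) \<Rightarrow> real^'n \<Rightarrow> real set \<Rightarrow> ereal" where
  "inf_spec_rad_har a Q \<phi> I \<equiv> inf_spectrum (weighted_measure (w_rad_har Q \<phi>) I) (H_rad_har a Q \<phi> I)"

abbreviation inf_spec_rad_avg ::
  "(real^'n \<Rightarrow> real^'n^'n) \<Rightarrow> (real^'n::finite \<Rightarrow> real) \<Rightarrow> real set \<Rightarrow> ereal" where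
  "inf_spec_rad_avg a Q I \<equiv> inf_spectrum (weighted_measure (w_rad_avg Q) I) (H_rad_avg a Q I)"

end

theory Submission
  imports Defs
begin

text \<open>
  A real number \<open>b\<close> bounds the spectrum of the operator of a closed form from below iff
  \<open>b \<parallel>u\<parallel>\<^sup>2 \<le> q(u, u)\<close> on the form core, so both inequalities compare Rayleigh quotients of test functions.

  For the upper bound take \<open>u(x) = f(|x|)\<close>: in polar coordinates its norm and energy are those of \<open>f\<close> for the
  averaged one-dimensional operator.

  For the lower bound, Cauchy--Schwarz gives \<open>|\<phi> \<bullet> \<nabla>u|\<^sup>2 \<le> (\<nabla>u \<bullet> a \<nabla>u) (\<phi> \<bullet> a\<inverse> \<phi>)\<close>, so on the ray in direction \<open>\<phi>\<close>
  the energy density of \<open>u\<close> dominates the one of the one-dimensional operator with the harmonic coefficient;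
  apply the one-dimensional bound on each ray and integrate over \<open>\<phi>\<close>. On the whole space the restriction of
  \<open>u\<close> to a ray need not vanish at the origin; logarithmic cutoffs repair this because \<open>d \<ge> 2\<close>.
\<close>

section \<open>Non-negative hermitian forms\<close>

text \<open>The operators are graphs built from closures of forms, and \<open>closure_form\<close>
  is a definite description, so nothing can be said about a spectrum before closability is known.
  Closability is proved once, for gradient forms with continuous coefficients that are elliptic on
  compact sets and with a positive continuous weight; the form in dimension d and all radial forms
  are instances. Spectrum and form are linked through resolvents alone: below a form bound the
  resolvent equation is solved variationally, and a best form bound lying in the resolvent set could
  be improved. Inequalities between bottoms of spectra are tested against real lower bounds
  \<open>b\<close>, which also covers infinite values. In polar coordinates everything is an
  integral of a function with values in \<open>[0, \<infinity>]\<close>, so exchanging integrals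
  requires only measurability; negative \<open>b\<close> is trivial because the forms are
  non-negative. The cutoff has to be logarithmic because of dimension two: with weight
  \<open>r\<close>, a cutoff that is linear on an interval shrinking to the origin keeps an energy
  of order one.\<close>

locale hermitian_form =
  fixes D :: "('a \<Rightarrow> complex) set" and q :: "'a sesq_form"
  assumes add_mem: "\<lbrakk>f \<in> D; g \<in> D\<rbrakk> \<Longrightarrow> (\<lambda>x. f x + g x) \<in> D"
    and scale_mem: "f \<in> D \<Longrightarrow> (\<lambda>x. c * f x) \<in> D"
    and add_left: "\<lbrakk>f \<in> D; g \<in> D; h \<in> D\<rbrakk> \<Longrightarrow> q (\<lambda>x. f x + g x) h = q f h + q g h"
    and scale_left: "\<lbrakk>f \<in> D; g \<in> D\<rbrakk> \<Longrightarrow> q (\<lambda>x. c * f x) g = c * q f g"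
    and hermitian: "\<lbrakk>f \<in> D; g \<in> D\<rbrakk> \<Longrightarrow> q g f = cnj (q f g)"
    and nonneg: "f \<in> D \<Longrightarrow> 0 \<le> Re (q f f)"
begin

abbreviation energy :: "('a \<Rightarrow> complex) \<Rightarrow> real" where "energy f \<equiv> Re (q f f)"

lemma diff_mem: "\<lbrakk>f \<in> D; g \<in> D\<rbrakk> \<Longrightarrow> (\<lambda>x. f x - g x) \<in> D"
  using add_mem[of f "\<lambda>x. -1 * g x"] scale_mem[of g "-1"] by simp

lemma diff_left: "\<lbrakk>f \<in> D; g \<in> D; h \<in> D\<rbrakk> \<Longrightarrow> q (\<lambda>x. f x - g x) h = q f h - q g h"
  using add_left[of f "\<lambda>x. -1 * g x" h] scale_mem[of g "-1"] scale_left[of g h "-1"] by simp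

lemma add_right: "\<lbrakk>f \<in> D; g \<in> D; h \<in> D\<rbrakk> \<Longrightarrow> q h (\<lambda>x. f x + g x) = q h f + q h g"
  using hermitian[of "\<lambda>x. f x + g x" h] hermitian[of f h] hermitian[of g h]
  by (simp add: add_left add_mem)

lemma scale_right: "\<lbrakk>f \<in> D; g \<in> D\<rbrakk> \<Longrightarrow> q f (\<lambda>x. c * g x) = cnj c * q f g"
  using hermitian[of "\<lambda>x. c * g x" f] hermitian[of g f] by (simp add: scale_left scale_mem)

lemma diff_right: "\<lbrakk>f \<in> D; g \<in> D; h \<in> D\<rbrakk> \<Longrightarrow> q h (\<lambda>x. f x - g x) = q h f - q h g"
  using hermitian[of "\<lambda>x. f x - g x" h] hermitian[of f h] hermitian[of g h]
  by (simp add: diff_left diff_mem)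

lemma self_real: "f \<in> D \<Longrightarrow> q f f = complex_of_real (energy f)"
  using hermitian[of f f] by (metis Reals_cnj_iff of_real_Re)

lemma cmod_self: "f \<in> D \<Longrightarrow> cmod (q f f) = energy f"
  using self_real[of f] nonneg[of f] by (metis abs_of_nonneg norm_of_real)

lemma energy_scale: "f \<in> D \<Longrightarrow> energy (\<lambda>x. c * f x) = (cmod c)\<^sup>2 * energy f"
proof -
  assume f: "f \<in> D"
  have "q (\<lambda>x. c * f x) (\<lambda>x. c * f x) = (c * cnj c) * q f f"
    using f by (simp add: scale_left scale_right scale_mem)
  then show ?thesis by (simp add: complex_norm_square[symmetric])
qed

lemma energy_expand:
  assumes "f \<in> D" "g \<in> D"
  shows "energy (\<lambda>x. f x + c * g x) = energy f + 2 * Re (cnj c * q f g) + (cmod c)\<^sup>2 * energy g"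
proof -
  have "q (\<lambda>x. f x + c * g x) (\<lambda>x. f x + c * g x)
      = q f f + (cnj c * q f g + cnj (cnj c * q f g)) + q (\<lambda>x. c * g x) (\<lambda>x. c * g x)"
    using assms by (simp add: add_left add_right scale_left scale_right add_mem scale_mem
        hermitian[of f g] algebra_simps)
  then show ?thesis using energy_scale[OF assms(2), of c] by simp
qed

lemma cauchy_schwarz:
  assumes f: "f \<in> D" and g: "g \<in> D"
  shows "(cmod (q f g))\<^sup>2 \<le> energy f * energy g"
proof -
  let ?b = "q f g"
  \<comment> \<open>A real multiple of \<open>q f g\<close> as coefficient makes the mixed term
    real, so a quadratic in one real variable remains.\<close>
  have *: "0 \<le> energy f - 2 * t * (cmod ?b)\<^sup>2 + t\<^sup>2 * (cmod ?b)\<^sup>2 * energy g" for t :: real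
  proof -
    let ?c = "complex_of_real (-t) * ?b"
    have "cnj ?c * ?b = complex_of_real (- t * (cmod ?b)\<^sup>2)"
      unfolding of_real_mult complex_norm_square by simp
    then have "Re (cnj ?c * ?b) = - t * (cmod ?b)\<^sup>2" by (metis Re_complex_of_real)
    moreover have "(cmod ?c)\<^sup>2 = t\<^sup>2 * (cmod ?b)\<^sup>2" by (simp add: norm_mult power_mult_distrib)
    moreover have "0 \<le> energy (\<lambda>x. f x + ?c * g x)"
      using f g by (intro nonneg add_mem scale_mem)
    ultimately show ?thesis using energy_expand[OF f g, of ?c] by simp
  qed
  show ?thesis
  proof (cases "energy g = 0")
    case True
    have "(cmod ?b)\<^sup>2 = 0"
    proof (rule ccontr)
      assume "(cmod ?b)\<^sup>2 \<noteq> 0"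
      then have "0 < (cmod ?b)\<^sup>2" by simp
      \<comment> \<open>With \<open>energy g = 0\<close> the quadratic is affine in
        \<open>t\<close>; at this \<open>t\<close> it takes the value -1.\<close>
      then show False using *[of "(energy f + 1) / (2 * (cmod ?b)\<^sup>2)"] True by (simp add: field_simps)
    qed
    then show ?thesis using True by simp
  next
    case False
    then have "energy g > 0" using nonneg[OF g] by simp
    then show ?thesis using *[of "1 / energy g"] by (simp add: field_simps power2_eq_square)
  qed
qed

lemma cmod_le: "\<lbrakk>f \<in> D; g \<in> D\<rbrakk> \<Longrightarrow> cmod (q f g) \<le> sqrt (energy f) * sqrt (energy g)"
  using real_le_rsqrt[OF cauchy_schwarz[of f g]] by (simp add: real_sqrt_mult)

lemma parallelogram:
  assumes "f \<in> D" "g \<in> D"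
  shows "energy (\<lambda>x. f x - g x) + energy (\<lambda>x. f x + g x) = 2 * energy f + 2 * energy g"
  using energy_expand[OF assms, of 1] energy_expand[OF assms, of "-1"] by simp

lemma energy_add_le: "\<lbrakk>f \<in> D; g \<in> D\<rbrakk> \<Longrightarrow> energy (\<lambda>x. f x + g x) \<le> 2 * energy f + 2 * energy g"
  using parallelogram[of f g] nonneg[OF diff_mem, of f g] by linarith

lemma energy_diff_le: "\<lbrakk>f \<in> D; g \<in> D\<rbrakk> \<Longrightarrow> energy (\<lambda>x. f x - g x) \<le> 2 * energy f + 2 * energy g"
  using parallelogram[of f g] nonneg[OF add_mem, of f g] by linarith

lemma form_diff_le:
  assumes mem: "f \<in> D" "g \<in> D" "f' \<in> D" "g' \<in> D"
    and le: "energy (\<lambda>x. f x - f' x) \<le> c\<^sup>2" "energy (\<lambda>x. g x - g' x) \<le> d\<^sup>2"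
      "energy f' \<le> a\<^sup>2" "energy g \<le> b\<^sup>2" and pos: "0 \<le> a" "0 \<le> b" "0 \<le> c" "0 \<le> d"
  shows "cmod (q f g - q f' g') \<le> c * b + a * d"
proof -
  have bound: "cmod (q f g) \<le> a * b"
    if "f \<in> D" "g \<in> D" "energy f \<le> a\<^sup>2" "energy g \<le> b\<^sup>2" "0 \<le> a" "0 \<le> b" for f g a b
    using that by (intro order_trans[OF cmod_le] mult_mono real_le_lsqrt) (auto simp: nonneg)
  have "q f g - q f' g' = q (\<lambda>x. f x - f' x) g + q f' (\<lambda>x. g x - g' x)"
    using mem by (simp add: diff_left diff_right)
  then show ?thesis
    using norm_triangle_mono[OF bound[OF diff_mem[OF mem(1,3)] mem(2) le(1,4) pos(3,2)]
        bound[OF mem(3) diff_mem[OF mem(2,4)] le(3,2) pos(1,4)]] by simp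
qed

text \<open>The splitting \<open>q (u - u') v + q u' (v - v')\<close> pairs a small difference with
  \<open>v\<close> or with \<open>u'\<close>, hence energy bounds for just these two
  sequences.\<close>

lemma form_diff_tendsto_0:
  assumes mem: "\<And>n. u n \<in> D" "\<And>n. v n \<in> D" "\<And>n. u' n \<in> D" "\<And>n. v' n \<in> D"
    and u: "(\<lambda>n. energy (\<lambda>x. u n x - u' n x)) \<longlonglongrightarrow> 0"
    and v: "(\<lambda>n. energy (\<lambda>x. v n x - v' n x)) \<longlonglongrightarrow> 0"
    and B: "\<And>n::nat. energy (v n) \<le> B" "\<And>n. energy (u' n) \<le> B"
  shows "(\<lambda>n. q (u n) (v n) - q (u' n) (v' n)) \<longlonglongrightarrow> 0"
proof (rule Lim_null_comparison)
  have nn: "0 \<le> energy (\<lambda>x. u n x - u' n x)" "0 \<le> energy (\<lambda>x. v n x - v' n x)" for n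
    by (intro nonneg diff_mem mem)+
  have "0 \<le> B" using B(1)[of 0] nonneg[OF mem(2)[of 0]] by linarith
  then have "cmod (q (u n) (v n) - q (u' n) (v' n))
      \<le> sqrt (energy (\<lambda>x. u n x - u' n x)) * sqrt B + sqrt B * sqrt (energy (\<lambda>x. v n x - v' n x))" for n
    by (intro form_diff_le mem) (simp_all add: nn B)
  then show "\<forall>\<^sub>F n in sequentially. norm (q (u n) (v n) - q (u' n) (v' n))
      \<le> sqrt (energy (\<lambda>x. u n x - u' n x)) * sqrt B + sqrt B * sqrt (energy (\<lambda>x. v n x - v' n x))"
    by simp
  show "(\<lambda>n. sqrt (energy (\<lambda>x. u n x - u' n x)) * sqrt B + sqrt B * sqrt (energy (\<lambda>x. v n x - v' n x)))
     \<longlonglongrightarrow> 0"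
    by (rule tendsto_eq_intros u v refl)+ simp
qed

section \<open>Sequences that are Cauchy in energy\<close>

lemma Cauchy_energy_bounded:
  fixes u :: "nat \<Rightarrow> 'a \<Rightarrow> complex"
  assumes mem: "\<And>n. u n \<in> D"
    and N: "\<And>m. m \<ge> N \<Longrightarrow> energy (\<lambda>x. u m x - u N x) \<le> e"
  shows "\<exists>B. \<forall>n. energy (u n) \<le> B"
proof -
  have "energy (u m) \<le> 2 * e + 2 * energy (u N)" if "m \<ge> N" for m
    using energy_add_le[OF diff_mem[OF mem[of m] mem[of N]] mem[of N]] N[OF that] by simp
  moreover have "energy (u m) \<le> (\<Sum>k<N. energy (u k))" if "m < N" for m
    using that by (intro member_le_sum) (auto intro: nonneg mem)
  moreover have "0 \<le> (\<Sum>k<N. energy (u k))" using mem by (intro sum_nonneg nonneg)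
  moreover have "0 \<le> 2 * e + 2 * energy (u N)"
    using N[of N] nonneg[OF mem[of N]] nonneg[OF diff_mem[OF mem[of N] mem[of N]]] by linarith
  ultimately have "energy (u n) \<le> 2 * e + 2 * energy (u N) + (\<Sum>k<N. energy (u k))" for n
    by (cases "n < N") (force simp: not_less)+
  then show ?thesis by blast
qed

definition energy_Cauchy :: "(nat \<Rightarrow> 'a \<Rightarrow> complex) \<Rightarrow> bool" where
  "energy_Cauchy u \<longleftrightarrow> (\<forall>n. u n \<in> D) \<and>
     (\<forall>e>0. \<exists>N. \<forall>m\<ge>N. \<forall>n\<ge>N. energy (\<lambda>x. u m x - u n x) < e)"

lemma energy_Cauchy_bounded:
  assumes "energy_Cauchy u"
  obtains B where "B > 0" "\<And>n. energy (u n) \<le> B\<^sup>2"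
proof -
  have mem: "\<And>n. u n \<in> D" using assms by (simp add: energy_Cauchy_def)
  obtain N where N: "\<forall>m\<ge>N. \<forall>n\<ge>N. energy (\<lambda>x. u m x - u n x) < 1"
    using assms zero_less_one unfolding energy_Cauchy_def by blast
  then obtain B where B: "\<And>n. energy (u n) \<le> B"
    using Cauchy_energy_bounded[of u N 1, OF mem] by (auto simp: less_imp_le)
  show ?thesis by (rule that[of "sqrt (max B 1)"]) (simp_all add: B max.coboundedI1)
qed

lemma Cauchy_form_convergent:
  assumes u: "energy_Cauchy u" and v: "energy_Cauchy v"
  shows "convergent (\<lambda>n. q (u n) (v n))"
proof -
  have mem: "\<And>n. u n \<in> D" "\<And>n. v n \<in> D" using u v by (simp_all add: energy_Cauchy_def)
  obtain B1 where B1: "B1 > 0" "\<And>n. energy (u n) \<le> B1\<^sup>2" using energy_Cauchy_bounded[OF u] by blast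
  obtain B2 where B2: "B2 > 0" "\<And>n. energy (v n) \<le> B2\<^sup>2" using energy_Cauchy_bounded[OF v] by blast
  have "Cauchy (\<lambda>n. q (u n) (v n))"
  proof (rule metric_CauchyI)
    fix e :: real assume e: "e > 0"
    define d1 where "d1 = e / (4 * B2)"
    define d2 where "d2 = e / (4 * B1)"
    have d: "0 < d1\<^sup>2" "0 < d2\<^sup>2" "d1 > 0" "d2 > 0" using e B1 B2 by (auto simp: d1_def d2_def)
    obtain N1 where N1: "\<forall>m\<ge>N1. \<forall>n\<ge>N1. energy (\<lambda>x. u m x - u n x) < d1\<^sup>2"
      using u d(1) unfolding energy_Cauchy_def by blast
    obtain N2 where N2: "\<forall>m\<ge>N2. \<forall>n\<ge>N2. energy (\<lambda>x. v m x - v n x) < d2\<^sup>2"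
      using v d(2) unfolding energy_Cauchy_def by blast
    have "dist (q (u m) (v m)) (q (u n) (v n)) < e" if mn: "m \<ge> max N1 N2" "n \<ge> max N1 N2" for m n
    proof -
      have "cmod (q (u m) (v m) - q (u n) (v n)) \<le> d1 * B2 + B1 * d2"
        using N1 N2 mn d B1 B2 by (intro form_diff_le mem) (auto intro: less_imp_le)
      moreover have "d1 * B2 = e / 4" "B1 * d2 = e / 4" using B1 B2 by (simp_all add: d1_def d2_def)
      ultimately show ?thesis using e unfolding dist_norm by linarith
    qed
    then show "\<exists>N. \<forall>m\<ge>N. \<forall>n\<ge>N. dist (q (u m) (v m)) (q (u n) (v n)) < e" by blast
  qed
  then show ?thesis by (simp add: Cauchy_convergent_iff)
qed

end

section \<open>The space of square-integrable functions\<close>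

lemma L2_measurable: "f \<in> L2 M \<Longrightarrow> f \<in> borel_measurable M"
  by (simp add: L2_def)

lemma L2_integrable: "f \<in> L2 M \<Longrightarrow> integrable M (\<lambda>x. (cmod (f x))\<^sup>2)"
  by (simp add: L2_def)

text \<open>Young's inequality with a weight. The choice \<open>\<delta> = 1\<close> serves for
  \<open>L2\<close>; the cutoff argument lets \<open>\<delta>\<close> tend to 0, so that the factor
  in front of the main term tends to 1.\<close>

lemma cmod_add_power2_le_weighted:
  assumes "\<delta> > 0"
  shows "(cmod (z + z'))\<^sup>2 \<le> (1 + \<delta>) * (cmod z)\<^sup>2 + (1 + 1 / \<delta>) * (cmod z')\<^sup>2"
proof -
  have "(cmod (z + z'))\<^sup>2 \<le> (cmod z + cmod z')\<^sup>2" by (intro power_mono norm_triangle_ineq) auto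
  moreover have "0 \<le> (\<delta> * cmod z - cmod z')\<^sup>2 / \<delta>" using assms by simp
  moreover have "(\<delta> * cmod z - cmod z')\<^sup>2 / \<delta> = \<delta> * (cmod z)\<^sup>2 - 2 * (cmod z * cmod z') + 1 / \<delta> * (cmod z')\<^sup>2"
    using assms by (simp add: power2_eq_square field_simps)
  moreover have "(cmod z + cmod z')\<^sup>2 = (cmod z)\<^sup>2 + 2 * (cmod z * cmod z') + (cmod z')\<^sup>2"
    by (simp add: power2_sum mult.assoc)
  moreover have "(1 + \<delta>) * (cmod z)\<^sup>2 + (1 + 1 / \<delta>) * (cmod z')\<^sup>2
      = (cmod z)\<^sup>2 + \<delta> * (cmod z)\<^sup>2 + ((cmod z')\<^sup>2 + 1 / \<delta> * (cmod z')\<^sup>2)"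
    by (simp add: distrib_right)
  ultimately show ?thesis by linarith
qed

lemma cmod_mult_le_power2: "cmod (a * cnj b) \<le> (cmod a)\<^sup>2 + (cmod b)\<^sup>2"
proof -
  have "cmod (a * cnj b) = cmod a * cmod b" by (simp add: norm_mult)
  moreover have "2 * (cmod a * cmod b) \<le> (cmod a)\<^sup>2 + (cmod b)\<^sup>2"
    using zero_le_power2[of "cmod a - cmod b"] unfolding power2_diff by (simp add: mult.assoc)
  moreover have "0 \<le> cmod a * cmod b" by simp
  ultimately show ?thesis by linarith
qed

lemma L2_add:
  assumes "f \<in> L2 M" "g \<in> L2 M"
  shows "(\<lambda>x. f x + g x) \<in> L2 M"
proof -
  have "integrable M (\<lambda>x. 2 * (cmod (f x))\<^sup>2 + 2 * (cmod (g x))\<^sup>2)"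
    using assms by (simp add: L2_def)
  then have "integrable M (\<lambda>x. (cmod (f x + g x))\<^sup>2)"
    by (rule Bochner_Integration.integrable_bound)
      (use assms in \<open>auto simp: L2_def intro!: order_trans[OF cmod_add_power2_le_weighted[of 1]]\<close>)
  then show ?thesis using assms by (auto simp: L2_def)
qed

lemma L2_scale: "f \<in> L2 M \<Longrightarrow> (\<lambda>x. c * f x) \<in> L2 M"
  by (auto simp: L2_def norm_mult power_mult_distrib)

lemma L2_mult_integrable:
  assumes "f \<in> L2 M" "g \<in> L2 M"
  shows "integrable M (\<lambda>x. f x * cnj (g x))"
proof (rule Bochner_Integration.integrable_bound)
  show "integrable M (\<lambda>x. (cmod (f x))\<^sup>2 + (cmod (g x))\<^sup>2)"
    using assms by (simp add: L2_def)
qed (use assms in \<open>auto simp: L2_def simp del: norm_mult intro!: cmod_mult_le_power2 order_trans[OF _ abs_ge_self]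
       borel_measurable_times borel_measurable_continuous_on[OF continuous_on_cnj]\<close>)

lemma L2_inner_self: "L2_inner M f f = complex_of_real ((L2_norm M f)\<^sup>2)"
  by (simp add: L2_inner_def L2_norm_def complex_norm_square[symmetric] del: of_real_power)

text \<open>The inner product is itself a form of this kind with energy
  \<open>(L2_norm M f)\<^sup>2\<close>, so Cauchy--Schwarz, the parallelogram law and the limit
  lemmas are shared by norm and energy.\<close>

interpretation L2: hermitian_form "L2 M" "L2_inner M" for M :: "'a measure"
proof
  fix f g h :: "'a \<Rightarrow> complex" and c
  assume f: "f \<in> L2 M" and g: "g \<in> L2 M"
  show "L2_inner M g f = cnj (L2_inner M f g)"
    unfolding L2_inner_def by (subst Bochner_Integration.integral_cnj[symmetric]) (simp add: mult.commute)
  assume h: "h \<in> L2 M"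
  show "L2_inner M (\<lambda>x. f x + g x) h = L2_inner M f h + L2_inner M g h"
    using f g h by (simp add: L2_inner_def distrib_right L2_mult_integrable)
qed (auto simp: L2_add L2_scale L2_inner_self L2_inner_def mult.assoc simp flip: of_real_power)

lemma L2_energy: "Re (L2_inner M f f) = (L2_norm M f)\<^sup>2"
  by (simp add: L2_inner_self del: of_real_power)

lemma L2_norm_nonneg: "0 \<le> L2_norm M f"
  by (simp add: L2_norm_def)

lemma L2_inner_cong_AE:
  assumes "AE x in M. f x = f' x" "AE x in M. g x = g' x"
    and "f \<in> L2 M" "f' \<in> L2 M" "g \<in> L2 M" "g' \<in> L2 M"
  shows "L2_inner M f g = L2_inner M f' g'"
  unfolding L2_inner_def
proof (rule integral_cong_AE)
  show "AE x in M. f x * cnj (g x) = f' x * cnj (g' x)" using assms(1,2) by eventually_elim simp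
qed (rule borel_measurable_integrable[OF L2_mult_integrable], fact+)+

lemma L2_norm_tendsto_0_iff:
  "(\<lambda>n. L2_norm M (u n)) \<longlonglongrightarrow> 0 \<longleftrightarrow> (\<lambda>n. Re (L2_inner M (u n) (u n))) \<longlonglongrightarrow> 0"
proof
  assume "(\<lambda>n. L2_norm M (u n)) \<longlonglongrightarrow> 0"
  from tendsto_power[OF this, of 2] show "(\<lambda>n. Re (L2_inner M (u n) (u n))) \<longlonglongrightarrow> 0"
    by (simp add: L2_energy)
next
  assume "(\<lambda>n. Re (L2_inner M (u n) (u n))) \<longlonglongrightarrow> 0"
  from tendsto_real_sqrt[OF this] show "(\<lambda>n. L2_norm M (u n)) \<longlonglongrightarrow> 0"
    by (simp add: L2_energy L2_norm_nonneg)
qed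

lemma L2_cauchy_schwarz:
  "\<lbrakk>f \<in> L2 M; g \<in> L2 M\<rbrakk> \<Longrightarrow> cmod (L2_inner M f g) \<le> L2_norm M f * L2_norm M g"
  using L2.cmod_le[of f M g] by (simp add: L2_energy L2_norm_nonneg)

lemma L2_bounded_of_tendsto:
  assumes mem: "\<And>n. u n \<in> L2 M" "f \<in> L2 M"
    and lim: "(\<lambda>n. L2_norm M (\<lambda>x. u n x - f x)) \<longlonglongrightarrow> 0"
  shows "\<exists>B. \<forall>n. Re (L2_inner M (u n) (u n)) \<le> B"
proof -
  obtain K where K: "\<And>n. norm (L2_norm M (\<lambda>x. u n x - f x)) \<le> K"
    using convergent_imp_Bseq[OF convergentI[OF lim]] unfolding Bseq_def by blast
  have "Re (L2_inner M (u n) (u n)) \<le> 2 * K\<^sup>2 + 2 * Re (L2_inner M f f)" for n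
  proof -
    have "(L2_norm M (\<lambda>x. u n x - f x))\<^sup>2 \<le> K\<^sup>2" using K[of n] abs_le_square_iff by fastforce
    then show ?thesis
      using L2.energy_add_le[OF L2.diff_mem[OF mem(1)[of n] mem(2)] mem(2)] by (simp add: L2_energy)
  qed
  then show ?thesis by blast
qed

lemma L2_inner_tendsto:
  assumes mem: "\<And>n. u n \<in> L2 M" "\<And>n. v n \<in> L2 M" "f \<in> L2 M" "g \<in> L2 M"
    and u: "(\<lambda>n. L2_norm M (\<lambda>x. u n x - f x)) \<longlonglongrightarrow> 0"
    and v: "(\<lambda>n. L2_norm M (\<lambda>x. v n x - g x)) \<longlonglongrightarrow> 0"
  shows "(\<lambda>n. L2_inner M (u n) (v n)) \<longlonglongrightarrow> L2_inner M f g"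
proof -
  obtain B where B: "\<And>n. Re (L2_inner M (v n) (v n)) \<le> B"
    using L2_bounded_of_tendsto[OF mem(2,4) v] by blast
  have "(\<lambda>n. L2_inner M (u n) (v n) - L2_inner M f g) \<longlonglongrightarrow> 0"
    by (rule L2.form_diff_tendsto_0[where B = "max B (Re (L2_inner M f f))"])
      (use mem u v B in \<open>auto simp: L2_norm_tendsto_0_iff max.coboundedI1\<close>)
  then show ?thesis by (simp add: LIM_zero_iff)
qed

subsection \<open>Completeness\<close>

text \<open>A finite sum \<open>c\<close> bounds each increment by
  \<open>sqrt c * (1 / sqrt 2) ^ k\<close>, a summable geometric sequence. This is the pointwise
  half of completeness.\<close>

lemma convergent_of_weighted_increments:
  fixes v :: "nat \<Rightarrow> complex"
  assumes "(\<Sum>k. ennreal (2 ^ k * (cmod (v (Suc k) - v k))\<^sup>2)) \<noteq> \<infinity>"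
  shows "convergent v"
proof -
  have fin: "\<exists>c\<ge>0. y = ennreal c" if "y \<noteq> \<infinity>" for y using that by (cases y) auto
  have term_le: "f k \<le> suminf f" for f :: "nat \<Rightarrow> ennreal" and k
    using sum_le_suminf[OF summableI, of "{k}" f] by simp
  obtain c where c: "(\<Sum>k. ennreal (2 ^ k * (cmod (v (Suc k) - v k))\<^sup>2)) = ennreal c" "c \<ge> 0"
    using fin[OF assms] by blast
  have inc: "cmod (v (Suc k) - v k) \<le> sqrt c * (1 / sqrt 2) ^ k" for k
  proof -
    have "ennreal (2 ^ k * (cmod (v (Suc k) - v k))\<^sup>2) \<le> ennreal c"
      unfolding c(1)[symmetric] by (rule term_le)
    then have "(cmod (v (Suc k) - v k))\<^sup>2 \<le> c / 2 ^ k" using c(2) by (simp add: field_simps)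
    then have "cmod (v (Suc k) - v k) \<le> sqrt (c / 2 ^ k)" by (rule real_le_rsqrt)
    then show ?thesis by (simp add: real_sqrt_divide real_sqrt_power power_divide)
  qed
  have "summable (\<lambda>k. sqrt c * (1 / sqrt 2) ^ k)"
    by (intro summable_mult summable_geometric) simp
  then have "summable (\<lambda>k. v (Suc k) - v k)"
    by (rule summable_comparison_test'[where N = 0]) (rule inc)
  then have "convergent (\<lambda>n. (\<Sum>k<n. v (Suc k) - v k) + v 0)"
    by (intro convergent_add convergent_const) (simp add: summable_iff_convergent)
  then show ?thesis by (simp add: sum_lessThan_telescope)
qed

lemma L2_nn_integral:
  assumes "f \<in> L2 M"
  shows "(\<integral>\<^sup>+x. ennreal ((cmod (f x))\<^sup>2) \<partial>M) = ennreal ((L2_norm M f)\<^sup>2)"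
  using assms by (subst nn_integral_eq_integral) (auto simp: L2_def L2_norm_def)

text \<open>Riesz--Fischer. If the squared increments of a subsequence are below
  \<open>(1/4) ^ k\<close>, the weights \<open>2 ^ k\<close> still leave a finite integral, so the
  subsequence converges almost everywhere. Fatou's lemma then bounds the distance of every late
  \<open>u m\<close> to the pointwise limit.\<close>

lemma L2_complete:
  assumes mem: "\<And>n. u n \<in> L2 M"
    and Cauchy: "\<And>e. e > 0 \<Longrightarrow> \<exists>N. \<forall>m\<ge>N. \<forall>n\<ge>N. (L2_norm M (\<lambda>x. u m x - u n x))\<^sup>2 < e"
  obtains f where "f \<in> L2 M" "(\<lambda>n. L2_norm M (\<lambda>x. u n x - f x)) \<longlonglongrightarrow> 0"
proof -
  have "\<forall>k::nat. \<exists>N. \<forall>m\<ge>N. \<forall>n\<ge>N. (L2_norm M (\<lambda>x. u m x - u n x))\<^sup>2 < (1/4) ^ k"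
    using Cauchy by simp
  then obtain N where N: "\<And>k m n. m \<ge> N k \<Longrightarrow> n \<ge> N k \<Longrightarrow> (L2_norm M (\<lambda>x. u m x - u n x))\<^sup>2 < (1/4) ^ k"
    by metis
  \<comment> \<open>Summing all earlier thresholds gives in one formula
    \<open>r k \<ge> N k\<close>, \<open>r (Suc k) \<ge> N k\<close> and, through the summand
    \<open>k\<close>, divergence to infinity.\<close>
  define r where "r k = k + (\<Sum>i\<le>k. N i)" for k
  have rN: "r k \<ge> N k" for k unfolding r_def by (intro trans_le_add2 member_le_sum) auto
  have rS: "r (Suc k) \<ge> N k" for k using rN[of k] by (simp add: r_def)
  define v where "v k = u (r k)" for k
  have vmem: "v k \<in> L2 M" for k by (simp add: v_def mem)
  have dmem: "(\<lambda>x. v (Suc k) x - v k x) \<in> L2 M" for k by (intro L2.diff_mem vmem)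
  have meas[measurable]: "v k \<in> borel_measurable M" "u k \<in> borel_measurable M" for k
    using vmem mem L2_measurable by auto
  have "(\<integral>\<^sup>+x. (\<Sum>k. ennreal (2 ^ k * (cmod (v (Suc k) x - v k x))\<^sup>2)) \<partial>M)
      = (\<Sum>k. \<integral>\<^sup>+x. ennreal (2 ^ k * (cmod (v (Suc k) x - v k x))\<^sup>2) \<partial>M)"
    by (rule nn_integral_suminf) measurable
  also have "\<dots> \<le> (\<Sum>k. ennreal ((1/2) ^ k))"
  proof (intro suminf_le)
    fix k
    have "(\<integral>\<^sup>+x. ennreal (2 ^ k * (cmod (v (Suc k) x - v k x))\<^sup>2) \<partial>M)
        = ennreal (2 ^ k) * ennreal ((L2_norm M (\<lambda>x. v (Suc k) x - v k x))\<^sup>2)"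
      by (subst L2_nn_integral[OF dmem, symmetric], subst nn_integral_cmult[symmetric])
        (auto simp: ennreal_mult')
    also have "\<dots> \<le> ennreal (2 ^ k) * ennreal ((1/4) ^ k)"
      unfolding v_def by (intro mult_left_mono ennreal_leI less_imp_le N rN rS) auto
    also have "\<dots> = ennreal ((1/2) ^ k)"
      by (simp add: ennreal_mult'[symmetric] power_mult_distrib[symmetric])
    finally show "(\<integral>\<^sup>+x. ennreal (2 ^ k * (cmod (v (Suc k) x - v k x))\<^sup>2) \<partial>M) \<le> ennreal ((1/2) ^ k)" .
  qed auto
  also have "\<dots> < \<infinity>" by (subst suminf_ennreal2) (auto intro: summable_geometric)
  finally have "AE x in M. (\<Sum>k. ennreal (2 ^ k * (cmod (v (Suc k) x - v k x))\<^sup>2)) \<noteq> \<infinity>"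
    by (intro nn_integral_PInf_AE) auto
  then have conv: "AE x in M. convergent (\<lambda>k. v k x)"
    by eventually_elim (rule convergent_of_weighted_increments)
  \<comment> \<open>\<open>lim\<close> has some value also where the sequence diverges; this
    concerns a null set and keeps \<open>f\<close> measurable.\<close>
  define f where "f x = lim (\<lambda>k. v k x)" for x
  have f_meas[measurable]: "f \<in> borel_measurable M" unfolding f_def by measurable
  have bound: "(\<integral>\<^sup>+x. ennreal ((cmod (u m x - f x))\<^sup>2) \<partial>M) \<le> ennreal e"
    if K: "\<And>n. n \<ge> K \<Longrightarrow> (L2_norm M (\<lambda>x. u m x - u n x))\<^sup>2 < e" and e: "e > 0" for m e K
  proof -
    have "(\<integral>\<^sup>+x. ennreal ((cmod (u m x - f x))\<^sup>2) \<partial>M)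
        = (\<integral>\<^sup>+x. liminf (\<lambda>k. ennreal ((cmod (u m x - v k x))\<^sup>2)) \<partial>M)"
    proof (rule nn_integral_cong_AE)
      show "AE x in M. ennreal ((cmod (u m x - f x))\<^sup>2) = liminf (\<lambda>k. ennreal ((cmod (u m x - v k x))\<^sup>2))"
        using conv
      proof eventually_elim
        case (elim x)
        then have "(\<lambda>k. v k x) \<longlonglongrightarrow> f x" by (simp add: f_def convergent_LIMSEQ_iff)
        then have "(\<lambda>k. ennreal ((cmod (u m x - v k x))\<^sup>2)) \<longlonglongrightarrow> ennreal ((cmod (u m x - f x))\<^sup>2)"
          by (intro tendsto_intros)
        then show ?case by (intro lim_imp_Liminf[symmetric]) auto
      qed
    qed
    also have "\<dots> \<le> liminf (\<lambda>k. \<integral>\<^sup>+x. ennreal ((cmod (u m x - v k x))\<^sup>2) \<partial>M)"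
      by (rule nn_integral_liminf) measurable
    also have "\<dots> \<le> limsup (\<lambda>k. \<integral>\<^sup>+x. ennreal ((cmod (u m x - v k x))\<^sup>2) \<partial>M)"
      by (rule Liminf_le_Limsup) simp
    also have "\<dots> \<le> ennreal e"
    proof (rule Limsup_bounded)
      have "eventually (\<lambda>k. r k \<ge> K) sequentially"
        unfolding eventually_sequentially r_def by (intro exI[of _ K]) auto
      then show "eventually (\<lambda>k. (\<integral>\<^sup>+x. ennreal ((cmod (u m x - v k x))\<^sup>2) \<partial>M) \<le> ennreal e) sequentially"
      proof eventually_elim
        case (elim k)
        then show ?case using K[of "r k"] e
          by (subst L2_nn_integral) (auto simp: v_def mem L2.diff_mem ennreal_leI less_imp_le)
      qed
    qed
    finally show ?thesis .
  qed
  have diff: "(\<lambda>x. u m x - f x) \<in> L2 M" "(L2_norm M (\<lambda>x. u m x - f x))\<^sup>2 \<le> e"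
    if "\<And>n. n \<ge> K \<Longrightarrow> (L2_norm M (\<lambda>x. u m x - u n x))\<^sup>2 < e" and e: "e > 0" for m e K
  proof -
    note b = bound[OF that]
    have "integrable M (\<lambda>x. (cmod (u m x - f x))\<^sup>2)"
      by (rule integrableI_bounded) (use b in \<open>auto intro: order_le_less_trans[OF b]\<close>)
    then show *: "(\<lambda>x. u m x - f x) \<in> L2 M" by (simp add: L2_def)
    show "(L2_norm M (\<lambda>x. u m x - f x))\<^sup>2 \<le> e"
      using b e by (simp add: L2_nn_integral[OF *])
  qed
  show ?thesis
  proof
    obtain K where K: "\<forall>m\<ge>K. \<forall>n\<ge>K. (L2_norm M (\<lambda>x. u m x - u n x))\<^sup>2 < 1"
      using Cauchy[of 1] by auto
    then have "(\<lambda>x. u K x - f x) \<in> L2 M" by (intro diff(1)[of K K 1]) auto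
    from L2.diff_mem[OF mem[of K] this] show "f \<in> L2 M" by simp
    show "(\<lambda>n. L2_norm M (\<lambda>x. u n x - f x)) \<longlonglongrightarrow> 0"
    proof (rule LIMSEQ_I)
      fix e :: real assume e: "e > 0"
      then have e2: "(e/2)\<^sup>2 > 0" by simp
      obtain K where K: "\<forall>m\<ge>K. \<forall>n\<ge>K. (L2_norm M (\<lambda>x. u m x - u n x))\<^sup>2 < (e/2)\<^sup>2"
        using Cauchy[OF e2] by blast
      have "norm (L2_norm M (\<lambda>x. u n x - f x) - 0) < e" if "n \<ge> K" for n
      proof -
        have "(L2_norm M (\<lambda>x. u n x - f x))\<^sup>2 \<le> (e/2)\<^sup>2"
          using K that e2 by (intro diff(2)[of K n]) auto
        then have "L2_norm M (\<lambda>x. u n x - f x) \<le> e/2"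
          using power2_le_imp_le[of "L2_norm M (\<lambda>x. u n x - f x)" "e/2"] e by simp
        then show ?thesis using e by (simp add: L2_norm_nonneg)
      qed
      then show "\<exists>no. \<forall>n\<ge>no. norm (L2_norm M (\<lambda>x. u n x - f x) - 0) < e" by blast
    qed
  qed
qed

section \<open>Closable forms and the bottom of the spectrum\<close>

text \<open>Besides closability in its sequential form, the core has to contain a function, so that
  the infimum in the variational argument is taken over a nonempty set.\<close>

locale closable_form = hermitian_form D q
  for D :: "('a \<Rightarrow> complex) set" and q :: "'a sesq_form" +
  fixes M :: "'a measure"
  assumes zero_mem: "(\<lambda>_. 0) \<in> D"
    and D_L2: "D \<subseteq> L2 M"
    and closable: "\<lbrakk>energy_Cauchy u; (\<lambda>n. L2_norm M (u n)) \<longlonglongrightarrow> 0\<rbrakk> \<Longrightarrow> (\<lambda>n. energy (u n)) \<longlonglongrightarrow> 0"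
begin

lemma mem_L2: "f \<in> D \<Longrightarrow> f \<in> L2 M"
  using D_L2 by blast

section \<open>The closure of a closable form\<close>

lemma form_approx_iff:
  "form_approx M D q u f \<longleftrightarrow> energy_Cauchy u \<and> (\<lambda>n. L2_norm M (\<lambda>x. u n x - f x)) \<longlonglongrightarrow> 0"
proof -
  have "cmod (q (\<lambda>x. u m x - u n x) (\<lambda>x. u m x - u n x)) = energy (\<lambda>x. u m x - u n x)"
    if "\<forall>n. u n \<in> D" for m n using that by (intro cmod_self diff_mem) auto
  then show ?thesis unfolding form_approx_def energy_Cauchy_def by (cases "\<forall>n. u n \<in> D") auto
qed

lemma energy_Cauchy_mem: "energy_Cauchy u \<Longrightarrow> u n \<in> D"
  by (simp add: energy_Cauchy_def)

lemma energy_Cauchy_diff: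
  assumes "energy_Cauchy u" "energy_Cauchy v"
  shows "energy_Cauchy (\<lambda>n x. u n x - v n x)"
  unfolding energy_Cauchy_def
proof (intro conjI allI impI)
  note mem = energy_Cauchy_mem[OF assms(1)] energy_Cauchy_mem[OF assms(2)]
  show "(\<lambda>x. u n x - v n x) \<in> D" for n by (intro diff_mem mem)
  fix e :: real assume "e > 0"
  then have e: "e / 4 > 0" by simp
  obtain N1 where N1: "\<forall>m\<ge>N1. \<forall>n\<ge>N1. energy (\<lambda>x. u m x - u n x) < e / 4"
    using assms(1) e unfolding energy_Cauchy_def by blast
  obtain N2 where N2: "\<forall>m\<ge>N2. \<forall>n\<ge>N2. energy (\<lambda>x. v m x - v n x) < e / 4"
    using assms(2) e unfolding energy_Cauchy_def by blast
  have "energy (\<lambda>x. u m x - v m x - (u n x - v n x)) < e"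
    if "m \<ge> max N1 N2" "n \<ge> max N1 N2" for m n
  proof -
    have "energy (\<lambda>x. (u m x - u n x) - (v m x - v n x))
        \<le> 2 * energy (\<lambda>x. u m x - u n x) + 2 * energy (\<lambda>x. v m x - v n x)"
      by (intro energy_diff_le diff_mem mem)
    moreover have "energy (\<lambda>x. u m x - u n x) < e / 4" "energy (\<lambda>x. v m x - v n x) < e / 4"
      using N1 N2 that by auto
    moreover have "(\<lambda>x. (u m x - u n x) - (v m x - v n x)) = (\<lambda>x. u m x - v m x - (u n x - v n x))"
      by (simp add: algebra_simps)
    ultimately show ?thesis by simp
  qed
  then show "\<exists>N. \<forall>m\<ge>N. \<forall>n\<ge>N. energy (\<lambda>x. u m x - v m x - (u n x - v n x)) < e" by blast
qed

text \<open>The difference of two approximations of the same \<open>f\<close> is Cauchy in energy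
  and null in \<open>L2\<close>, which is exactly the situation of closability.\<close>

lemma form_approx_energy_diff:
  assumes "f \<in> L2 M" "form_approx M D q u f" "form_approx M D q u' f"
  shows "(\<lambda>n. energy (\<lambda>x. u n x - u' n x)) \<longlonglongrightarrow> 0"
proof (rule closable)
  have C: "energy_Cauchy u" "energy_Cauchy u'" using assms by (auto simp: form_approx_iff)
  show "energy_Cauchy (\<lambda>n x. u n x - u' n x)" by (intro energy_Cauchy_diff C)
  note mem = mem_L2[OF energy_Cauchy_mem[OF C(1)]] mem_L2[OF energy_Cauchy_mem[OF C(2)]]
  have lim: "(\<lambda>n. Re (L2_inner M (\<lambda>x. u n x - f x) (\<lambda>x. u n x - f x))) \<longlonglongrightarrow> 0"
    "(\<lambda>n. Re (L2_inner M (\<lambda>x. u' n x - f x) (\<lambda>x. u' n x - f x))) \<longlonglongrightarrow> 0"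
    using assms by (auto simp: form_approx_iff simp flip: L2_norm_tendsto_0_iff)
  have "(\<lambda>n. Re (L2_inner M (\<lambda>x. u n x - u' n x) (\<lambda>x. u n x - u' n x))) \<longlonglongrightarrow> 0"
  proof (rule tendsto_sandwich[OF always_eventually always_eventually tendsto_const])
    show "(\<lambda>n. 2 * Re (L2_inner M (\<lambda>x. u n x - f x) (\<lambda>x. u n x - f x))
        + 2 * Re (L2_inner M (\<lambda>x. u' n x - f x) (\<lambda>x. u' n x - f x))) \<longlonglongrightarrow> 0"
      using tendsto_add[OF tendsto_mult[OF tendsto_const[of 2] lim(1)] tendsto_mult[OF tendsto_const[of 2] lim(2)]]
      by simp
    show "\<forall>n. Re (L2_inner M (\<lambda>x. u n x - u' n x) (\<lambda>x. u n x - u' n x))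
      \<le> 2 * Re (L2_inner M (\<lambda>x. u n x - f x) (\<lambda>x. u n x - f x))
        + 2 * Re (L2_inner M (\<lambda>x. u' n x - f x) (\<lambda>x. u' n x - f x))"
      using L2.energy_diff_le[OF L2.diff_mem[OF mem(1) assms(1)] L2.diff_mem[OF mem(2) assms(1)]] by simp
    show "\<forall>n. 0 \<le> Re (L2_inner M (\<lambda>x. u n x - u' n x) (\<lambda>x. u n x - u' n x))"
      by (simp add: L2_energy)
  qed
  then show "(\<lambda>n. L2_norm M (\<lambda>x. u n x - u' n x)) \<longlonglongrightarrow> 0" by (simp add: L2_norm_tendsto_0_iff)
qed

text \<open>This gives meaning to the definite description in \<open>closure_form\<close>: the limit
  exists because the form values are Cauchy, and two choices of approximating sequences differ by
  null sequences in energy.\<close>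

lemma closure_form_tendsto:
  assumes L2: "f \<in> L2 M" "g \<in> L2 M"
    and u: "form_approx M D q u f" and v: "form_approx M D q v g"
  shows "(\<lambda>n. q (u n) (v n)) \<longlonglongrightarrow> closure_form M D q f g"
proof -
  have Cu: "energy_Cauchy u" and Cv: "energy_Cauchy v" using u v by (auto simp: form_approx_iff)
  obtain c where c: "(\<lambda>n. q (u n) (v n)) \<longlonglongrightarrow> c"
    using Cauchy_form_convergent[OF Cu Cv] by (auto simp: convergent_def)
  have "(\<lambda>n. q (u' n) (v' n)) \<longlonglongrightarrow> c"
    if u': "form_approx M D q u' f" and v': "form_approx M D q v' g" for u' v'
  proof -
    have Cu': "energy_Cauchy u'" and Cv': "energy_Cauchy v'"
      using u' v' by (auto simp: form_approx_iff)
    obtain B1 where B1: "\<And>n. energy (v n) \<le> B1\<^sup>2" using energy_Cauchy_bounded[OF Cv] by blast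
    obtain B2 where B2: "\<And>n. energy (u' n) \<le> B2\<^sup>2" using energy_Cauchy_bounded[OF Cu'] by blast
    have "(\<lambda>n. q (u n) (v n) - q (u' n) (v' n)) \<longlonglongrightarrow> 0"
    proof (rule form_diff_tendsto_0[where B = "max (B1\<^sup>2) (B2\<^sup>2)"])
      show "(\<lambda>n. energy (\<lambda>x. u n x - u' n x)) \<longlonglongrightarrow> 0" "(\<lambda>n. energy (\<lambda>x. v n x - v' n x)) \<longlonglongrightarrow> 0"
        using form_approx_energy_diff L2 u u' v v' by blast+
    qed (use Cu Cv Cu' Cv' B1 B2 in \<open>auto intro: energy_Cauchy_mem max.coboundedI1 max.coboundedI2\<close>)
    from tendsto_diff[OF c this] show ?thesis by simp
  qed
  then have "closure_form M D q f g = c"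
    unfolding closure_form_def by (intro the_equality) (use c u v LIMSEQ_unique in blast)+
  then show ?thesis using c by simp
qed

lemma form_approx_const:
  assumes "f \<in> D"
  shows "form_approx M D q (\<lambda>_. f) f"
proof -
  have "L2_norm M (\<lambda>x. f x - f x) = 0" by (simp add: L2_norm_def)
  moreover have "energy (\<lambda>x. f x - f x) = 0"
    using diff_left[OF assms assms diff_mem[OF assms assms]] by simp
  ultimately show ?thesis using assms by (simp add: form_approx_iff energy_Cauchy_def)
qed

lemma mem_closure_domain: "f \<in> D \<Longrightarrow> f \<in> closure_domain M D q"
  using form_approx_const by (auto simp: closure_domain_def mem_L2)

text \<open>A lower bound \<open>m\<close> makes \<open>q - m\<close> non-negative, so that
  Cauchy--Schwarz and the parallelogram law hold for the shifted form.\<close>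

lemma shifted_form:
  assumes "\<And>u. u \<in> D \<Longrightarrow> m * (L2_norm M u)\<^sup>2 \<le> energy u"
  shows "hermitian_form D (\<lambda>f g. q f g - complex_of_real m * L2_inner M f g)"
proof
  fix f g h :: "'a \<Rightarrow> complex" and c
  assume f: "f \<in> D"
  show "0 \<le> Re (q f f - complex_of_real m * L2_inner M f f)"
    using assms[OF f] by (simp add: L2_energy)
  assume g: "g \<in> D"
  show "q g f - complex_of_real m * L2_inner M g f = cnj (q f g - complex_of_real m * L2_inner M f g)"
    using f g hermitian[OF f g] L2.hermitian[OF mem_L2[OF f] mem_L2[OF g]] by simp
  assume h: "h \<in> D"
  show "q (\<lambda>x. f x + g x) h - complex_of_real m * L2_inner M (\<lambda>x. f x + g x) h
      = q f h - complex_of_real m * L2_inner M f h + (q g h - complex_of_real m * L2_inner M g h)"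
    using f g h by (simp add: add_left L2.add_left mem_L2 algebra_simps)
qed (auto simp: add_mem scale_mem scale_left L2.scale_left mem_L2 algebra_simps)

section \<open>Resolvent set and form bounds\<close>

lemma form_operatorE:
  assumes "(f, k) \<in> form_operator M D q"
  obtains w where "f \<in> closure_domain M D q" "f \<in> L2 M" "k \<in> L2 M" "form_approx M D q w f" "\<And>n. w n \<in> D"
    "(\<lambda>n. L2_norm M (\<lambda>x. w n x - f x)) \<longlonglongrightarrow> 0"
    "\<And>g. g \<in> closure_domain M D q \<Longrightarrow> closure_form M D q f g = L2_inner M k g"
  using assms by (auto simp: form_operator_def closure_domain_def form_approx_def)

text \<open>If \<open>m\<close> is in the resolvent set and \<open>f = (T - m)\<inverse> u\<close>, then \<open>\<parallel>u\<parallel>\<^sup>2 = s(f, u)\<close> for the shifted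
  form \<open>s = q - m\<close>, and Cauchy--Schwarz for \<open>s\<close> together with \<open>s(f, f) = \<langle>u, f\<rangle> \<le> C \<parallel>u\<parallel>\<^sup>2\<close> gives a strictly
  better lower bound for the form.\<close>

lemma resolvent_improves_bound:
  assumes m: "\<And>u. u \<in> D \<Longrightarrow> m * (L2_norm M u)\<^sup>2 \<le> energy u"
    and res: "complex_of_real m \<in> resolvent_set M (form_operator M D q)"
  shows "\<exists>C>0. \<forall>u\<in>D. (L2_norm M u)\<^sup>2 \<le> C * (energy u - m * (L2_norm M u)\<^sup>2)"
proof -
  let ?T = "form_operator M D q"
  let ?s = "\<lambda>f g. q f g - complex_of_real m * L2_inner M f g"
  interpret s: hermitian_form D ?s by (rule shifted_form[OF m])
  obtain C0 where C0: "\<forall>(f, k)\<in>?T. L2_norm M f \<le> C0 * L2_norm M (\<lambda>x. k x - complex_of_real m * f x)"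
    using res unfolding resolvent_set_def by blast
  \<comment> \<open>The resolvent estimate does not fix the sign of its constant; the maximum with 1
    makes it positive.\<close>
  define C where "C = max C0 1"
  have C: "L2_norm M f \<le> C * L2_norm M (\<lambda>x. k x - complex_of_real m * f x)" if "(f, k) \<in> ?T" for f k
    using C0 that L2_norm_nonneg[of M "\<lambda>x. k x - complex_of_real m * f x"]
    by (force simp: C_def intro: order_trans mult_right_mono)
  have "(L2_norm M u)\<^sup>2 \<le> C * (energy u - m * (L2_norm M u)\<^sup>2)" if u: "u \<in> D" for u
  proof -
    have uL: "u \<in> L2 M" using u by (rule mem_L2)
    obtain f k where fk: "(f, k) \<in> ?T" and eq: "AE x in M. k x - complex_of_real m * f x = u x"
      using res uL unfolding resolvent_set_def by blast
    obtain w where f: "f \<in> closure_domain M D q" and fL: "f \<in> L2 M" and kL: "k \<in> L2 M"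
      and w: "form_approx M D q w f" and wmem: "\<And>n. w n \<in> D"
      and wlim: "(\<lambda>n. L2_norm M (\<lambda>x. w n x - f x)) \<longlonglongrightarrow> 0"
      and op: "\<And>g. g \<in> closure_domain M D q \<Longrightarrow> closure_form M D q f g = L2_inner M k g"
      by (rule form_operatorE[OF fk], rule that)
    have rL: "(\<lambda>x. k x - complex_of_real m * f x) \<in> L2 M" by (intro L2.diff_mem kL L2.scale_mem fL)
    have shift: "L2_inner M k g - complex_of_real m * L2_inner M f g = L2_inner M u g" if g: "g \<in> L2 M" for g
      using L2_inner_cong_AE[OF eq _ rL uL g g]
      by (simp add: L2.diff_left L2.scale_left L2.scale_mem kL fL g)
    \<comment> \<open>\<open>f\<close> lies only in the domain of the closure, so Cauchy--Schwarz is
      applied to its approximations \<open>w n\<close> in the core and carried to the limit.\<close>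
    have lim1: "(\<lambda>n. ?s (w n) u) \<longlonglongrightarrow> L2_inner M u u"
      unfolding shift[OF uL, symmetric] op[OF mem_closure_domain[OF u], symmetric]
      by (intro tendsto_intros closure_form_tendsto[OF fL uL w form_approx_const[OF u]]
          L2_inner_tendsto[OF mem_L2[OF wmem] uL fL uL wlim]) (simp add: L2_norm_def)
    have lim2: "(\<lambda>n. ?s (w n) (w n)) \<longlonglongrightarrow> L2_inner M u f"
      unfolding shift[OF fL, symmetric] op[OF f, symmetric]
      by (intro tendsto_intros closure_form_tendsto[OF fL fL w w]
          L2_inner_tendsto[OF mem_L2[OF wmem] mem_L2[OF wmem] fL fL wlim wlim])
    have "(cmod (L2_inner M u u))\<^sup>2 \<le> Re (L2_inner M u f) * Re (?s u u)"
    proof (rule LIMSEQ_le)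
      show "(\<lambda>n. (cmod (?s (w n) u))\<^sup>2) \<longlonglongrightarrow> (cmod (L2_inner M u u))\<^sup>2"
        by (intro tendsto_intros lim1)
      show "(\<lambda>n. Re (?s (w n) (w n)) * Re (?s u u)) \<longlonglongrightarrow> Re (L2_inner M u f) * Re (?s u u)"
        by (intro tendsto_intros lim2)
      show "\<exists>N. \<forall>n\<ge>N. (cmod (?s (w n) u))\<^sup>2 \<le> Re (?s (w n) (w n)) * Re (?s u u)"
        using s.cauchy_schwarz[OF wmem u] by blast
    qed
    moreover have "Re (L2_inner M u f) \<le> C * (L2_norm M u)\<^sup>2"
    proof -
      have "L2_norm M (\<lambda>x. k x - complex_of_real m * f x) = L2_norm M u"
        using L2_inner_cong_AE[OF eq eq rL uL rL uL] L2_norm_nonneg[of M]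
        by (metis (lifting) L2_energy power2_eq_imp_eq)
      then have "L2_norm M f \<le> C * L2_norm M u" using C[OF fk] by simp
      then have "L2_norm M u * L2_norm M f \<le> L2_norm M u * (C * L2_norm M u)"
        by (intro mult_left_mono L2_norm_nonneg)
      then show ?thesis
        using L2_cauchy_schwarz[OF uL fL] complex_Re_le_cmod[of "L2_inner M u f"]
        by (simp add: power2_eq_square mult_ac)
    qed
    moreover have "cmod (L2_inner M u u) = (L2_norm M u)\<^sup>2"
      by (simp add: L2_inner_self del: of_real_power)
    ultimately have "((L2_norm M u)\<^sup>2)\<^sup>2 \<le> C * (L2_norm M u)\<^sup>2 * Re (?s u u)"
      using mult_right_mono[OF _ s.nonneg[OF u], of "Re (L2_inner M u f)" "C * (L2_norm M u)\<^sup>2"] by simp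
    then have le: "(L2_norm M u)\<^sup>2 * (L2_norm M u)\<^sup>2 \<le> (L2_norm M u)\<^sup>2 * (C * Re (?s u u))"
      by (simp add: power2_eq_square mult_ac)
    have "(L2_norm M u)\<^sup>2 \<le> C * Re (?s u u)"
    proof (cases "L2_norm M u = 0")
      case True
      then show ?thesis using s.nonneg[OF u] by (simp add: C_def)
    next
      case False
      then have "(L2_norm M u)\<^sup>2 > 0" by simp
      then show ?thesis using le mult_le_cancel_left_pos by blast
    qed
    then show ?thesis by (simp add: L2_energy)
  qed
  moreover have "C > 0" by (simp add: C_def)
  ultimately show ?thesis by blast
qed

text \<open>If the bound failed, the infimum \<open>m\<close> of the Rayleigh quotients would be
  below \<open>b\<close>, hence in the resolvent set; then \<open>m + 1 / C\<close> would also be a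
  lower bound for the quotients, against the choice of \<open>m\<close>.\<close>

lemma form_bound_of_resolvent:
  assumes res: "\<And>\<mu>. \<mu> < b \<Longrightarrow> complex_of_real \<mu> \<in> resolvent_set M (form_operator M D q)"
    and u: "u \<in> D"
  shows "b * (L2_norm M u)\<^sup>2 \<le> energy u"
proof (rule ccontr)
  assume less: "\<not> ?thesis"
  let ?R = "(\<lambda>u. energy u / (L2_norm M u)\<^sup>2) ` {u \<in> D. L2_norm M u \<noteq> 0}"
  define m where "m = Inf ?R"
  have u0: "L2_norm M u \<noteq> 0" using less nonneg[OF u] by auto
  have bdd: "bdd_below ?R" by (rule bdd_belowI2[of _ 0]) (simp add: nonneg)
  have "m \<le> energy u / (L2_norm M u)\<^sup>2"
    unfolding m_def by (rule cInf_lower[OF _ bdd]) (use u u0 in auto)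
  also have "\<dots> < b" using less u0 by (simp add: field_simps)
  finally have "m < b" .
  have m: "m * (L2_norm M v)\<^sup>2 \<le> energy v" if v: "v \<in> D" for v
  proof (cases "L2_norm M v = 0")
    case True
    then show ?thesis using nonneg[OF v] by simp
  next
    case False
    then have "m \<le> energy v / (L2_norm M v)\<^sup>2"
      unfolding m_def by (intro cInf_lower[OF _ bdd]) (use v in auto)
    then show ?thesis using False by (simp add: field_simps)
  qed
  obtain C where C: "C > 0" "\<And>v. v \<in> D \<Longrightarrow> (L2_norm M v)\<^sup>2 \<le> C * (energy v - m * (L2_norm M v)\<^sup>2)"
    using resolvent_improves_bound[OF m res[OF \<open>m < b\<close>]] by blast
  have "m + 1 / C \<le> Inf ?R"
  proof (rule cInf_greatest)
    fix y assume "y \<in> ?R"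
    then obtain v where v: "v \<in> D" "L2_norm M v \<noteq> 0" "y = energy v / (L2_norm M v)\<^sup>2" by auto
    then have p: "(L2_norm M v)\<^sup>2 > 0" by simp
    have "(m + 1 / C) * (L2_norm M v)\<^sup>2 \<le> energy v" using C(2)[OF v(1)] C(1) by (simp add: field_simps)
    then show "m + 1 / C \<le> y" unfolding v(3) using p by (simp add: pos_le_divide_eq)
  qed (use u u0 in auto)
  then show False using C(1) by (simp add: m_def)
qed

text \<open>Below the bound, \<open>(T - \<mu>) f = h\<close> is solved by minimising \<open>J(u) = s(u, u) - 2 Re \<langle>h, u\<rangle>\<close> over the core, where
  \<open>s = q - \<mu>\<close>: the parallelogram identity makes minimising sequences Cauchy, and the first variation shows that
  their limit is a weak solution.\<close>

lemma resolvent_of_form_bound: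
  assumes bound: "\<And>u. u \<in> D \<Longrightarrow> b * (L2_norm M u)\<^sup>2 \<le> energy u" and less: "\<mu> < b"
  shows "complex_of_real \<mu> \<in> resolvent_set M (form_operator M D q)"
proof -
  let ?T = "form_operator M D q"
  let ?s = "\<lambda>f g. q f g - complex_of_real \<mu> * L2_inner M f g"
  define d where "d = b - \<mu>"
  have d: "d > 0" using less by (simp add: d_def)
  have \<mu>_bound: "\<mu> * (L2_norm M u)\<^sup>2 \<le> energy u" if "u \<in> D" for u
    using bound[OF that] less mult_right_mono[of \<mu> b "(L2_norm M u)\<^sup>2"] by auto
  interpret s: hermitian_form D ?s by (rule shifted_form[OF \<mu>_bound])
  have s_energy: "s.energy u = energy u - \<mu> * (L2_norm M u)\<^sup>2" for u by (simp add: L2_energy)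
  have coercive: "d * (L2_norm M u)\<^sup>2 \<le> s.energy u" if "u \<in> D" for u
    using bound[OF that] unfolding s_energy d_def by (simp add: algebra_simps)
  have "\<exists>(f, k)\<in>?T. AE x in M. k x - complex_of_real \<mu> * f x = h x" if h: "h \<in> L2 M" for h
  proof -
    define J where "J u = s.energy u - 2 * Re (L2_inner M h u)" for u
    define j where "j = Inf (J ` D)"
    \<comment> \<open>Completing the square in \<open>L2_norm M u\<close>, after coercivity has
      bounded the quadratic part from below.\<close>
    have J_ge: "- (L2_norm M h)\<^sup>2 / d \<le> J u" if u: "u \<in> D" for u
    proof -
      have "Re (L2_inner M h u) \<le> L2_norm M h * L2_norm M u"
        using L2_cauchy_schwarz[OF h mem_L2[OF u]] complex_Re_le_cmod order_trans by blast
      then have *: "d * (L2_norm M u)\<^sup>2 - 2 * (L2_norm M h * L2_norm M u) \<le> J u"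
        using coercive[OF u] by (simp add: J_def)
      have "0 \<le> (d * L2_norm M u - L2_norm M h)\<^sup>2" by simp
      also have "\<dots> = d * (d * (L2_norm M u)\<^sup>2 - 2 * (L2_norm M h * L2_norm M u)) + (L2_norm M h)\<^sup>2"
        by (simp add: power2_eq_square algebra_simps)
      also have "\<dots> \<le> d * J u + (L2_norm M h)\<^sup>2" using * d by (intro add_mono mult_left_mono) auto
      finally show ?thesis using d by (simp add: field_simps)
    qed
    have bdd: "bdd_below (J ` D)" using J_ge by (intro bdd_belowI2)
    have j: "j \<le> J u" if "u \<in> D" for u unfolding j_def using that by (intro cInf_lower[OF _ bdd]) auto
    have "\<exists>u\<in>D. J u < j + 1 / real (Suc n)" for n
    proof -
      have "\<exists>y\<in>J ` D. y < j + 1 / real (Suc n)"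
        unfolding j_def by (rule cInf_lessD) (use zero_mem in auto)
      then show ?thesis by auto
    qed
    then obtain u where u: "\<And>n. u n \<in> D" and uJ: "\<And>n. J (u n) < j + 1 / real (Suc n)" by metis
    \<comment> \<open>The midpoint of \<open>u m\<close> and \<open>u n\<close> cannot bring
      \<open>J\<close> below \<open>j\<close>, while both endpoints nearly attain \<open>j\<close>;
      the parallelogram identity converts this into smallness of the difference.\<close>
    have s_Cauchy: "s.energy (\<lambda>x. u m x - u n x) \<le> 2 / real (Suc m) + 2 / real (Suc n)" for m n
    proof -
      let ?p = "\<lambda>x. u m x + u n x"
      have p: "?p \<in> D" by (intro add_mem u)
      have half: "Re (L2_inner M h (\<lambda>x. 1/2 * ?p x)) = Re (L2_inner M h ?p) / 2"
        by (subst L2.scale_right[OF h mem_L2[OF p]]) simp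
      have "J (\<lambda>x. 1/2 * ?p x) = s.energy ?p / 4 - Re (L2_inner M h ?p)"
        unfolding J_def s.energy_scale[OF p] half by (simp add: power2_eq_square)
      also have "L2_inner M h ?p = L2_inner M h (u m) + L2_inner M h (u n)"
        by (intro L2.add_right mem_L2 u h)
      finally have "4 * j \<le> s.energy ?p - 4 * Re (L2_inner M h (u m)) - 4 * Re (L2_inner M h (u n))"
        using j[OF scale_mem[OF p, of "1/2"]] unfolding plus_complex.sel by linarith
      then show ?thesis
        using s.parallelogram[OF u[of m] u[of n]] uJ[of m] uJ[of n] unfolding J_def by linarith
    qed
    have s_small: "\<exists>N. \<forall>m\<ge>N. \<forall>n\<ge>N. s.energy (\<lambda>x. u m x - u n x) < e" if e: "e > 0" for e :: real
    proof -
      obtain N where N: "1 / real (Suc N) < e / 4" using nat_approx_posE[of "e/4"] e by auto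
      have "s.energy (\<lambda>x. u m x - u n x) < e" if "m \<ge> N" "n \<ge> N" for m n
      proof -
        have "1 / real (Suc m) \<le> 1 / real (Suc N)" "1 / real (Suc n) \<le> 1 / real (Suc N)"
          using that by (auto simp: frac_le)
        then show ?thesis using s_Cauchy[of m n] N by simp
      qed
      then show ?thesis by blast
    qed
    have L2_small: "\<exists>N. \<forall>m\<ge>N. \<forall>n\<ge>N. (L2_norm M (\<lambda>x. u m x - u n x))\<^sup>2 < e" if e: "e > 0" for e
    proof -
      obtain N where N: "\<forall>m\<ge>N. \<forall>n\<ge>N. s.energy (\<lambda>x. u m x - u n x) < d * e"
        using s_small[of "d * e"] d e by auto
      have "(L2_norm M (\<lambda>x. u m x - u n x))\<^sup>2 < e" if "m \<ge> N" "n \<ge> N" for m n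
      proof -
        have "d * (L2_norm M (\<lambda>x. u m x - u n x))\<^sup>2 < d * e"
          using N that coercive[OF diff_mem[OF u u], of m n] by (meson order_le_less_trans)
        then show ?thesis using d by simp
      qed
      then show ?thesis by blast
    qed
    obtain f where f: "f \<in> L2 M" and lim: "(\<lambda>n. L2_norm M (\<lambda>x. u n x - f x)) \<longlonglongrightarrow> 0"
      using L2_complete[OF mem_L2[OF u] L2_small] by blast
    have "energy_Cauchy u"
      unfolding energy_Cauchy_def
    proof (intro conjI allI impI u)
      fix e :: real assume e: "e > 0"
      \<comment> \<open>The minimising sequence is Cauchy for the shifted form, whereas the closure
        refers to \<open>q\<close>. By coercivity the term
        \<open>\<mu> * (L2_norm M w)\<^sup>2\<close> costs at most the factor
        \<open>\<bar>\<mu>\<bar> / d\<close>.\<close>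
      define K where "K = 1 + \<bar>\<mu>\<bar> / d"
      have K: "K > 0" using d by (simp add: K_def add_pos_nonneg)
      obtain N where N: "\<forall>m\<ge>N. \<forall>n\<ge>N. s.energy (\<lambda>x. u m x - u n x) < e / K"
        using s_small[of "e / K"] e K by auto
      have "energy (\<lambda>x. u m x - u n x) < e" if "m \<ge> N" "n \<ge> N" for m n
      proof -
        let ?w = "\<lambda>x. u m x - u n x"
        have "\<mu> * (L2_norm M ?w)\<^sup>2 \<le> \<bar>\<mu>\<bar> / d * (d * (L2_norm M ?w)\<^sup>2)"
          using d by (simp add: mult_right_mono)
        also have "\<dots> \<le> \<bar>\<mu>\<bar> / d * s.energy ?w"
          using d by (intro mult_left_mono coercive diff_mem u) auto
        finally have "energy ?w \<le> K * s.energy ?w" unfolding K_def s_energy by (simp add: algebra_simps)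
        moreover have "K * s.energy ?w < e" using N that K by (simp add: field_simps)
        ultimately show ?thesis by linarith
      qed
      then show "\<exists>N. \<forall>m\<ge>N. \<forall>n\<ge>N. energy (\<lambda>x. u m x - u n x) < e" by blast
    qed
    then have fa: "form_approx M D q u f" using lim by (simp add: form_approx_iff)
    then have fc: "f \<in> closure_domain M D q" using f by (auto simp: closure_domain_def)
    have weak: "(cmod (?s (u n) g - L2_inner M h g))\<^sup>2 \<le> (s.energy g + 1) / real (Suc n)"
      if g: "g \<in> D" for g n
    proof -
      define c where "c = ?s (u n) g - L2_inner M h g"
      define S where "S = s.energy g"
      have S: "S \<ge> 0" unfolding S_def using g by (rule s.nonneg)
      \<comment> \<open>A nearly optimal descent step along \<open>g\<close>: it would lower
        \<open>J\<close> by at least \<open>(cmod c)\<^sup>2 / (S + 1)\<close>, but only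
        \<open>1 / real (Suc n)\<close> is available. The summand 1 avoids a zero denominator when
        \<open>S = 0\<close>.\<close>
      define t where "t = complex_of_real (- (1 / (S + 1))) * c"
      have "J (\<lambda>x. u n x + t * g x) = J (u n) + 2 * Re (cnj t * c) + (cmod t)\<^sup>2 * S"
        unfolding J_def s.energy_expand[OF u g] c_def S_def
        using h mem_L2[OF u] mem_L2[OF g]
        by (simp add: L2.add_right L2.scale_right L2.scale_mem algebra_simps)
      moreover have "j \<le> J (\<lambda>x. u n x + t * g x)" by (intro j add_mem scale_mem u g)
      moreover have "Re (cnj t * c) = - ((cmod c)\<^sup>2 / (S + 1))"
      proof -
        have "cnj t * c = complex_of_real (- ((cmod c)\<^sup>2 / (S + 1)))"
          unfolding t_def of_real_minus of_real_divide complex_norm_square by simp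
        then show ?thesis by (metis Re_complex_of_real)
      qed
      moreover have "(cmod t)\<^sup>2 * S \<le> (cmod c)\<^sup>2 / (S + 1)"
      proof -
        have ct: "cmod t = cmod c / (S + 1)"
          unfolding t_def norm_mult norm_of_real using S by simp
        have "(cmod t)\<^sup>2 * S = (cmod c)\<^sup>2 / (S + 1) * (S / (S + 1))"
          unfolding ct using S by (simp add: power2_eq_square)
        also have "\<dots> \<le> (cmod c)\<^sup>2 / (S + 1) * 1" using S by (intro mult_left_mono) auto
        finally show ?thesis by simp
      qed
      ultimately have "(cmod c)\<^sup>2 / (S + 1) \<le> 1 / real (Suc n)" using uJ[of n] by linarith
      then show ?thesis using S unfolding c_def[symmetric] S_def[symmetric] by (simp add: field_simps)
    qed
    define k where "k x = h x + complex_of_real \<mu> * f x" for x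
    have kL: "k \<in> L2 M" unfolding k_def by (intro L2_add L2_scale h f)
    have "closure_form M D q f g = L2_inner M k g" if gc: "g \<in> closure_domain M D q" for g
    proof -
      obtain v where v: "form_approx M D q v g" and g: "g \<in> L2 M"
        using gc by (auto simp: closure_domain_def)
      have Cv: "energy_Cauchy v" and vlim: "(\<lambda>n. L2_norm M (\<lambda>x. v n x - g x)) \<longlonglongrightarrow> 0"
        using v by (auto simp: form_approx_iff)
      have vmem: "v n \<in> D" for n using Cv by (rule energy_Cauchy_mem)
      obtain B where B: "\<And>n. energy (v n) \<le> B\<^sup>2" using energy_Cauchy_bounded[OF Cv] by blast
      obtain B' where B': "\<And>n. Re (L2_inner M (v n) (v n)) \<le> B'"
        using L2_bounded_of_tendsto[OF mem_L2[OF vmem] g vlim] by blast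
      define B2 where "B2 = B\<^sup>2 + \<bar>\<mu>\<bar> * B' + 1"
      have sB: "s.energy (v n) + 1 \<le> B2" for n
      proof -
        have "- \<mu> * (L2_norm M (v n))\<^sup>2 \<le> \<bar>\<mu>\<bar> * (L2_norm M (v n))\<^sup>2" by (intro mult_right_mono) auto
        also have "\<dots> \<le> \<bar>\<mu>\<bar> * B'" using B'[of n] by (intro mult_left_mono) (auto simp: L2_energy)
        finally show ?thesis unfolding s_energy B2_def using B[of n] by linarith
      qed
      \<comment> \<open>The estimate \<open>weak\<close> is uniform over test functions of bounded
        shifted energy, so the test function may move along the approximation \<open>v n\<close> of
        \<open>g\<close>.\<close>
      have "(\<lambda>n. ?s (u n) (v n) - L2_inner M h (v n)) \<longlonglongrightarrow> 0"
      proof (rule Lim_null_comparison)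
        show "\<forall>\<^sub>F n in sequentially. norm (?s (u n) (v n) - L2_inner M h (v n)) \<le> sqrt (B2 / real (Suc n))"
        proof (intro always_eventually allI real_le_rsqrt)
          show "(cmod (?s (u n) (v n) - L2_inner M h (v n)))\<^sup>2 \<le> B2 / real (Suc n)" for n
            using weak[OF vmem] sB[of n] by (meson divide_right_mono of_nat_0_le_iff order_trans)
        qed
        have "(\<lambda>n. B2 * inverse (real (Suc n))) \<longlonglongrightarrow> B2 * 0"
          by (intro tendsto_intros LIMSEQ_inverse_real_of_nat)
        then have "(\<lambda>n. sqrt (B2 * inverse (real (Suc n)))) \<longlonglongrightarrow> sqrt (B2 * 0)"
          by (rule tendsto_real_sqrt)
        then show "(\<lambda>n. sqrt (B2 / real (Suc n))) \<longlonglongrightarrow> 0" by (simp add: divide_inverse)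
      qed
      moreover have "(\<lambda>n. ?s (u n) (v n) - L2_inner M h (v n))
          \<longlonglongrightarrow> closure_form M D q f g - complex_of_real \<mu> * L2_inner M f g - L2_inner M h g"
        by (intro tendsto_intros closure_form_tendsto[OF f g fa v]
            L2_inner_tendsto[OF mem_L2[OF u] mem_L2[OF vmem] f g lim vlim]
            L2_inner_tendsto[OF h mem_L2[OF vmem] h g _ vlim]) (simp add: L2_norm_def)
      ultimately have "closure_form M D q f g - complex_of_real \<mu> * L2_inner M f g - L2_inner M h g = 0"
        by (rule LIMSEQ_unique[rotated])
      moreover have "L2_inner M k g = L2_inner M h g + complex_of_real \<mu> * L2_inner M f g"
        unfolding k_def by (simp add: L2.add_left L2.scale_left L2.scale_mem h f g)
      ultimately show ?thesis by (simp add: algebra_simps)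
    qed
    then have "(f, k) \<in> ?T" using fc kL by (simp add: form_operator_def)
    then show ?thesis by (intro bexI[of _ "(f, k)"]) (auto simp: k_def)
  qed
  \<comment> \<open>Coercivity extended to the closure bounds the inverse by the reciprocal of the
    distance from \<open>\<mu>\<close> to \<open>b\<close>.\<close>
  moreover have "L2_norm M f \<le> 1 / d * L2_norm M (\<lambda>x. k x - complex_of_real \<mu> * f x)" if fk: "(f, k) \<in> ?T" for f k
  proof -
    obtain w where f: "f \<in> closure_domain M D q" and fL: "f \<in> L2 M" and kL: "k \<in> L2 M"
      and w: "form_approx M D q w f" and wmem: "\<And>n. w n \<in> D"
      and wlim: "(\<lambda>n. L2_norm M (\<lambda>x. w n x - f x)) \<longlonglongrightarrow> 0"
      and op: "\<And>g. g \<in> closure_domain M D q \<Longrightarrow> closure_form M D q f g = L2_inner M k g"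
      by (rule form_operatorE[OF fk], rule that)
    let ?r = "\<lambda>x. k x - complex_of_real \<mu> * f x"
    have rL: "?r \<in> L2 M" by (intro L2.diff_mem kL L2.scale_mem fL)
    have inner_lim: "(\<lambda>n. L2_inner M (w n) (w n)) \<longlonglongrightarrow> L2_inner M f f"
      by (rule L2_inner_tendsto[OF mem_L2[OF wmem] mem_L2[OF wmem] fL fL wlim wlim])
    have "d * Re (L2_inner M f f) \<le> Re (closure_form M D q f f - complex_of_real \<mu> * L2_inner M f f)"
    proof (rule LIMSEQ_le)
      show "(\<lambda>n. d * Re (L2_inner M (w n) (w n))) \<longlonglongrightarrow> d * Re (L2_inner M f f)"
        by (intro tendsto_intros inner_lim)
      show "(\<lambda>n. Re (?s (w n) (w n))) \<longlonglongrightarrow> Re (closure_form M D q f f - complex_of_real \<mu> * L2_inner M f f)"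
        by (intro tendsto_intros inner_lim closure_form_tendsto[OF fL fL w w])
      show "\<exists>N. \<forall>n\<ge>N. d * Re (L2_inner M (w n) (w n)) \<le> Re (?s (w n) (w n))"
        using coercive[OF wmem] by (auto simp: L2_energy)
    qed
    also have "closure_form M D q f f - complex_of_real \<mu> * L2_inner M f f = L2_inner M ?r f"
      using op[OF f] by (simp add: L2.diff_left L2.scale_left L2.scale_mem kL fL)
    also have "Re (L2_inner M ?r f) \<le> L2_norm M ?r * L2_norm M f"
      using L2_cauchy_schwarz[OF rL fL] complex_Re_le_cmod order_trans by blast
    finally have le: "L2_norm M f * (d * L2_norm M f) \<le> L2_norm M f * L2_norm M ?r"
      by (simp add: L2_energy power2_eq_square mult_ac)
    have "d * L2_norm M f \<le> L2_norm M ?r"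
    proof (cases "L2_norm M f = 0")
      case False
      then have "L2_norm M f > 0" using L2_norm_nonneg[of M f] by linarith
      then show ?thesis using le by simp
    qed (simp add: L2_norm_nonneg)
    then show ?thesis using d by (simp add: field_simps)
  qed
  ultimately show ?thesis unfolding resolvent_set_def by blast
qed

text \<open>Quantifying over all real \<open>b\<close> determines \<open>inf_spectrum\<close>
  completely, also when no real number lies in the spectrum and the infimum is
  \<open>\<infinity>\<close>.\<close>

theorem le_inf_spectrum_iff:
  "ereal b \<le> inf_spectrum M (form_operator M D q) \<longleftrightarrow> (\<forall>u\<in>D. b * (L2_norm M u)\<^sup>2 \<le> energy u)"
proof -
  have "ereal b \<le> inf_spectrum M (form_operator M D q)
      \<longleftrightarrow> (\<forall>\<mu><b. complex_of_real \<mu> \<in> resolvent_set M (form_operator M D q))"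
    unfolding inf_spectrum_def spectrum_def le_INF_iff by (force simp: not_le)
  also have "\<dots> \<longleftrightarrow> (\<forall>u\<in>D. b * (L2_norm M u)\<^sup>2 \<le> energy u)"
    using form_bound_of_resolvent resolvent_of_form_bound by blast
  finally show ?thesis .
qed

end

section \<open>Compactly supported functions\<close>

abbreviation frechet :: "('a::real_normed_vector \<Rightarrow> complex) \<Rightarrow> 'a \<Rightarrow> 'a \<Rightarrow> complex" where
  "frechet f x \<equiv> frechet_derivative f (at x)"

lemma C1_onE:
  assumes "C1_on S f"
  obtains D where "\<And>x. x \<in> S \<Longrightarrow> (f has_derivative blinfun_apply (D x)) (at x)" "continuous_on S D"
  using assms unfolding C1_on_def by blast

lemma C1_on_imp_continuous_on: "C1_on S f \<Longrightarrow> continuous_on S f"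
  unfolding C1_on_def by (meson has_derivative_at_withinI has_derivative_continuous_on)

lemma C1_on_UNIV_has_derivative: "C1_on UNIV f \<Longrightarrow> (f has_derivative frechet_derivative f (at x)) (at x)"
  by (elim C1_onE) (metis UNIV_I frechet_derivative_at)

lemma C1_on_UNIV_continuous_derivative:
  fixes f :: "'a::real_normed_vector \<Rightarrow> complex"
  assumes "C1_on UNIV f"
  shows "continuous_on UNIV (\<lambda>x. frechet f x v)"
proof -
  obtain D where D: "\<And>x. (f has_derivative blinfun_apply (D x)) (at x)" "continuous_on UNIV D"
    using assms by (elim C1_onE) auto
  have "frechet f x v = blinfun_apply (D x) v" for x
    using fun_cong[OF frechet_derivative_at[OF D(1)], of x v] by simp
  then show ?thesis using D(2) by (simp add: continuous_intros)
qed

lemma C01_C1: "f \<in> C01 U \<Longrightarrow> C1_on UNIV f"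
  by (simp add: C01_def)

lemma C01_continuous_on: "f \<in> C01 U \<Longrightarrow> continuous_on S f"
  using continuous_on_subset[OF C1_on_imp_continuous_on[OF C01_C1] subset_UNIV] .

lemmas C01_has_derivative = C1_on_UNIV_has_derivative[OF C01_C1]

lemma C01_continuous_derivative: "f \<in> C01 U \<Longrightarrow> continuous_on S (\<lambda>x. frechet f x v)"
  using continuous_on_subset[OF C1_on_UNIV_continuous_derivative[OF C01_C1] subset_UNIV] .

lemma C01_support:
  assumes "f \<in> C01 U"
  obtains K where "compact K" "K \<subseteq> U" "\<And>x. x \<notin> K \<Longrightarrow> f x = 0" "\<And>x v. x \<notin> K \<Longrightarrow> frechet f x v = 0"
proof
  let ?K = "closure {x. f x \<noteq> 0}"
  show "compact ?K" "?K \<subseteq> U" using assms by (auto simp: C01_def)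
  show "f x = 0" if "x \<notin> ?K" for x using that closure_subset[of "{x. f x \<noteq> 0}"] by auto
  show "frechet f x v = 0" if "x \<notin> ?K" for x v
  proof -
    have "((\<lambda>_. 0) has_derivative (\<lambda>_. 0)) (at x)" by simp
    then have "(f has_derivative (\<lambda>_. 0)) (at x)"
      by (rule has_derivative_transform_within_open[of _ _ _ _ "- ?K"])
        (use that closure_subset[of "{x. f x \<noteq> 0}"] in \<open>auto simp: open_Compl\<close>)
    from fun_cong[OF frechet_derivative_at[OF this], of v] show ?thesis by simp
  qed
qed

lemma C01I:
  assumes "C1_on UNIV f" "compact K" "K \<subseteq> U" "\<And>x. x \<notin> K \<Longrightarrow> f x = 0"
  shows "f \<in> C01 U"
proof -
  have "closure {x. f x \<noteq> 0} \<subseteq> K"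
    using assms(2,4) by (intro closure_minimal) (auto intro: compact_imp_closed)
  moreover from this have "compact (closure {x. f x \<noteq> 0})"
    using compact_Int_closed[OF assms(2) closed_closure, of "{x. f x \<noteq> 0}"] by (simp add: inf.absorb2)
  ultimately show ?thesis using assms by (auto simp: C01_def)
qed

lemma C1_on_add:
  assumes "C1_on S f" "C1_on S g"
  shows "C1_on S (\<lambda>x. f x + g x)"
proof -
  obtain F where F: "\<And>x. x \<in> S \<Longrightarrow> (f has_derivative blinfun_apply (F x)) (at x)" "continuous_on S F"
    using assms(1) unfolding C1_on_def by blast
  obtain G where G: "\<And>x. x \<in> S \<Longrightarrow> (g has_derivative blinfun_apply (G x)) (at x)" "continuous_on S G"
    using assms(2) unfolding C1_on_def by blast
  show ?thesis unfolding C1_on_def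
    by (rule exI[of _ "\<lambda>x. F x + G x"])
      (use F G in \<open>auto simp: blinfun.bilinear_simps intro!: continuous_intros derivative_eq_intros\<close>)
qed

lemma C1_on_cmult:
  fixes f :: "'a::real_normed_vector \<Rightarrow> complex"
  assumes "C1_on S f"
  shows "C1_on S (\<lambda>x. c * f x)"
proof -
  obtain F where F: "\<And>x. x \<in> S \<Longrightarrow> (f has_derivative blinfun_apply (F x)) (at x)" "continuous_on S F"
    using assms(1) unfolding C1_on_def by blast
  have "((\<lambda>x. c * f x) has_derivative blinfun_apply (blinfun_mult_right c o\<^sub>L F x)) (at x)" if "x \<in> S" for x
    using F(1)[OF that] by (auto intro!: derivative_eq_intros)
  moreover have "continuous_on S (\<lambda>x. blinfun_mult_right c o\<^sub>L F x)"
    using F(2) by (intro continuous_intros)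
  ultimately show ?thesis
    unfolding C1_on_def by (intro exI[of _ "\<lambda>x. blinfun_mult_right c o\<^sub>L F x"]) simp
qed

lemma C01_add:
  assumes "f \<in> C01 U" "g \<in> C01 U"
  shows "(\<lambda>x. f x + g x) \<in> C01 U"
proof -
  obtain K where K: "compact K" "K \<subseteq> U" "\<And>x. x \<notin> K \<Longrightarrow> f x = 0"
    by (rule C01_support[OF assms(1)], rule that)
  obtain L where L: "compact L" "L \<subseteq> U" "\<And>x. x \<notin> L \<Longrightarrow> g x = 0"
    by (rule C01_support[OF assms(2)], rule that)
  show ?thesis
    by (rule C01I[of _ "K \<union> L"]) (use assms K L in \<open>auto intro: C1_on_add C01_C1\<close>)
qed

lemma C01_cmult:
  assumes "f \<in> C01 U"
  shows "(\<lambda>x. c * f x) \<in> C01 U"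
proof -
  obtain K where K: "compact K" "K \<subseteq> U" "\<And>x. x \<notin> K \<Longrightarrow> f x = 0"
    by (rule C01_support[OF assms], rule that)
  show ?thesis by (rule C01I[of _ K]) (use assms K in \<open>auto intro: C1_on_cmult C01_C1\<close>)
qed

lemma C01_zero: "(\<lambda>_. 0) \<in> C01 U"
  by (rule C01I[of _ "{}"]) (auto simp: C1_on_def zero_blinfun.rep_eq intro!: exI[of _ "\<lambda>_. 0"])

lemma frechet_add:
  assumes "f \<in> C01 U" "g \<in> C01 U"
  shows "frechet (\<lambda>x. f x + g x) x v = frechet f x v + frechet g x v"
  using fun_cong[OF frechet_derivative_at[OF has_derivative_add[OF
      C01_has_derivative[OF assms(1)] C01_has_derivative[OF assms(2)]]], of x v] by simp

lemma frechet_cmult: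
  assumes "f \<in> C01 U"
  shows "frechet (\<lambda>x. c * f x) x v = c * frechet f x v"
  using fun_cong[OF frechet_derivative_at[OF has_derivative_mult_right[OF C01_has_derivative[OF assms]]], of c x v]
  by simp

section \<open>Weighted measures\<close>

lemma sets_weighted_measure: "sets (weighted_measure w U) = sets (restrict_space borel U)"
  by (simp add: weighted_measure_def sets_restrict_space)

lemma borel_measurable_weighted_measure:
  "borel_measurable (weighted_measure w U) = borel_measurable (restrict_space borel U)"
  by (intro measurable_cong_sets sets_weighted_measure refl)

lemma continuous_on_measurable_weighted:
  "continuous_on U f \<Longrightarrow> f \<in> borel_measurable (weighted_measure w U)"
  unfolding borel_measurable_weighted_measure by (rule borel_measurable_continuous_on_restrict)

lemma nn_integral_weighted:
  assumes U: "U \<in> sets borel" and w: "w \<in> borel_measurable (restrict_space borel U)"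
    and g: "g \<in> borel_measurable (restrict_space borel U)"
  shows "(\<integral>\<^sup>+x. g x \<partial>weighted_measure w U) = (\<integral>\<^sup>+x\<in>U. ennreal (w x) * g x \<partial>lborel)"
proof -
  have sets: "sets (restrict_space lborel U) = sets (restrict_space borel U)"
    by (simp add: sets_restrict_space)
  have wg: "(\<lambda>x. ennreal (w x)) \<in> borel_measurable (restrict_space lborel U)"
    "g \<in> borel_measurable (restrict_space lborel U)"
    using w g by (simp_all add: measurable_cong_sets[OF sets refl])
  have "(\<integral>\<^sup>+x. g x \<partial>weighted_measure w U) = (\<integral>\<^sup>+x. ennreal (w x) * g x \<partial>restrict_space lborel U)"
    unfolding weighted_measure_def using wg by (rule nn_integral_density)
  also have "\<dots> = (\<integral>\<^sup>+x\<in>U. ennreal (w x) * g x \<partial>lborel)"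
    using U by (intro nn_integral_restrict_space) auto
  finally show ?thesis .
qed

text \<open>Whatever the weight does near the boundary of \<open>U\<close>, an integrand with
  compact support sees it on a compact set only, where it is bounded.\<close>

lemma weighted_compact_support:
  fixes F :: "'a::euclidean_space \<Rightarrow> 'b::{banach, second_countable_topology}"
  assumes U: "open U" and w: "continuous_on U w" "\<And>x. x \<in> U \<Longrightarrow> 0 \<le> w x"
    and F: "continuous_on U F" and K: "compact K" "K \<subseteq> U" "\<And>x. x \<in> U \<Longrightarrow> x \<notin> K \<Longrightarrow> F x = 0"
  shows "integrable (weighted_measure w U) F"
    and "integral\<^sup>L (weighted_measure w U) F = (\<integral>x. indicator K x *\<^sub>R (w x *\<^sub>R F x) \<partial>lborel)"
proof -
  have sets: "sets (restrict_space lborel U) = sets (restrict_space borel U)"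
    by (simp add: sets_restrict_space)
  have wm: "w \<in> borel_measurable (restrict_space lborel U)"
    using borel_measurable_continuous_on_restrict[OF w(1)] by (simp add: measurable_cong_sets[OF sets refl])
  have Fm: "F \<in> borel_measurable (restrict_space lborel U)"
    using borel_measurable_continuous_on_restrict[OF F] by (simp add: measurable_cong_sets[OF sets refl])
  have pos: "AE x in restrict_space lborel U. 0 \<le> w x"
    using w(2) by (intro AE_I2) (simp add: space_restrict_space)
  have U': "U \<inter> space lborel \<in> sets lborel" using U by simp
  have eq: "indicator U x *\<^sub>R (w x *\<^sub>R F x) = indicator K x *\<^sub>R (w x *\<^sub>R F x)" for x
    using K by (auto simp: indicator_def)
  have "integrable lborel (\<lambda>x. indicator K x *\<^sub>R (w x *\<^sub>R F x))"
    using w F K by (intro borel_integrable_compact continuous_intros) (auto intro: continuous_on_subset)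
  then show "integrable (weighted_measure w U) F"
    unfolding weighted_measure_def integrable_density[OF Fm wm pos] integrable_restrict_space[OF U'] eq .
  show "integral\<^sup>L (weighted_measure w U) F = (\<integral>x. indicator K x *\<^sub>R (w x *\<^sub>R F x) \<partial>lborel)"
    unfolding weighted_measure_def integral_density[OF Fm wm pos] integral_restrict_space[OF U'] eq ..
qed

section \<open>Weak nullity of derivatives\<close>

lemma lborel_integral_translate:
  fixes f :: "'a::euclidean_space \<Rightarrow> 'b::{banach, second_countable_topology}"
  assumes "f \<in> borel_measurable borel"
  shows "(\<integral>x. f (x + c) \<partial>lborel) = (\<integral>x. f x \<partial>lborel)"
proof -
  have "(\<integral>x. f x \<partial>lborel) = (\<integral>x. f x \<partial>distr lborel borel ((+) c))" by (simp add: lborel_distr_plus)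
  also have "\<dots> = (\<integral>x. f (c + x) \<partial>lborel)" by (rule integral_distr) (use assms in auto)
  finally show ?thesis by (simp add: add.commute)
qed

text \<open>Differentiation under the integral is carried out below for the gauge integral over a
  box; this moves compactly supported integrands between the two integrals.\<close>

lemma continuous_zero_outside_integral:
  fixes F :: "'a::euclidean_space \<Rightarrow> complex"
  assumes F: "continuous_on UNIV F" and K: "K \<subseteq> cbox a b" "\<And>x. x \<notin> K \<Longrightarrow> F x = 0"
  shows "integrable lborel F" "integral (cbox a b) F = (\<integral>x. F x \<partial>lborel)"
proof -
  have eq: "F = (\<lambda>x. indicator (cbox a b) x *\<^sub>R F x)" using K by (force simp: indicator_def)
  have *: "integrable lborel (\<lambda>x. indicator (cbox a b) x *\<^sub>R F x)"
    using F by (intro borel_integrable_compact) (auto intro: continuous_on_subset)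
  then show "integrable lborel F" by (subst eq)
  have "set_integrable lborel (cbox a b) F" using * by (simp add: set_integrable_def)
  from set_borel_integral_eq_integral(2)[OF this] show "integral (cbox a b) F = (\<integral>x. F x \<partial>lborel)"
    unfolding set_lebesgue_integral_def eq[symmetric] by simp
qed

text \<open>Pairing \<open>\<partial>\<^sub>b u\<close> with a continuous function needs no smoothing: \<open>\<Phi>(t) = \<integral> u(y + t b) W(y) dy\<close> is
  differentiable with \<open>\<Phi>'(t) = \<integral> \<partial>\<^sub>b u(x) W(x - t b) dx\<close>, so \<open>h \<Phi>'(0)\<close> is \<open>\<Phi>(h) - \<Phi>(0)\<close> up to
  the modulus of continuity of \<open>W\<close>.\<close>

lemma derivative_pairing_bound:
  fixes u W :: "'a::euclidean_space \<Rightarrow> complex"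
  assumes u: "C1_on UNIV u" and W: "continuous_on UNIV W" and K: "compact K" "\<And>x. x \<notin> K \<Longrightarrow> W x = 0"
    and K': "compact K'" "\<And>x t. x \<in> K \<Longrightarrow> \<bar>t\<bar> \<le> h \<Longrightarrow> x + t *\<^sub>R b \<in> K'"
    and h: "h > 0" and osc: "\<And>x t. \<bar>t\<bar> \<le> h \<Longrightarrow> cmod (W (x - t *\<^sub>R b) - W x) \<le> \<eta>"
    and sup: "\<And>x. cmod (W x) \<le> S"
  shows "h * cmod (\<integral>x. frechet u x b * W x \<partial>lborel)
    \<le> h * (\<eta> * (\<integral>x. indicator K' x * cmod (frechet u x b) \<partial>lborel))
      + 2 * S * (\<integral>x. indicator K' x * cmod (u x) \<partial>lborel)"
proof -
  have cu: "continuous_on UNIV u" using C1_on_imp_continuous_on[OF u] .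
  have cd: "continuous_on UNIV (\<lambda>x. frechet u x b)" using C1_on_UNIV_continuous_derivative[OF u] .
  obtain p where p: "K \<subseteq> cbox (-p) p" using bounded_subset_cbox_symmetric[OF compact_imp_bounded[OF K(1)]] by blast
  define \<Phi> where "\<Phi> t = (\<integral>y. u (y + t *\<^sub>R b) * W y \<partial>lborel)" for t :: real
  define \<Phi>' where "\<Phi>' t = (\<integral>y. frechet u (y + t *\<^sub>R b) b * W y \<partial>lborel)" for t :: real
  have comp: "continuous_on UNIV (\<lambda>y. G (y + t *\<^sub>R b) * W y)" if "continuous_on UNIV G" for G :: "'a \<Rightarrow> complex" and t
    by (intro continuous_intros W continuous_on_compose2[OF that]) auto
  have zero: "G (y + t *\<^sub>R b) * W y = 0" if "y \<notin> K" for G :: "'a \<Rightarrow> complex" and t y using K(2)[OF that] by simp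
  have \<Phi>_eq: "\<Phi> t = integral (cbox (-p) p) (\<lambda>y. u (y + t *\<^sub>R b) * W y)" for t
    unfolding \<Phi>_def by (rule continuous_zero_outside_integral(2)[OF comp[OF cu] p, symmetric]) (rule zero)
  have \<Phi>'_eq: "\<Phi>' t = integral (cbox (-p) p) (\<lambda>y. frechet u (y + t *\<^sub>R b) b * W y)" for t
    unfolding \<Phi>'_def by (rule continuous_zero_outside_integral(2)[OF comp[OF cd] p, symmetric]) (rule zero)
  have deriv: "(\<Phi> has_vector_derivative \<Phi>' t) (at t within {-h..h})" if t: "t \<in> {-h..h}" for t
    unfolding \<Phi>_eq[abs_def] \<Phi>'_eq
  proof (rule leibniz_rule_vector_derivative[OF _ _ _ t])
    fix x :: real and y :: 'a
    have "((\<lambda>x. y + x *\<^sub>R b) has_derivative (\<lambda>s. s *\<^sub>R b)) (at x within {-h..h})"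
      by (auto intro!: derivative_eq_intros)
    moreover have "(u has_derivative frechet u (y + x *\<^sub>R b)) (at (y + x *\<^sub>R b) within range (\<lambda>x. y + x *\<^sub>R b))"
      by (rule has_derivative_at_withinI[OF C1_on_UNIV_has_derivative[OF u]])
    ultimately have "((\<lambda>x. u (y + x *\<^sub>R b)) has_derivative (\<lambda>s. frechet u (y + x *\<^sub>R b) (s *\<^sub>R b))) (at x within {-h..h})"
      using has_derivative_compose[OF _ C1_on_UNIV_has_derivative[OF u]] by blast
    moreover have "frechet u (y + x *\<^sub>R b) (s *\<^sub>R b) = s *\<^sub>R frechet u (y + x *\<^sub>R b) b" for s
      by (rule linear_scale[OF has_derivative_linear[OF C1_on_UNIV_has_derivative[OF u]]])
    ultimately have "((\<lambda>x. u (y + x *\<^sub>R b)) has_vector_derivative frechet u (y + x *\<^sub>R b) b) (at x within {-h..h})"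
      by (simp add: has_vector_derivative_def)
    then show "((\<lambda>x. u (y + x *\<^sub>R b) * W y) has_vector_derivative frechet u (y + x *\<^sub>R b) b * W y) (at x within {-h..h})"
      by (auto intro!: derivative_eq_intros)
  next
    show "(\<lambda>y. u (y + x *\<^sub>R b) * W y) integrable_on cbox (-p) p" for x
      by (intro integrable_continuous continuous_on_subset[OF comp[OF cu]]) auto
    show "continuous_on ({- h..h} \<times> cbox (- p) p) (\<lambda>(x, y). frechet u (y + x *\<^sub>R b) b * W y)"
      unfolding case_prod_beta
      by (intro continuous_intros continuous_on_compose2[OF cd] continuous_on_compose2[OF W]) auto
  qed (rule convex_real_interval)
  have int_K': "integrable lborel (\<lambda>x. indicator K' x * cmod (G x))" if "continuous_on UNIV G" for G :: "'a \<Rightarrow> complex"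
    using borel_integrable_compact[OF K'(1), of "\<lambda>x. cmod (G x)"] that
    by (auto intro!: continuous_intros intro: continuous_on_subset)
  \<comment> \<open>Moving the translation onto \<open>W\<close> puts the dependence on
    \<open>t\<close> there, so that \<open>\<Phi>' t - \<Phi>' 0\<close> is controlled without any
    modulus of continuity of the derivative of \<open>u\<close>.\<close>
  have shift: "(\<integral>y. G (y + t *\<^sub>R b) * W y \<partial>lborel) = (\<integral>x. G x * W (x - t *\<^sub>R b) \<partial>lborel)"
    "integrable lborel (\<lambda>x. G x * W (x - t *\<^sub>R b))"
    if G: "continuous_on UNIV G" for G :: "'a \<Rightarrow> complex" and t
  proof -
    have c: "continuous_on UNIV (\<lambda>x. G x * W (x - t *\<^sub>R b))"
      by (intro continuous_intros G continuous_on_compose2[OF W]) auto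
    have m: "(\<lambda>x. G x * W (x - t *\<^sub>R b)) \<in> borel_measurable borel"
      using borel_measurable_continuous_onI[OF c] .
    show "(\<integral>y. G (y + t *\<^sub>R b) * W y \<partial>lborel) = (\<integral>x. G x * W (x - t *\<^sub>R b) \<partial>lborel)"
      using lborel_integral_translate[OF m, of "t *\<^sub>R b"] by simp
    let ?K = "(\<lambda>x. x + t *\<^sub>R b) ` K"
    have "compact ?K" using K(1) by (intro compact_continuous_image continuous_intros)
    then obtain r where r: "?K \<subseteq> cbox (-r) r" using bounded_subset_cbox_symmetric compact_imp_bounded by blast
    have "G x * W (x - t *\<^sub>R b) = 0" if "x \<notin> ?K" for x
    proof -
      have "x - t *\<^sub>R b \<notin> K" using that by (auto simp: image_iff)
      then show ?thesis using K(2) by simp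
    qed
    then show "integrable lborel (\<lambda>x. G x * W (x - t *\<^sub>R b))"
      by (rule continuous_zero_outside_integral(1)[OF c r])
  qed
  have ind: "x \<in> K'" if "W (x - t *\<^sub>R b) \<noteq> 0" "\<bar>t\<bar> \<le> h" for x t
  proof -
    have "x - t *\<^sub>R b \<in> K" using that(1) K(2) by blast
    from K'(2)[OF this that(2)] show ?thesis by simp
  qed
  have \<Phi>_bound: "cmod (\<Phi> t) \<le> S * (\<integral>x. indicator K' x * cmod (u x) \<partial>lborel)" if t: "\<bar>t\<bar> \<le> h" for t
  proof -
    have "cmod (\<Phi> t) \<le> (\<integral>x. S * (indicator K' x * cmod (u x)) \<partial>lborel)"
      unfolding \<Phi>_def shift[OF cu]
    proof (rule Bochner_Integration.integral_norm_bound_integral)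
      show "integrable lborel (\<lambda>x. u x * W (x - t *\<^sub>R b))" by (rule shift(2)[OF cu])
      show "integrable lborel (\<lambda>x. S * (indicator K' x * cmod (u x)))" using int_K'[OF cu] by simp
      fix x
      have "S \<ge> 0" using sup[of 0] norm_ge_zero order_trans by blast
      then show "cmod (u x * W (x - t *\<^sub>R b)) \<le> S * (indicator K' x * cmod (u x))"
        using ind[OF _ t, of x] sup[of "x - t *\<^sub>R b"]
        by (cases "W (x - t *\<^sub>R b) = 0") (auto simp: norm_mult mult.commute[of S] intro: mult_left_mono)
    qed
    then show ?thesis by simp
  qed
  have \<Phi>'_bound: "cmod (\<Phi>' t - \<Phi>' 0) \<le> \<eta> * (\<integral>x. indicator K' x * cmod (frechet u x b) \<partial>lborel)"
    if t: "t \<in> {-h..h}" for t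
  proof -
    have t': "\<bar>t\<bar> \<le> h" using t by auto
    note i1 = shift(2)[OF cd, of t] and i0 = shift(2)[OF cd, of 0]
    have "\<Phi>' t - \<Phi>' 0 = (\<integral>x. frechet u x b * W (x - t *\<^sub>R b) - frechet u x b * W (x - 0 *\<^sub>R b) \<partial>lborel)"
      unfolding \<Phi>'_def shift(1)[OF cd] using i1 i0 by (rule Bochner_Integration.integral_diff[symmetric])
    also have "cmod \<dots> \<le> (\<integral>x. \<eta> * (indicator K' x * cmod (frechet u x b)) \<partial>lborel)"
    proof (rule Bochner_Integration.integral_norm_bound_integral)
      show "integrable lborel (\<lambda>x. frechet u x b * W (x - t *\<^sub>R b) - frechet u x b * W (x - 0 *\<^sub>R b))"
        using i1 i0 by (rule Bochner_Integration.integrable_diff)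
      show "integrable lborel (\<lambda>x. \<eta> * (indicator K' x * cmod (frechet u x b)))" using int_K'[OF cd] by simp
      fix x
      have "cmod (frechet u x b * W (x - t *\<^sub>R b) - frechet u x b * W (x - 0 *\<^sub>R b))
          = cmod (W (x - t *\<^sub>R b) - W x) * cmod (frechet u x b)"
        by (simp add: right_diff_distrib[symmetric] norm_mult)
      also have "\<dots> \<le> \<eta> * (indicator K' x * cmod (frechet u x b))"
      proof (cases "x \<in> K'")
        case True
        then show ?thesis using osc[OF t'] by (simp add: mult_right_mono)
      next
        case False
        then have "W (x - t *\<^sub>R b) = 0" "W x = 0" using ind[of x t] ind[of x 0] t' h by auto
        then show ?thesis using False by simp
      qed
      finally show "cmod (frechet u x b * W (x - t *\<^sub>R b) - frechet u x b * W (x - 0 *\<^sub>R b))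
        \<le> \<eta> * (indicator K' x * cmod (frechet u x b))" .
    qed
    finally show ?thesis by simp
  qed
  \<comment> \<open>Mean value estimate: the error of the linearisation at 0 is \<open>h\<close>
    times the oscillation of the derivative.\<close>
  have "norm (\<Phi> h - \<Phi> 0 - (h - 0) *\<^sub>R \<Phi>' 0)
      \<le> norm (h - 0) * (\<eta> * (\<integral>x. indicator K' x * cmod (frechet u x b) \<partial>lborel))"
    by (rule vector_differentiable_bound_linearization[OF deriv _ \<Phi>'_bound])
      (use h in \<open>auto simp: closed_segment_eq_real_ivl\<close>)
  moreover have "cmod (h *\<^sub>R \<Phi>' 0) \<le> cmod (\<Phi> h - \<Phi> 0 - (h - 0) *\<^sub>R \<Phi>' 0) + (cmod (\<Phi> h) + cmod (\<Phi> 0))"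
    using norm_triangle_ineq4[of "\<Phi> h - \<Phi> 0" "\<Phi> h - \<Phi> 0 - (h - 0) *\<^sub>R \<Phi>' 0"]
      norm_triangle_ineq4[of "\<Phi> h" "\<Phi> 0"] by simp
  ultimately have "h * cmod (\<Phi>' 0) \<le> h * (\<eta> * (\<integral>x. indicator K' x * cmod (frechet u x b) \<partial>lborel))
      + 2 * (S * (\<integral>x. indicator K' x * cmod (u x) \<partial>lborel))"
    using \<Phi>_bound[of h] \<Phi>_bound[of 0] h by simp
  then show ?thesis by (simp add: \<Phi>'_def)
qed

text \<open>Split \<open>q (u n) (u n)\<close> into \<open>q (u n) (u n - u N)\<close>, small by the
  Cauchy property, and \<open>q (u n) (u N)\<close>, which tends to 0 because \<open>u N\<close> is
  a fixed test function.\<close>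

lemma (in hermitian_form) energy_tendsto_0_of_weak:
  assumes u: "energy_Cauchy u" and weak: "\<And>v. v \<in> D \<Longrightarrow> (\<lambda>n. q (u n) v) \<longlonglongrightarrow> 0"
  shows "(\<lambda>n. energy (u n)) \<longlonglongrightarrow> 0"
proof (rule LIMSEQ_I)
  fix e :: real assume e: "e > 0"
  have mem: "u n \<in> D" for n using u by (simp add: energy_Cauchy_def)
  obtain B where B: "B > 0" "\<And>n. energy (u n) \<le> B\<^sup>2" using energy_Cauchy_bounded[OF u] by blast
  define d where "d = e / (2 * B)"
  have d: "d > 0" "d\<^sup>2 > 0" using e B by (auto simp: d_def)
  obtain N where N: "\<forall>m\<ge>N. \<forall>n\<ge>N. energy (\<lambda>x. u m x - u n x) < d\<^sup>2"
    using u d(2) unfolding energy_Cauchy_def by blast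
  obtain N' where N': "\<And>n. n \<ge> N' \<Longrightarrow> cmod (q (u n) (u N)) < e / 2"
    using LIMSEQ_D[OF weak[OF mem[of N]], of "e / 2"] e by auto
  have "norm (energy (u n) - 0) < e" if n: "n \<ge> max N N'" for n
  proof -
    have "q (u n) (u n) = q (u n) (\<lambda>x. u n x - u N x) + q (u n) (u N)"
      using mem by (simp add: diff_right)
    then have "cmod (q (u n) (u n)) \<le> cmod (q (u n) (\<lambda>x. u n x - u N x)) + cmod (q (u n) (u N))"
      by (simp add: norm_triangle_ineq)
    moreover have "cmod (q (u n) (\<lambda>x. u n x - u N x)) \<le> B * d"
    proof (rule order_trans[OF cmod_le[OF mem diff_mem[OF mem mem]]], intro mult_mono)
      show "sqrt (energy (u n)) \<le> B" using B by (intro real_le_lsqrt) auto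
      show "sqrt (energy (\<lambda>x. u n x - u N x)) \<le> d"
        using N n d by (intro real_le_lsqrt) (auto intro: less_imp_le)
      show "0 \<le> sqrt (energy (\<lambda>x. u n x - u N x))"
        using nonneg[OF diff_mem[OF mem mem], of n N] by simp
    qed (use B in auto)
    moreover have "B * d = e / 2" using B by (simp add: d_def)
    ultimately have "energy (u n) < e" using N'[of n] n cmod_self[OF mem[of n]] by simp
    then show ?thesis using nonneg[OF mem[of n]] by simp
  qed
  then show "\<exists>no. \<forall>n\<ge>no. norm (energy (u n) - 0) < e" by blast
qed

section \<open>Continuity, translation and local norms on compact sets\<close>

lemma continuous_on_zero_extension:
  fixes F :: "'a::t2_space \<Rightarrow> 'b::real_normed_vector"
  assumes "open U" "compact K" "K \<subseteq> U" "continuous_on U F" "\<And>x. x \<in> U \<Longrightarrow> x \<notin> K \<Longrightarrow> F x = 0"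
  shows "continuous_on UNIV (\<lambda>x. if x \<in> U then F x else 0)"
proof -
  let ?G = "\<lambda>x. if x \<in> U then F x else 0"
  have "continuous_on U ?G" using assms(4) by (rule continuous_on_eq) auto
  moreover have "continuous_on (- K) ?G"
    by (rule continuous_on_eq[OF continuous_on_const[of _ 0]]) (use assms in auto)
  moreover have "open (- K)" using assms(2) by (simp add: compact_imp_closed open_Compl)
  ultimately have "continuous_on (U \<union> - K) ?G" using assms(1) by (intro continuous_on_open_Un)
  moreover have "U \<union> - K = UNIV" using assms(3) by blast
  ultimately show ?thesis by simp
qed

lemma compact_translates:
  fixes K :: "'a::real_normed_vector set"
  assumes "compact K"
  shows "compact ((\<lambda>(x, t). x + t *\<^sub>R b) ` (K \<times> {-h..h::real}))"
  using assms by (intro compact_continuous_image compact_Times)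
    (auto simp: case_prod_beta intro!: continuous_intros)

text \<open>The support is thickened twice along \<open>b\<close>: for \<open>x\<close> in
  \<open>K'\<close> both \<open>x\<close> and its translate stay in the compact \<open>K''\<close>,
  where uniform continuity applies; for \<open>x\<close> outside \<open>K'\<close> both values of
  \<open>W\<close> vanish.\<close>

lemma uniform_translation_continuity:
  fixes W :: "'a::real_normed_vector \<Rightarrow> complex"
  assumes W: "continuous_on UNIV W" and K: "compact K" "\<And>x. x \<notin> K \<Longrightarrow> W x = 0" and \<eta>: "\<eta> > 0" and h0: "h0 > 0"
  obtains h where "0 < h" "h \<le> h0" "\<And>x t. \<bar>t\<bar> \<le> h \<Longrightarrow> cmod (W (x - t *\<^sub>R b) - W x) \<le> \<eta>"
proof -
  define K' where "K' = (\<lambda>(x, t). x + t *\<^sub>R b) ` (K \<times> {-h0..h0})"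
  define K'' where "K'' = (\<lambda>(x, t). x + t *\<^sub>R b) ` (K' \<times> {-h0..h0})"
  have "compact K''" unfolding K''_def K'_def using K(1) by (intro compact_translates)
  then have "uniformly_continuous_on K'' W"
    using W by (intro compact_uniformly_continuous) (auto intro: continuous_on_subset)
  then obtain d where d: "d > 0" "\<And>x y. x \<in> K'' \<Longrightarrow> y \<in> K'' \<Longrightarrow> dist y x < d \<Longrightarrow> dist (W y) (W x) < \<eta>"
    using \<eta> unfolding uniformly_continuous_on_def by meson
  define h where "h = min h0 (d / (2 * (norm b + 1)))"
  have nb: "2 * (norm b + 1) > 0" by (simp add: add_nonneg_pos)
  have h: "0 < h" "h \<le> h0" using h0 d(1) nb by (auto simp: h_def)
  have hd: "h * norm b < d"
  proof -
    have "h * norm b \<le> d / (2 * (norm b + 1)) * norm b" unfolding h_def by (intro mult_right_mono) auto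
    also have "\<dots> < d" using d(1) nb by (simp add: field_simps add_nonneg_pos)
    finally show ?thesis .
  qed
  have "cmod (W (x - t *\<^sub>R b) - W x) \<le> \<eta>" if t: "\<bar>t\<bar> \<le> h" for x t
  proof (cases "x \<in> K'")
    case True
    have "x - t *\<^sub>R b \<in> K''"
      unfolding K''_def using True t h by (intro image_eqI[of _ _ "(x, -t)"]) auto
    moreover have "x \<in> K''"
      unfolding K''_def using True h0 by (intro image_eqI[of _ _ "(x, 0)"]) auto
    moreover have "\<bar>t\<bar> * norm b \<le> h * norm b" using t by (intro mult_right_mono) auto
    then have "dist (x - t *\<^sub>R b) x < d" using hd by (simp add: dist_norm)
    ultimately show ?thesis using d(2) by (force simp: dist_norm)
  next
    case False
    have "x \<notin> K" using False h0 unfolding K'_def by (auto intro!: image_eqI[of _ _ "(x, 0)"])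
    moreover have "x - t *\<^sub>R b \<notin> K"
    proof
      assume "x - t *\<^sub>R b \<in> K"
      then have "x \<in> K'" unfolding K'_def using t h by (intro image_eqI[of _ _ "(x - t *\<^sub>R b, t)"]) auto
      with False show False ..
    qed
    ultimately show ?thesis using K(2) \<eta> by simp
  qed
  then show ?thesis using h that by blast
qed

text \<open>Cauchy--Schwarz in \<open>L2 lborel\<close> against the indicator of
  \<open>K\<close>.\<close>

lemma L1_le_L2_on_compact:
  fixes G :: "'a::euclidean_space \<Rightarrow> complex"
  assumes G: "continuous_on K G" and K: "compact K"
  shows "(\<integral>x. indicator K x * cmod (G x) \<partial>lborel)
    \<le> sqrt (measure lborel K) * sqrt (\<integral>x. indicator K x * (cmod (G x))\<^sup>2 \<partial>lborel)"
proof -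
  let ?f = "\<lambda>x. complex_of_real (indicator K x)"
  let ?g = "\<lambda>x. complex_of_real (indicator K x * cmod (G x))"
  have int: "integrable lborel (\<lambda>x. indicator K x * H x)" if "continuous_on K H" for H :: "'a \<Rightarrow> real"
    using borel_integrable_compact[OF K that] by simp
  have f: "?f \<in> L2 lborel"
  proof -
    have "(cmod (?f x))\<^sup>2 = indicator K x * 1" for x by (simp add: indicator_def)
    moreover have "?f \<in> borel_measurable lborel"
      using borel_compact[OF K] by measurable
    ultimately show ?thesis using int[of "\<lambda>_. 1"] by (simp add: L2_def del: norm_of_real)
  qed
  have g2: "(cmod (?g x))\<^sup>2 = indicator K x * (cmod (G x))\<^sup>2" for x by (simp add: indicator_def)
  have g: "?g \<in> L2 lborel"
    unfolding L2_def mem_Collect_eq g2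
    using measurable_compose[OF borel_measurable_integrable[OF int[OF continuous_on_norm[OF G]]] borel_measurable_of_real]
      int[OF continuous_on_power[OF continuous_on_norm[OF G]], of 2] by simp
  have "L2_inner lborel ?f ?g = complex_of_real (\<integral>x. indicator K x * cmod (G x) \<partial>lborel)"
  proof -
    have "?f x * cnj (?g x) = complex_of_real (indicator K x * cmod (G x))" for x by (simp add: indicator_def)
    then show ?thesis unfolding L2_inner_def by (simp only: integral_complex_of_real)
  qed
  then have "(\<integral>x. indicator K x * cmod (G x) \<partial>lborel) \<le> cmod (L2_inner lborel ?f ?g)" by simp
  also have "\<dots> \<le> L2_norm lborel ?f * L2_norm lborel ?g" by (rule L2_cauchy_schwarz[OF f g])
  also have "L2_norm lborel ?g = sqrt (\<integral>x. indicator K x * (cmod (G x))\<^sup>2 \<partial>lborel)"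
    unfolding L2_norm_def g2 ..
  also have "L2_norm lborel ?f = sqrt (measure lborel K)"
  proof -
    have "(cmod (?f x))\<^sup>2 = indicator K x" for x by (simp add: indicator_def)
    then show ?thesis using K by (simp add: L2_norm_def borel_compact)
  qed
  finally show ?thesis .
qed

section \<open>Gradient forms\<close>

text \<open>Coefficients indexed by pairs of basis vectors allow one formula for
  \<open>real\<close>, whose only basis vector is 1, and for \<open>real^'n\<close>.\<close>

definition sesq :: "('a \<Rightarrow> 'a \<Rightarrow> real) \<Rightarrow> ('a::euclidean_space \<Rightarrow> complex) \<Rightarrow> ('a \<Rightarrow> complex) \<Rightarrow> complex" where
  "sesq m \<xi> \<eta> = (\<Sum>b\<in>Basis. \<Sum>c\<in>Basis. \<xi> b * complex_of_real (m b c) * cnj (\<eta> c))"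

definition grad_form :: "('a \<Rightarrow> 'a \<Rightarrow> 'a \<Rightarrow> real) \<Rightarrow> ('a \<Rightarrow> real) \<Rightarrow> 'a set \<Rightarrow> 'a::euclidean_space sesq_form" where
  "grad_form A w U f g = 1/2 * (\<integral>x. sesq (A x) (frechet f x) (frechet g x) \<partial>weighted_measure w U)"

text \<open>Ellipticity is required on compact subsets only, since the coefficients may degenerate
  towards the boundary of \<open>U\<close> and at infinity. Test functions never leave a compact
  subset of \<open>U\<close>.\<close>

locale elliptic_form =
  fixes A :: "'a::euclidean_space \<Rightarrow> 'a \<Rightarrow> 'a \<Rightarrow> real" and w :: "'a \<Rightarrow> real" and U :: "'a set"
  assumes open_U: "open U"
    and w_cont: "continuous_on U w"
    and w_pos: "x \<in> U \<Longrightarrow> 0 < w x"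
    and A_cont: "\<lbrakk>b \<in> Basis; c \<in> Basis\<rbrakk> \<Longrightarrow> continuous_on U (\<lambda>x. A x b c)"
    and A_sym: "\<lbrakk>x \<in> U; b \<in> Basis; c \<in> Basis\<rbrakk> \<Longrightarrow> A x b c = A x c b"
    and elliptic: "\<lbrakk>compact K; K \<subseteq> U\<rbrakk> \<Longrightarrow>
      \<exists>k>0. \<forall>x\<in>K. \<forall>\<xi>. k * (\<Sum>b\<in>Basis. (cmod (\<xi> b))\<^sup>2) \<le> Re (sesq (A x) \<xi> \<xi>)"
begin

abbreviation "meas \<equiv> weighted_measure w U"
abbreviation "gf \<equiv> grad_form A w U"
abbreviation "grad_density f g x \<equiv> sesq (A x) (frechet f x) (frechet g x)"

lemmas integral_compact_support =
  weighted_compact_support[OF open_U w_cont less_imp_le[OF w_pos]]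

lemma sesq_nonneg: "x \<in> U \<Longrightarrow> 0 \<le> Re (sesq (A x) \<xi> \<xi>)"
proof -
  assume "x \<in> U"
  then obtain k where "k > 0" "k * (\<Sum>b\<in>Basis. (cmod (\<xi> b))\<^sup>2) \<le> Re (sesq (A x) \<xi> \<xi>)"
    using elliptic[of "{x}"] by auto
  moreover have "0 \<le> k * (\<Sum>b\<in>Basis. (cmod (\<xi> b))\<^sup>2)" using \<open>k > 0\<close> by (simp add: sum_nonneg)
  ultimately show ?thesis by linarith
qed

lemma density_continuous: "\<lbrakk>f \<in> C01 U; g \<in> C01 U\<rbrakk> \<Longrightarrow> continuous_on U (grad_density f g)"
  unfolding sesq_def by (intro continuous_intros C01_continuous_derivative A_cont)

lemma density_integrable:
  assumes "f \<in> C01 U" "g \<in> C01 U"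
  shows "integrable meas (grad_density f g)"
proof -
  obtain K where K: "compact K" "K \<subseteq> U" "\<And>x v. x \<notin> K \<Longrightarrow> frechet f x v = 0"
    by (rule C01_support[OF assms(1)], rule that)
  show ?thesis
    by (rule integral_compact_support(1)[OF _ density_continuous[OF assms] K(1,2)])
      (auto simp: sesq_def K(3))
qed

lemma C01_L2: "C01 U \<subseteq> L2 meas"
proof
  fix f assume f: "f \<in> C01 U"
  obtain K where K: "compact K" "K \<subseteq> U" "\<And>x. x \<notin> K \<Longrightarrow> f x = 0"
    by (rule C01_support[OF f], rule that)
  have "integrable meas (\<lambda>x. (cmod (f x))\<^sup>2)"
    by (rule integral_compact_support(1)[OF _ _ K(1,2)])
      (auto simp: K(3) intro!: continuous_intros C01_continuous_on[OF f])
  then show "f \<in> L2 meas"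
    using continuous_on_measurable_weighted[OF C01_continuous_on[OF f]] by (simp add: L2_def)
qed

lemma gf_energy:
  assumes "f \<in> C01 U"
  shows "Re (gf f f) = 1/2 * (\<integral>x. Re (grad_density f f x) \<partial>meas)"
  using integral_Re[OF density_integrable[OF assms assms]] by (simp add: grad_form_def)

sublocale hermitian_form "C01 U" gf
proof
  fix f g h :: "'a \<Rightarrow> complex" and c
  assume f: "f \<in> C01 U"
  show "(\<lambda>x. c * f x) \<in> C01 U" using f by (rule C01_cmult)
  have space: "space meas = U" by (simp add: weighted_measure_def space_restrict_space)
  show "0 \<le> Re (gf f f)"
    unfolding gf_energy[OF f] by (intro mult_nonneg_nonneg Bochner_Integration.integral_nonneg) (auto simp: space sesq_nonneg)
  assume g: "g \<in> C01 U"
  show "(\<lambda>x. f x + g x) \<in> C01 U" using f g by (rule C01_add)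
  have "grad_density (\<lambda>x. c * f x) g x = c * grad_density f g x" for x
    by (simp add: sesq_def frechet_cmult[OF f] sum_distrib_left mult.assoc)
  then show "gf (\<lambda>x. c * f x) g = c * gf f g" by (simp add: grad_form_def)
  have "grad_density g f x = cnj (grad_density f g x)" if "x \<in> space meas" for x
  proof -
    have "grad_density g f x = (\<Sum>c\<in>Basis. \<Sum>b\<in>Basis. frechet g x b * complex_of_real (A x b c) * cnj (frechet f x c))"
      unfolding sesq_def by (rule sum.swap)
    also have "\<dots> = cnj (grad_density f g x)"
      unfolding sesq_def cnj_sum using that
      by (intro sum.cong refl) (simp add: space A_sym[of x] mult_ac)
    finally show ?thesis .
  qed
  then have "(\<integral>x. grad_density g f x \<partial>meas) = (\<integral>x. cnj (grad_density f g x) \<partial>meas)"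
    by (intro Bochner_Integration.integral_cong refl)
  then show "gf g f = cnj (gf f g)" by (simp add: grad_form_def)
  assume h: "h \<in> C01 U"
  have "grad_density (\<lambda>x. f x + g x) h x = grad_density f h x + grad_density g h x" for x
    by (simp add: sesq_def frechet_add[OF f g] sum.distrib distrib_right)
  then show "gf (\<lambda>x. f x + g x) h = gf f h + gf g h"
    using density_integrable[OF f h] density_integrable[OF g h] by (simp add: grad_form_def distrib_left)
qed

text \<open>Passage from Lebesgue integrals over one compact set to the weighted integral over
  \<open>U\<close>: enlarging the domain only adds non-negative contributions. The set
  \<open>K\<close>, a support of \<open>G\<close>, supplies integrability.\<close>

lemma integral_on_compact_le:
  fixes F G :: "'a \<Rightarrow> real"
  assumes K': "compact K'" "K' \<subseteq> U" and F: "continuous_on K' F" and le: "\<And>x. x \<in> K' \<Longrightarrow> F x \<le> c * (w x * G x)"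
    and G: "continuous_on U G" "\<And>x. x \<in> U \<Longrightarrow> 0 \<le> G x" and c: "c \<ge> 0"
    and K: "compact K" "K \<subseteq> U" "\<And>x. x \<in> U \<Longrightarrow> x \<notin> K \<Longrightarrow> G x = 0"
  shows "(\<integral>x. indicator K' x * F x \<partial>lborel) \<le> c * (\<integral>x. G x \<partial>meas)"
proof -
  have "(\<integral>x. indicator K' x * F x \<partial>lborel) \<le> (\<integral>x. c * (indicator K x * (w x * G x)) \<partial>lborel)"
  proof (rule integral_mono)
    show "integrable lborel (\<lambda>x. indicator K' x * F x)" using borel_integrable_compact[OF K'(1) F] by simp
    have "continuous_on K (\<lambda>x. w x * G x)"
      using K(2) w_cont G(1) by (intro continuous_intros) (auto intro: continuous_on_subset)
    from borel_integrable_compact[OF K(1) this]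
    show "integrable lborel (\<lambda>x. c * (indicator K x * (w x * G x)))" by simp
    fix x
    have pos: "0 \<le> c * (w x * G x)" if "x \<in> U"
      using that c w_pos[OF that] G(2)[OF that] by simp
    show "indicator K' x * F x \<le> c * (indicator K x * (w x * G x))"
    proof (cases "x \<in> K'")
      case True
      then show ?thesis using le[OF True] K(3)[of x] K'(2) by (cases "x \<in> K") auto
    next
      case False
      then show ?thesis using pos K(2) by (cases "x \<in> K") auto
    qed
  qed
  also have "\<dots> = c * (\<integral>x. G x \<partial>meas)"
    using integral_compact_support(2)[OF _ G(1) K] by simp
  finally show ?thesis .
qed

section \<open>Closability of gradient forms\<close>

lemma w_lower_bound:
  assumes "compact K" "K \<subseteq> U"
  shows "\<exists>w0>0. \<forall>x\<in>K. w0 \<le> w x"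
proof (cases "K = {}")
  case True
  then show ?thesis by (intro exI[of _ 1]) auto
next
  case False
  then obtain x where "x \<in> K" "\<And>y. y \<in> K \<Longrightarrow> w x \<le> w y"
    using continuous_attains_inf[OF assms(1) False continuous_on_subset[OF w_cont assms(2)]] by blast
  then show ?thesis using w_pos assms(2) by blast
qed

lemma local_L1_tendsto_0:
  assumes K': "compact K'" "K' \<subseteq> U" and u: "\<And>n. u n \<in> C01 U" and lim: "(\<lambda>n. L2_norm meas (u n)) \<longlonglongrightarrow> 0"
  shows "(\<lambda>n. \<integral>x. indicator K' x * cmod (u n x) \<partial>lborel) \<longlonglongrightarrow> 0"
proof -
  obtain w0 where w0: "w0 > 0" "\<And>x. x \<in> K' \<Longrightarrow> w0 \<le> w x" using w_lower_bound[OF K'] by blast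
  have bound: "(\<integral>x. indicator K' x * cmod (u n x) \<partial>lborel)
      \<le> sqrt (measure lborel K') * sqrt (1 / w0 * (L2_norm meas (u n))\<^sup>2)" for n
  proof -
    obtain K where K: "compact K" "K \<subseteq> U" "\<And>x. x \<notin> K \<Longrightarrow> u n x = 0"
      by (rule C01_support[OF u[of n]], rule that)
    have "(\<integral>x. indicator K' x * (cmod (u n x))\<^sup>2 \<partial>lborel) \<le> 1 / w0 * (\<integral>x. (cmod (u n x))\<^sup>2 \<partial>meas)"
    proof (rule integral_on_compact_le[OF K' _ _ _ _ _ K(1,2)])
      show "(cmod (u n x))\<^sup>2 \<le> 1 / w0 * (w x * (cmod (u n x))\<^sup>2)" if "x \<in> K'" for x
        using w0(2)[OF that] w0(1) mult_right_mono[of w0 "w x" "(cmod (u n x))\<^sup>2"] by (simp add: field_simps)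
    qed (use w0 K(3) in \<open>auto intro!: continuous_intros C01_continuous_on[OF u]\<close>)
    also have "(\<integral>x. (cmod (u n x))\<^sup>2 \<partial>meas) = (L2_norm meas (u n))\<^sup>2" by (simp add: L2_norm_def)
    finally have *: "(\<integral>x. indicator K' x * (cmod (u n x))\<^sup>2 \<partial>lborel) \<le> 1 / w0 * (L2_norm meas (u n))\<^sup>2" .
    show ?thesis
      by (rule order_trans[OF L1_le_L2_on_compact[OF C01_continuous_on[OF u] K'(1)]])
        (intro mult_left_mono real_sqrt_le_mono * , simp)
  qed
  have "(\<lambda>n. sqrt (measure lborel K') * sqrt (1 / w0 * (L2_norm meas (u n))\<^sup>2))
      \<longlonglongrightarrow> sqrt (measure lborel K') * sqrt (1 / w0 * 0\<^sup>2)"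
    by (intro tendsto_intros lim)
  then have lim': "(\<lambda>n. sqrt (measure lborel K') * sqrt (1 / w0 * (L2_norm meas (u n))\<^sup>2)) \<longlonglongrightarrow> 0" by simp
  show ?thesis
    by (rule tendsto_sandwich[OF always_eventually always_eventually tendsto_const lim'])
      (use bound in \<open>auto intro!: Bochner_Integration.integral_nonneg\<close>)
qed

text \<open>On \<open>K'\<close> the weight and the ellipticity constant are bounded away from 0, so
  the energy controls the square integral of each partial derivative, and hence its local
  integral.\<close>

lemma local_gradient_bounded:
  assumes K': "compact K'" "K' \<subseteq> U" and u: "\<And>n. u n \<in> C01 U" and E: "\<And>n::nat. energy (u n) \<le> E" and b: "b \<in> Basis"
  shows "\<exists>B\<ge>0. \<forall>n. (\<integral>x. indicator K' x * cmod (frechet (u n) x b) \<partial>lborel) \<le> B"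
proof -
  obtain w0 where w0: "w0 > 0" "\<And>x. x \<in> K' \<Longrightarrow> w0 \<le> w x" using w_lower_bound[OF K'] by blast
  obtain k where k: "k > 0" "\<And>x \<xi>. x \<in> K' \<Longrightarrow> k * (\<Sum>b\<in>Basis. (cmod (\<xi> b))\<^sup>2) \<le> Re (sesq (A x) \<xi> \<xi>)"
    using elliptic[OF K'] by blast
  have bound: "(\<integral>x. indicator K' x * cmod (frechet (u n) x b) \<partial>lborel)
      \<le> sqrt (measure lborel K') * sqrt (1 / (k * w0) * (2 * E))" for n
  proof -
    obtain K where K: "compact K" "K \<subseteq> U" "\<And>x v. x \<notin> K \<Longrightarrow> frechet (u n) x v = 0"
      by (rule C01_support[OF u[of n]], rule that)
    have "(\<integral>x. indicator K' x * (cmod (frechet (u n) x b))\<^sup>2 \<partial>lborel)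
        \<le> 1 / (k * w0) * (\<integral>x. Re (grad_density (u n) (u n) x) \<partial>meas)"
    proof (rule integral_on_compact_le[OF K' _ _ _ _ _ K(1,2)])
      fix x assume x: "x \<in> K'"
      let ?d = "Re (grad_density (u n) (u n) x)"
      have "(cmod (frechet (u n) x b))\<^sup>2 \<le> (\<Sum>b\<in>Basis. (cmod (frechet (u n) x b))\<^sup>2)"
        using b by (intro member_le_sum) auto
      then have "k * (cmod (frechet (u n) x b))\<^sup>2 \<le> ?d"
        using k(2)[OF x, of "frechet (u n) x"] k(1) by (meson less_imp_le mult_left_mono order_trans)
      then have "w0 * (k * (cmod (frechet (u n) x b))\<^sup>2) \<le> w x * ?d"
        using w0(2)[OF x] w0(1) k(1) by (intro mult_mono) auto
      then show "(cmod (frechet (u n) x b))\<^sup>2 \<le> 1 / (k * w0) * (w x * ?d)"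
        using w0(1) k(1) by (simp add: field_simps)
    next
      show "continuous_on U (\<lambda>x. Re (grad_density (u n) (u n) x))"
        by (intro continuous_intros density_continuous u)
      show "0 \<le> Re (grad_density (u n) (u n) x)" if "x \<in> U" for x by (rule sesq_nonneg[OF that])
    qed (use w0 k K(3) in \<open>auto simp: sesq_def intro!: continuous_intros C01_continuous_derivative[OF u]\<close>)
    also have "(\<integral>x. Re (grad_density (u n) (u n) x) \<partial>meas) = 2 * energy (u n)"
      using gf_energy[OF u[of n]] by simp
    also have "1 / (k * w0) * (2 * energy (u n)) \<le> 1 / (k * w0) * (2 * E)"
      using E[of n] w0 k by (intro mult_left_mono) auto
    finally have *: "(\<integral>x. indicator K' x * (cmod (frechet (u n) x b))\<^sup>2 \<partial>lborel) \<le> 1 / (k * w0) * (2 * E)" .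
    show ?thesis
      by (rule order_trans[OF L1_le_L2_on_compact[OF C01_continuous_derivative[OF u] K'(1)]])
        (intro mult_left_mono real_sqrt_le_mono * , simp)
  qed
  moreover have "0 \<le> sqrt (measure lborel K') * sqrt (1 / (k * w0) * (2 * E))"
    by (rule order_trans[OF _ bound[of 0]]) (intro Bochner_Integration.integral_nonneg, simp)
  ultimately show ?thesis by blast
qed

lemma derivative_pairing_tendsto_0:
  assumes u: "\<And>n. u n \<in> C01 U" and E: "\<And>n. energy (u n) \<le> E"
    and lim: "(\<lambda>n. L2_norm meas (u n)) \<longlonglongrightarrow> 0" and b: "b \<in> Basis"
    and W: "continuous_on UNIV W" and K: "compact K" "K \<subseteq> U" "\<And>x. x \<notin> K \<Longrightarrow> W x = 0"
  shows "(\<lambda>n. \<integral>x. frechet (u n) x b * W x \<partial>lborel) \<longlonglongrightarrow> 0"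
proof (rule LIMSEQ_I)
  fix e :: real assume e: "e > 0"
  obtain h0 where h0: "h0 > 0" "(\<Union>x\<in>K. cball x h0) \<subseteq> U"
    using compact_subset_open_imp_cball_epsilon_subset[OF K(1) open_U K(2)] by blast
  define K' where "K' = (\<lambda>(x, t). x + t *\<^sub>R b) ` (K \<times> {-h0..h0})"
  have K'1: "compact K'" unfolding K'_def by (rule compact_translates[OF K(1)])
  have K'2: "K' \<subseteq> U"
  proof
    fix y assume "y \<in> K'"
    then obtain x t where xt: "x \<in> K" "t \<in> {-h0..h0}" "y = x + t *\<^sub>R b" unfolding K'_def by auto
    then have "y \<in> cball x h0" using b by (auto simp: dist_norm)
    then show "y \<in> U" using h0(2) xt(1) by blast
  qed
  obtain B where B: "B \<ge> 0" "\<And>n. (\<integral>x. indicator K' x * cmod (frechet (u n) x b) \<partial>lborel) \<le> B"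
    using local_gradient_bounded[where u = u and E = E, OF K'1 K'2 u E b] by blast
  \<comment> \<open>Order of choices: \<open>\<eta>\<close> beats the gradient bound
    \<open>B\<close>, then \<open>h\<close> comes from the continuity of \<open>W\<close> for this
    \<open>\<eta>\<close>, and finally \<open>n\<close> makes the local integral of
    \<open>u n\<close> beat the fixed factor \<open>2 * S / h\<close>.\<close>
  define \<eta> where "\<eta> = e / (2 * (B + 1))"
  have \<eta>: "\<eta> > 0" "\<eta> * B < e / 2" using e B(1) by (auto simp: \<eta>_def field_simps)
  obtain h where h: "0 < h" "h \<le> h0" and osc: "\<And>x t. \<bar>t\<bar> \<le> h \<Longrightarrow> cmod (W (x - t *\<^sub>R b) - W x) \<le> \<eta>"
    using uniform_translation_continuity[OF W K(1,3) \<eta>(1) h0(1), of b] by blast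
  have "bounded (W ` K)"
    using K(1) W by (intro compact_imp_bounded compact_continuous_image) (auto intro: continuous_on_subset)
  then obtain S where S: "S > 0" "\<And>x. x \<in> K \<Longrightarrow> cmod (W x) \<le> S" unfolding bounded_pos by blast
  have sup: "cmod (W x) \<le> S" for x using S K(3)[of x] by (cases "x \<in> K") auto
  let ?J = "\<lambda>n. \<integral>x. indicator K' x * cmod (u n x) \<partial>lborel"
  have J0: "(\<lambda>n. 2 * S / h * ?J n) \<longlonglongrightarrow> 0"
    using tendsto_mult[OF tendsto_const local_L1_tendsto_0[OF K'1 K'2 u lim], of "2 * S / h"] by simp
  then obtain N where N: "\<And>n. n \<ge> N \<Longrightarrow> norm (2 * S / h * ?J n - 0) < e / 2"
    using LIMSEQ_D[OF J0, of "e/2"] e by auto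
  have "norm ((\<integral>x. frechet (u n) x b * W x \<partial>lborel) - 0) < e" if n: "n \<ge> N" for n
  proof -
    have "h * cmod (\<integral>x. frechet (u n) x b * W x \<partial>lborel)
        \<le> h * (\<eta> * (\<integral>x. indicator K' x * cmod (frechet (u n) x b) \<partial>lborel)) + 2 * S * ?J n"
    proof (rule derivative_pairing_bound[OF C01_C1[OF u] W K(1,3) K'1 _ h(1) osc sup])
      show "x + t *\<^sub>R b \<in> K'" if "x \<in> K" "\<bar>t\<bar> \<le> h" for x t
        unfolding K'_def using that h by (intro image_eqI[of _ _ "(x, t)"]) auto
    qed
    also have "\<dots> \<le> h * (\<eta> * B) + 2 * S * ?J n"
      using h \<eta> B S by (intro add_mono mult_left_mono) auto
    finally have "cmod (\<integral>x. frechet (u n) x b * W x \<partial>lborel) \<le> \<eta> * B + 2 * S / h * ?J n"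
      using h by (simp add: field_simps)
    then show ?thesis
      using \<eta>(2) N[OF n] abs_ge_self[of "2 * S / h * ?J n - 0"] unfolding real_norm_def by simp
  qed
  then show "\<exists>no. \<forall>n\<ge>no. norm ((\<integral>x. frechet (u n) x b * W x \<partial>lborel) - 0) < e" by blast
qed

text \<open>Weight, coefficients and the derivatives of \<open>v\<close> combine into functions
  \<open>W b\<close> that are continuous after extension by zero and supported in a compact subset
  of \<open>U\<close>; \<open>gf (u n) v\<close> is half the sum of their pairings with the partial
  derivatives of \<open>u n\<close>.\<close>

lemma weak_tendsto_0:
  assumes u: "\<And>n. u n \<in> C01 U" and E: "\<And>n. energy (u n) \<le> E"
    and lim: "(\<lambda>n. L2_norm meas (u n)) \<longlonglongrightarrow> 0" and v: "v \<in> C01 U"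
  shows "(\<lambda>n. gf (u n) v) \<longlonglongrightarrow> 0"
proof -
  obtain K where K: "compact K" "K \<subseteq> U" "\<And>x v'. x \<notin> K \<Longrightarrow> frechet v x v' = 0"
    by (rule C01_support[OF v], rule that)
  define F where "F b x = complex_of_real (w x) * (\<Sum>c\<in>Basis. complex_of_real (A x b c) * cnj (frechet v x c))" for b x
  define W where "W b x = (if x \<in> U then F b x else 0)" for b x
  have F: "continuous_on U (F b)" if "b \<in> Basis" for b
    unfolding F_def using that by (intro continuous_intros w_cont A_cont C01_continuous_derivative[OF v])
  have W: "continuous_on UNIV (W b)" if "b \<in> Basis" for b
    unfolding W_def by (rule continuous_on_zero_extension[OF open_U K(1,2) F[OF that]]) (simp add: F_def K(3))
  have W0: "W b x = 0" if "x \<notin> K" for b x by (simp add: W_def F_def K(3)[OF that])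
  obtain p where p: "K \<subseteq> cbox (-p) p" using bounded_subset_cbox_symmetric[OF compact_imp_bounded[OF K(1)]] by blast
  have eq: "gf (u n) v = 1/2 * (\<Sum>b\<in>Basis. \<integral>x. frechet (u n) x b * W b x \<partial>lborel)" for n
  proof -
    have int: "integrable lborel (\<lambda>x. frechet (u n) x b * W b x)" if "b \<in> Basis" for b
      by (rule continuous_zero_outside_integral(1)[OF _ p])
        (auto simp: W0 intro!: continuous_intros C01_continuous_derivative[OF u] W that)
    have "(\<integral>x. grad_density (u n) v x \<partial>meas) = (\<integral>x. indicator K x *\<^sub>R (w x *\<^sub>R grad_density (u n) v x) \<partial>lborel)"
      by (rule integral_compact_support(2)[OF _ density_continuous[OF u v] K(1,2)]) (auto simp: sesq_def K(3))
    also have "\<dots> = (\<integral>x. (\<Sum>b\<in>Basis. frechet (u n) x b * W b x) \<partial>lborel)"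
    proof (intro Bochner_Integration.integral_cong refl)
      fix x
      show "indicator K x *\<^sub>R (w x *\<^sub>R grad_density (u n) v x) = (\<Sum>b\<in>Basis. frechet (u n) x b * W b x)"
      proof (cases "x \<in> K")
        case True
        then have "x \<in> U" using K(2) by blast
        then show ?thesis using True
          by (simp add: sesq_def W_def F_def scaleR_conv_of_real sum_distrib_left mult_ac)
      qed (simp add: W0)
    qed
    also have "\<dots> = (\<Sum>b\<in>Basis. \<integral>x. frechet (u n) x b * W b x \<partial>lborel)"
      by (rule Bochner_Integration.integral_sum) (rule int)
    finally show ?thesis by (simp add: grad_form_def)
  qed
  have "(\<lambda>n. \<integral>x. frechet (u n) x b * W b x \<partial>lborel) \<longlonglongrightarrow> 0" if b: "b \<in> Basis" for b
    by (rule derivative_pairing_tendsto_0[OF u E lim b W[OF b] K(1,2) W0])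
  then have "(\<lambda>n. \<Sum>b\<in>Basis. \<integral>x. frechet (u n) x b * W b x \<partial>lborel) \<longlonglongrightarrow> (\<Sum>b\<in>(Basis :: 'a set). 0)"
    by (rule tendsto_sum)
  from tendsto_mult[OF tendsto_const[of "1/2"] this] show ?thesis unfolding eq by simp
qed

sublocale closable_form "C01 U" gf meas
proof
  show "(\<lambda>_. 0) \<in> C01 U" by (rule C01_zero)
  show "C01 U \<subseteq> L2 meas" by (rule C01_L2)
  fix u assume u: "energy_Cauchy u" and lim: "(\<lambda>n. L2_norm meas (u n)) \<longlonglongrightarrow> 0"
  obtain B where B: "\<And>n. energy (u n) \<le> B\<^sup>2" using energy_Cauchy_bounded[OF u] by blast
  have mem: "u n \<in> C01 U" for n using u by (simp add: energy_Cauchy_def)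
  show "(\<lambda>n. energy (u n)) \<longlonglongrightarrow> 0"
    by (rule energy_tendsto_0_of_weak[OF u]) (rule weak_tendsto_0[OF mem B lim])
qed

end

section \<open>Polar coordinates\<close>

lemma sphere_projection_measurable:
  "(\<lambda>x. x /\<^sub>R norm x) \<in> restrict_space lborel (ball 0 1 - {0::'a::euclidean_space}) \<rightarrow>\<^sub>M restrict_space borel (sphere 0 1)"
proof (rule measurable_restrict_space2)
  show "(\<lambda>x::'a. x /\<^sub>R norm x) \<in> restrict_space lborel (ball 0 1 - {0}) \<rightarrow>\<^sub>M borel"
    by (intro measurable_restrict_space1) simp
qed (auto simp: space_restrict_space)

lemma sets_sphere_measure: "sets (sphere_measure :: (real^'n::finite) measure) = sets (restrict_space borel (sphere 0 1))"
  by (simp add: sphere_measure_def)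

lemma space_sphere_measure: "space (sphere_measure :: (real^'n::finite) measure) = sphere 0 1"
  using sets_eq_imp_space_eq[OF sets_sphere_measure] by (simp add: space_restrict_space)

lemma nn_integral_sphere_measure:
  fixes h :: "real^'n::finite \<Rightarrow> ennreal"
  assumes h: "h \<in> borel_measurable (restrict_space borel (sphere 0 1))"
  shows "(\<integral>\<^sup>+\<phi>. h \<phi> \<partial>sphere_measure)
    = of_nat CARD('n) * (\<integral>\<^sup>+x\<in>ball 0 1 - {0}. h (x /\<^sub>R norm x) \<partial>lborel)"
proof -
  let ?D = "distr (restrict_space lborel (ball 0 1 - {0})) (restrict_space borel (sphere 0 1)) (\<lambda>x::real^'n. x /\<^sub>R norm x)"
  have "(\<integral>\<^sup>+\<phi>. h \<phi> \<partial>sphere_measure) = of_nat CARD('n) * (\<integral>\<^sup>+\<phi>. h \<phi> \<partial>?D)"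
    unfolding sphere_measure_def by (rule nn_integral_scale_measure) (use h in simp)
  also have "(\<integral>\<^sup>+\<phi>. h \<phi> \<partial>?D) = (\<integral>\<^sup>+x. h (x /\<^sub>R norm x) \<partial>restrict_space lborel (ball 0 1 - {0}))"
    by (rule nn_integral_distr[OF sphere_projection_measurable]) (use h in simp)
  also have "\<dots> = (\<integral>\<^sup>+x\<in>ball 0 1 - {0}. h (x /\<^sub>R norm x) \<partial>lborel)"
    by (rule nn_integral_restrict_space) auto
  finally show ?thesis .
qed

lemma nn_integral_lborel_dilation:
  fixes F :: "'a::euclidean_space \<Rightarrow> ennreal"
  assumes F: "F \<in> borel_measurable borel" and c: "c > 0"
  shows "(\<integral>\<^sup>+x. F x \<partial>lborel) = ennreal (c ^ DIM('a)) * (\<integral>\<^sup>+x. F (c *\<^sub>R x) \<partial>lborel)"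
proof -
  have m: "(\<lambda>x::'a. 0 + c *\<^sub>R x) \<in> lborel \<rightarrow>\<^sub>M borel" by simp
  have "(\<integral>\<^sup>+x. F x \<partial>lborel)
      = (\<integral>\<^sup>+x. F x \<partial>density (distr lborel borel (\<lambda>x. 0 + c *\<^sub>R x)) (\<lambda>_. ennreal (\<bar>c\<bar> ^ DIM('a))))"
    using lborel_affine[of c "0::'a"] c by simp
  also have "\<dots> = (\<integral>\<^sup>+x. ennreal (\<bar>c\<bar> ^ DIM('a)) * F x \<partial>distr lborel borel (\<lambda>x. 0 + c *\<^sub>R x))"
    using F by (intro nn_integral_density) auto
  also have "\<dots> = (\<integral>\<^sup>+x. ennreal (\<bar>c\<bar> ^ DIM('a)) * F (0 + c *\<^sub>R x) \<partial>lborel)"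
    using F by (intro nn_integral_distr[OF m]) auto
  also have "\<dots> = ennreal (c ^ DIM('a)) * (\<integral>\<^sup>+x. F (c *\<^sub>R x) \<partial>lborel)"
    using c F by (simp add: nn_integral_cmult)
  finally show ?thesis .
qed

lemma nn_integral_inverse_power_tail:
  assumes c: "c > 0" and d: "d > 0"
  shows "(\<integral>\<^sup>+s\<in>{c<..}. ennreal (inverse (s ^ Suc d)) \<partial>lborel) = ennreal (inverse (real d * c ^ d))"
proof -
  have "(\<integral>\<^sup>+s\<in>{c<..}. ennreal (inverse (s ^ Suc d)) \<partial>lborel)
      = (\<integral>\<^sup>+s. ennreal (inverse (s ^ Suc d)) * indicator {c..} s \<partial>lborel)"
    by (intro nn_integral_cong_AE, rule AE_mp[OF AE_lborel_singleton[of c]]) (auto simp: indicator_def)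
  also have "\<dots> = ennreal (0 - - inverse (real d * c ^ d))"
  proof (rule nn_integral_FTC_atLeast)
    fix s assume s: "c \<le> s"
    then have s0: "s > 0" using c by simp
    have "((\<lambda>s. - inverse (real d * s ^ d)) has_real_derivative
        inverse (real d * s ^ d) * (real d * (real d * s ^ (d - Suc 0))) * inverse (real d * s ^ d)) (at s)"
      using s0 d by (auto intro!: derivative_eq_intros)
    moreover have "inverse (real d * s ^ d) * (real d * (real d * s ^ (d - Suc 0))) * inverse (real d * s ^ d)
        = inverse (s ^ Suc d)"
    proof -
      have "inverse (k * (s * y)) * (k * (k * y)) * inverse (k * (s * y)) = inverse (s * (s * y))"
        if "k > 0" "y > 0" for k y :: real using that s0 by (simp add: field_simps)
      moreover have "s ^ d = s * s ^ (d - Suc 0)" using d by (cases d) auto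
      ultimately show ?thesis using s0 d by simp
    qed
    ultimately show "((\<lambda>s. - inverse (real d * s ^ d)) has_real_derivative inverse (s ^ Suc d)) (at s)"
      by (simp only:)
    show "0 \<le> inverse (s ^ Suc d)" using s0 by simp
  next
    have "filterlim (\<lambda>s::real. s ^ d) at_top at_top" using d by (intro filterlim_pow_at_top filterlim_ident)
    then have "filterlim (\<lambda>s::real. real d * s ^ d) at_top at_top"
      using d by (intro filterlim_tendsto_pos_mult_at_top[OF tendsto_const]) auto
    from tendsto_inverse_0_at_top[OF this]
    show "((\<lambda>s. - inverse (real d * s ^ d)) \<longlongrightarrow> 0) at_top" using tendsto_minus by fastforce
  qed auto
  finally show ?thesis by simp
qed

text \<open>Unfolding \<^const>\<open>sphere_measure\<close> turns the right-hand side into an integral over \<open>(x, r)\<close> with \<open>x\<close> in the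
  unit ball. Substituting \<open>r = s |x|\<close>, then \<open>y = s x\<close> for fixed \<open>s\<close>, leaves the integral of \<open>g y\<close> against
  \<open>d |y|\<^sup>d \<integral>\<^bsub>s > |y|\<^esub> s\<^sup>-\<^sup>d\<^sup>-\<^sup>1 ds = 1\<close>.\<close>

theorem nn_integral_polar:
  fixes g :: "real^'n::finite \<Rightarrow> ennreal"
  assumes g[measurable]: "g \<in> borel_measurable borel"
  shows "(\<integral>\<^sup>+x. g x \<partial>lborel)
    = (\<integral>\<^sup>+\<phi>. (\<integral>\<^sup>+r\<in>{0<..}. ennreal (r ^ (CARD('n) - 1)) * g (r *\<^sub>R \<phi>) \<partial>lborel) \<partial>sphere_measure)"
proof -
  define d where "d = CARD('n)"
  have d: "d > 0" "DIM(real^'n) = d" by (simp_all add: d_def)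
  let ?B = "ball 0 1 - {0::real^'n}"
  \<comment> \<open>\<open>?L\<close> is the integrand after \<open>r = s |x|\<close>,
    \<open>?K\<close> the one after \<open>y = s x\<close>. The condition that \<open>x\<close> lies
    in the unit ball turns into \<open>|y| < s\<close>, the lower limit of the remaining integral in
    \<open>s\<close>.\<close>
  let ?K = "\<lambda>y s. ennreal (norm y ^ d * inverse (s ^ Suc d)) * g y * indicator {0<..} s * indicator (ball 0 s - {0}) y"
  let ?L = "\<lambda>x s. ennreal (norm x ^ d * s ^ (d - 1)) * g (s *\<^sub>R x) * indicator {0<..} s * indicator ?B x"
  let ?R = "\<lambda>x. \<integral>\<^sup>+r\<in>{0<..}. ennreal (r ^ (d - 1)) * g (r *\<^sub>R (x /\<^sub>R norm x)) \<partial>lborel"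
  have powd: "x * x ^ (d - 1) = x ^ d" for x :: real using d(1) by (cases d) auto
  have meas1: "(\<lambda>\<phi>. \<integral>\<^sup>+r\<in>{0<..}. ennreal (r ^ (d - 1)) * g (r *\<^sub>R \<phi>) \<partial>lborel) \<in> borel_measurable borel"
    by measurable
  have "(\<integral>\<^sup>+\<phi>. (\<integral>\<^sup>+r\<in>{0<..}. ennreal (r ^ (d - 1)) * g (r *\<^sub>R \<phi>) \<partial>lborel) \<partial>sphere_measure)
      = of_nat d * (\<integral>\<^sup>+x\<in>?B. ?R x \<partial>lborel)"
    unfolding d_def by (rule nn_integral_sphere_measure) (use meas1 in \<open>simp add: d_def measurable_restrict_space1\<close>)
  also have "(\<integral>\<^sup>+x\<in>?B. ?R x \<partial>lborel)
      = (\<integral>\<^sup>+x. (\<integral>\<^sup>+s. ?L x s \<partial>lborel) \<partial>lborel)"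
  proof (intro nn_integral_cong)
    fix x :: "real^'n"
    show "?R x * indicator ?B x
      = (\<integral>\<^sup>+s. ?L x s \<partial>lborel)"
    proof (cases "x \<in> ?B")
      case True
      then have x: "norm x > 0" by simp
      then have cancel: "norm x * s * inverse (norm x) = s" for s by simp
      have "?R x
        = ennreal \<bar>norm x\<bar> * (\<integral>\<^sup>+s. ennreal ((0 + norm x * s) ^ (d - 1)) * g ((0 + norm x * s) *\<^sub>R (x /\<^sub>R norm x))
            * indicator {0<..} (0 + norm x * s) \<partial>lborel)"
        by (rule nn_integral_real_affine) (use x in auto)
      also have "\<dots> = (\<integral>\<^sup>+s. ennreal (norm x) * (ennreal ((norm x * s) ^ (d - 1)) * g (s *\<^sub>R x) * indicator {0<..} s) \<partial>lborel)"
        using x by (subst nn_integral_cmult[symmetric])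
          (auto simp: indicator_def zero_less_mult_iff cancel intro!: nn_integral_cong)
      also have "\<dots> = (\<integral>\<^sup>+s. ennreal (norm x ^ d * s ^ (d - 1)) * g (s *\<^sub>R x) * indicator {0<..} s \<partial>lborel)"
        by (intro nn_integral_cong)
          (simp add: indicator_def powd[symmetric] power_mult_distrib ennreal_mult' mult_ac)
      finally show ?thesis using True by simp
    qed simp
  qed
  also have "\<dots> = (\<integral>\<^sup>+s. (\<integral>\<^sup>+x. ?L x s \<partial>lborel) \<partial>lborel)"
    by (rule lborel_pair.Fubini') (unfold case_prod_beta indicator_def Diff_iff mem_ball_0 singleton_iff, measurable)
  also have "\<dots> = (\<integral>\<^sup>+s. (\<integral>\<^sup>+y. ?K y s \<partial>lborel) \<partial>lborel)"
  proof (rule nn_integral_cong)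
    fix s :: real
    let ?H = "\<lambda>y. ennreal ((norm y / s) ^ d * s ^ (d - 1)) * g y * indicator {0<..} s * indicator (ball 0 s - {0}) y"
    show "(\<integral>\<^sup>+x. ?L x s \<partial>lborel)
      = (\<integral>\<^sup>+y. ?K y s \<partial>lborel)"
    proof (cases "s > 0")
      case s: True
      have Hm: "?H \<in> borel_measurable borel"
        unfolding indicator_def Diff_iff mem_ball_0 singleton_iff by measurable
      have "(\<integral>\<^sup>+y. ?H y \<partial>lborel) = ennreal (s ^ d) * (\<integral>\<^sup>+x. ?H (s *\<^sub>R x) \<partial>lborel)"
        using nn_integral_lborel_dilation[OF Hm s] by (simp only: d(2))
      then have "ennreal (inverse (s ^ d)) * (\<integral>\<^sup>+y. ?H y \<partial>lborel)
          = ennreal (inverse (s ^ d)) * ennreal (s ^ d) * (\<integral>\<^sup>+x. ?H (s *\<^sub>R x) \<partial>lborel)" by (simp add: mult.assoc)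
      also have "ennreal (inverse (s ^ d)) * ennreal (s ^ d) = 1"
        using s by (simp add: ennreal_mult'[symmetric])
      finally have "(\<integral>\<^sup>+x. ?H (s *\<^sub>R x) \<partial>lborel) = ennreal (inverse (s ^ d)) * (\<integral>\<^sup>+y. ?H y \<partial>lborel)" by simp
      also have "\<dots> = (\<integral>\<^sup>+y. ennreal (inverse (s ^ d)) * ?H y \<partial>lborel)"
        by (rule nn_integral_cmult[symmetric]) (use Hm in simp)
      also have "\<dots> = (\<integral>\<^sup>+y. ?K y s \<partial>lborel)"
      proof (intro nn_integral_cong)
        fix y :: "real^'n"
        have "inverse (s ^ d) * ((norm y / s) ^ d * s ^ (d - 1)) = norm y ^ d * inverse (s ^ Suc d)"
          using s powd[of s] by (simp add: field_simps)
        then have "ennreal (inverse (s ^ d)) * ennreal ((norm y / s) ^ d * s ^ (d - 1))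
            = ennreal (norm y ^ d * inverse (s ^ Suc d))"
          using s by (simp add: ennreal_mult'[symmetric])
        then show "ennreal (inverse (s ^ d)) * ?H y
          = ?K y s"
          by (simp only: mult.assoc[symmetric])
      qed
      also have "(\<integral>\<^sup>+x. ?H (s *\<^sub>R x) \<partial>lborel)
          = (\<integral>\<^sup>+x. ?L x s \<partial>lborel)"
        using s by (intro nn_integral_cong) (auto simp: indicator_def)
      finally show ?thesis .
    qed simp
  qed
  also have "\<dots> = (\<integral>\<^sup>+y. (\<integral>\<^sup>+s. ?K y s \<partial>lborel) \<partial>lborel)"
  proof (rule lborel_pair.Fubini')
    show "(\<lambda>(y, s). ?K y s)
        \<in> borel_measurable (lborel \<Otimes>\<^sub>M lborel)"
      unfolding case_prod_beta indicator_def Diff_iff mem_ball_0 singleton_iff by measurable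
  qed
  also have "of_nat d * \<dots> = (\<integral>\<^sup>+y. g y \<partial>lborel)"
  proof -
    have "of_nat d * (\<integral>\<^sup>+s. ?K y s \<partial>lborel) = g y"
      if y: "y \<noteq> 0" for y :: "real^'n"
    proof -
      have y': "norm y > 0" using y by simp
      have pos: "s > 0" if "norm y < s" for s using y' that by linarith
      have "(\<integral>\<^sup>+s. ?K y s \<partial>lborel)
          = (\<integral>\<^sup>+s. ennreal (norm y ^ d) * g y * (ennreal (inverse (s ^ Suc d)) * indicator {norm y<..} s) \<partial>lborel)"
        using y pos by (intro nn_integral_cong) (auto simp: indicator_def ennreal_mult' mult_ac)
      also have "\<dots> = ennreal (norm y ^ d) * g y * ennreal (inverse (real d * norm y ^ d))"
        by (subst nn_integral_cmult) (auto simp: nn_integral_inverse_power_tail[OF y' d(1)] simp del: power_Suc)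
      finally have "of_nat d * (\<integral>\<^sup>+s. ?K y s \<partial>lborel)
          = (ennreal (real d) * ennreal (norm y ^ d) * ennreal (inverse (real d * norm y ^ d))) * g y"
        by (simp add: ennreal_of_nat_eq_real_of_nat mult_ac)
      also have "ennreal (real d) * ennreal (norm y ^ d) * ennreal (inverse (real d * norm y ^ d)) = 1"
        using y' d(1) by (simp add: ennreal_mult'[symmetric] field_simps)
      finally show ?thesis by simp
    qed
    note * = this
    have m: "(\<lambda>y. \<integral>\<^sup>+s. ?K y s \<partial>lborel)
        \<in> borel_measurable lborel"
      by (rule lborel.borel_measurable_nn_integral)
        (unfold case_prod_beta indicator_def Diff_iff mem_ball_0 singleton_iff, measurable)
    show ?thesis
      unfolding nn_integral_cmult[OF m, symmetric]
      by (intro nn_integral_cong_AE, rule AE_mp[OF AE_lborel_singleton[of 0]], intro AE_I2 impI) (rule *)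
  qed
  finally show ?thesis by (simp add: d_def)
qed

section \<open>The forms of the theorem as gradient forms\<close>

text \<open>Closability involves values on the core only; this transfers it from
  \<open>grad_form\<close> to \<open>form_1d\<close>.\<close>

lemma closable_form_cong:
  assumes "closable_form D q M" and eq: "\<And>f g. f \<in> D \<Longrightarrow> g \<in> D \<Longrightarrow> q' f g = q f g"
  shows "closable_form D q' M"
proof -
  interpret closable_form D q M by fact
  interpret q': hermitian_form D q'
    by standard (simp_all add: eq add_mem scale_mem add_left scale_left nonneg, rule hermitian)
  have "energy_Cauchy u" if u: "q'.energy_Cauchy u" for u
  proof -
    have mem: "u n \<in> D" for n using u by (simp add: q'.energy_Cauchy_def)
    show ?thesis
      using u unfolding energy_Cauchy_def q'.energy_Cauchy_def by (simp add: eq diff_mem mem)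
  qed
  note Cauchy = this
  show ?thesis
  proof
    fix u assume u: "q'.energy_Cauchy u" "(\<lambda>n. L2_norm M (u n)) \<longlonglongrightarrow> 0"
    have mem: "u n \<in> D" for n using u by (simp add: q'.energy_Cauchy_def)
    show "(\<lambda>n. q'.energy (u n)) \<longlonglongrightarrow> 0" using closable[OF Cauchy[OF u(1)] u(2)] by (simp add: eq mem)
  qed (use zero_mem D_L2 in auto)
qed

lemma vec_Basis: "(Basis :: (real^'n::finite) set) = range (\<lambda>i. axis i 1)"
  by (auto simp: Basis_vec_def)

lemma sum_vec_Basis: "(\<Sum>b\<in>(Basis :: (real^'n::finite) set). h b) = (\<Sum>i\<in>UNIV. h (axis i 1))"
  unfolding vec_Basis by (subst sum.reindex) (auto simp: inj_on_def axis_eq_axis)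

abbreviation (input) mat_coeff :: "(real^'n \<Rightarrow> real^'n^'n) \<Rightarrow> real^'n \<Rightarrow> real^'n \<Rightarrow> real^'n::finite \<Rightarrow> real" where
  "mat_coeff a x b c \<equiv> b \<bullet> (a x *v c)"

lemma mat_coeff_axis: "mat_coeff a x (axis i 1) (axis j 1) = a x $ i $ j"
  by (simp add: inner_axis' matrix_vector_mult_basis column_def)

lemma form_D_eq_grad_form: "form_D a Q U = grad_form (mat_coeff a) (\<lambda>x. exp (2 * Q x)) U"
  by (intro ext) (simp add: form_D_def grad_form_def sesq_def sum_vec_Basis mat_coeff_axis partial_deriv_def)

lemma inner_matrix_vector:
  fixes m :: "real^'n::finite^'n"
  shows "u \<bullet> (m *v v) = (\<Sum>i\<in>UNIV. \<Sum>j\<in>UNIV. u $ i * m $ i $ j * v $ j)"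
  by (simp add: inner_vec_def matrix_vector_mult_def sum_distrib_left mult.assoc)

text \<open>Splitting a complex gradient into real and imaginary parts reduces every estimate to the
  real quadratic form of \<open>a x\<close>.\<close>

lemma Re_sesq_mat:
  fixes a :: "real^'n::finite \<Rightarrow> real^'n^'n"
  shows "Re (sesq (mat_coeff a x) \<xi> \<xi>)
    = (let p = (\<chi> i. Re (\<xi> (axis i 1))); s = (\<chi> i. Im (\<xi> (axis i 1))) in p \<bullet> (a x *v p) + s \<bullet> (a x *v s))"
proof -
  have "sesq (mat_coeff a x) \<xi> \<xi> = (\<Sum>i\<in>UNIV. \<Sum>j\<in>UNIV.
      \<xi> (axis i 1) * complex_of_real (a x $ i $ j) * cnj (\<xi> (axis j 1)))"
    by (simp add: sesq_def sum_vec_Basis mat_coeff_axis)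
  then show ?thesis by (simp add: Let_def inner_matrix_vector sum.distrib)
qed

section \<open>The coefficient matrix and its ellipticity\<close>

locale coefficients =
  fixes a :: "real^'n::finite \<Rightarrow> real^'n^'n" and Q :: "real^'n \<Rightarrow> real"
  assumes a_C1: "C1_on UNIV a"
    and a_sym: "\<And>x. transpose (a x) = a x"
    and a_pos: "\<And>x v. v \<noteq> 0 \<Longrightarrow> v \<bullet> (a x *v v) > 0"
    and Q_C1: "C1_on UNIV Q"
begin

lemma a_cont: "continuous_on S a"
  using continuous_on_subset[OF C1_on_imp_continuous_on[OF a_C1]] by simp

lemma a_comp_cont[continuous_intros]: "continuous_on S g \<Longrightarrow> continuous_on S (\<lambda>x. a (g x) $ i $ j)"
  using continuous_on_compose2[OF a_cont[of UNIV]] by (intro continuous_on_component) auto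

lemma Q_cont[continuous_intros]: "continuous_on S g \<Longrightarrow> continuous_on S (\<lambda>x. Q (g x))"
  using continuous_on_compose2[OF C1_on_imp_continuous_on[OF Q_C1]] by auto

lemma quad_cont[continuous_intros]:
  assumes "continuous_on S g" "continuous_on S u" "continuous_on S v"
  shows "continuous_on S (\<lambda>x. u x \<bullet> (a (g x) *v v x))"
  unfolding inner_matrix_vector by (intro continuous_intros assms)

lemma a_symmetric: "a x $ i $ j = a x $ j $ i"
proof -
  have "transpose (a x) $ i $ j = a x $ i $ j" by (simp only: a_sym)
  then show ?thesis by (simp add: transpose_def)
qed

lemma a_inner_commute: "u \<bullet> (a x *v v) = v \<bullet> (a x *v u)"
  unfolding inner_matrix_vector
  by (rule trans[OF sum.swap], intro sum.cong refl, subst a_symmetric) (simp only: mult_ac)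

lemma a_nonneg: "v \<bullet> (a x *v v) \<ge> 0"
  using a_pos[of v x] by (cases "v = 0") auto

text \<open>The quadratic form attains a minimum on the compact set
  \<open>K \<times> sphere 0 1\<close>, which is positive by pointwise definiteness; homogeneity
  extends the bound to all vectors.\<close>

lemma uniformly_elliptic:
  assumes K: "compact K"
  shows "\<exists>k>0. \<forall>x\<in>K. \<forall>v. k * (v \<bullet> v) \<le> v \<bullet> (a x *v v)"
proof (cases "K = {}")
  case True
  then show ?thesis by (intro exI[of _ 1]) auto
next
  case False
  let ?f = "\<lambda>(x, v). v \<bullet> (a x *v v)"
  have ne: "K \<times> sphere (0::real^'n) 1 \<noteq> {}"
    using False by (metis (no_types) empty_iff norm_axis_1 mem_sphere_0 SigmaI equals0I ex_in_conv)
  have "continuous_on (K \<times> sphere (0::real^'n) 1) ?f"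
    unfolding case_prod_beta by (intro continuous_intros)
  then obtain z where z: "z \<in> K \<times> sphere 0 1" "\<And>y. y \<in> K \<times> sphere 0 1 \<Longrightarrow> ?f z \<le> ?f y"
    using continuous_attains_inf[OF compact_Times[OF K compact_sphere] ne] by blast
  obtain x0 v0 where z0: "z = (x0, v0)" by fastforce
  have v0: "v0 \<noteq> 0" using z(1) z0 by auto
  define k where "k = v0 \<bullet> (a x0 *v v0)"
  have k: "k > 0" using a_pos[OF v0] by (simp add: k_def)
  have "k * (v \<bullet> v) \<le> v \<bullet> (a x *v v)" if x: "x \<in> K" for x v
  proof (cases "v = 0")
    case False
    define e where "e = v /\<^sub>R norm v"
    have "k \<le> e \<bullet> (a x *v e)"
      using z(2)[of "(x, e)"] x False by (simp add: z0 k_def e_def)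
    then have "norm v * norm v * k \<le> norm v * norm v * (e \<bullet> (a x *v e))"
      by (intro mult_left_mono) auto
    also have "\<dots> = (norm v *\<^sub>R e) \<bullet> (a x *v (norm v *\<^sub>R e))"
      by (simp add: matrix_vector_mult_scaleR mult.assoc)
    also have "norm v *\<^sub>R e = v" using False by (simp add: e_def)
    finally show ?thesis by (simp add: dot_square_norm power2_eq_square mult_ac)
  qed simp
  then show ?thesis using k by blast
qed

lemma elliptic_form_D:
  assumes U: "open U"
  shows "elliptic_form (mat_coeff a) (\<lambda>x. exp (2 * Q x)) U"
proof
  show "open U" by fact
  show "continuous_on U (\<lambda>x. exp (2 * Q x))" by (intro continuous_intros)
  show "continuous_on U (\<lambda>x. mat_coeff a x b c)" for b c by (intro continuous_intros)
  show "mat_coeff a x b c = mat_coeff a x c b" for x b c by (rule a_inner_commute)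
  fix K :: "(real^'n) set" assume K: "compact K"
  obtain k where k: "k > 0" "\<And>x v. x \<in> K \<Longrightarrow> k * (v \<bullet> v) \<le> v \<bullet> (a x *v v)"
    using uniformly_elliptic[OF K] by blast
  have "k * (\<Sum>b\<in>Basis. (cmod (\<xi> b))\<^sup>2) \<le> Re (sesq (mat_coeff a x) \<xi> \<xi>)" if x: "x \<in> K" for x \<xi>
  proof -
    define p :: "real^'n" where "p = (\<chi> i. Re (\<xi> (axis i 1)))"
    define s :: "real^'n" where "s = (\<chi> i. Im (\<xi> (axis i 1)))"
    have "(\<Sum>b\<in>Basis. (cmod (\<xi> b))\<^sup>2) = p \<bullet> p + s \<bullet> s"
      unfolding sum_vec_Basis cmod_power2 p_def s_def inner_vec_def
      by (simp add: power2_eq_square sum.distrib)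
    then show ?thesis
      using k(2)[OF x, of p] k(2)[OF x, of s] unfolding Re_sesq_mat Let_def p_def[symmetric] s_def[symmetric]
      by (simp add: distrib_left)
  qed
  then show "\<exists>k>0. \<forall>x\<in>K. \<forall>\<xi>. k * (\<Sum>b\<in>Basis. (cmod (\<xi> b))\<^sup>2) \<le> Re (sesq (mat_coeff a x) \<xi> \<xi>)"
    using k(1) by blast
qed auto

lemma le_inf_spec_D_iff:
  assumes U: "open U"
  shows "ereal b \<le> inf_spec_D a Q U
    \<longleftrightarrow> (\<forall>u\<in>C01 U. b * (L2_norm (measure_D Q U) u)\<^sup>2 \<le> Re (form_D a Q U u u))"
proof -
  interpret elliptic_form "mat_coeff a" "\<lambda>x. exp (2 * Q x)" U by (rule elliptic_form_D[OF U])
  show ?thesis using le_inf_spectrum_iff unfolding H_D_def form_D_eq_grad_form .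
qed

end

subsection \<open>One-dimensional forms\<close>

abbreviation (input) coeff_1d :: "(real \<Rightarrow> real) \<Rightarrow> real \<Rightarrow> real \<Rightarrow> real \<Rightarrow> real" where
  "coeff_1d A r b c \<equiv> A r * (b * c)"

lemma sesq_1d: "sesq (coeff_1d A r) \<xi> \<eta> = \<xi> 1 * complex_of_real (A r) * cnj (\<eta> 1)"
  by (simp add: sesq_def)

lemma C01_vector_derivative:
  fixes f :: "real \<Rightarrow> complex"
  assumes "f \<in> C01 I"
  shows "(f has_vector_derivative frechet f r 1) (at r)"
proof -
  note D = C01_has_derivative[OF assms, of r]
  have "(\<lambda>s. s *\<^sub>R frechet f r 1) = frechet f r"
  proof
    fix s :: real
    have "s *\<^sub>R 1 = s" by simp
    then show "s *\<^sub>R frechet f r 1 = frechet f r s"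
      using linear_scale[OF has_derivative_linear[OF D], of s 1] by metis
  qed
  then show ?thesis unfolding has_vector_derivative_def using D by (simp only:)
qed

text \<open>The two derivatives have unrelated junk values where a function is not differentiable, so the forms agree
  only on \<open>C\<^sub>0\<^sup>1\<close>.\<close>

lemma form_1d_eq_grad_form:
  assumes "f \<in> C01 I" "g \<in> C01 I"
  shows "form_1d A w I f g = grad_form (coeff_1d A) w I f g"
  using vector_derivative_at[OF C01_vector_derivative[OF assms(1)]]
    vector_derivative_at[OF C01_vector_derivative[OF assms(2)]]
  unfolding form_1d_def grad_form_def sesq_1d by (simp add: mult_ac)

lemma elliptic_form_1d:
  assumes I: "open I" and w: "continuous_on I w" "\<And>r. r \<in> I \<Longrightarrow> 0 < w r"
    and A: "continuous_on I A" "\<And>r. r \<in> I \<Longrightarrow> 0 < A r"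
  shows "elliptic_form (coeff_1d A) w I"
proof
  show "open I" "continuous_on I w" "\<And>r. r \<in> I \<Longrightarrow> 0 < w r" by fact+
  show "continuous_on I (\<lambda>r. coeff_1d A r b c)" for b c by (intro continuous_intros A)
  fix K assume K: "compact K" "K \<subseteq> I"
  have "\<exists>k>0. \<forall>r\<in>K. k \<le> A r"
  proof (cases "K = {}")
    case True
    then show ?thesis by (intro exI[of _ 1]) auto
  next
    case False
    then obtain r where "r \<in> K" "\<And>y. y \<in> K \<Longrightarrow> A r \<le> A y"
      using continuous_attains_inf[OF K(1) False continuous_on_subset[OF A(1) K(2)]] by blast
    then show ?thesis using A(2) K(2) by blast
  qed
  then obtain k where k: "k > 0" "\<And>r. r \<in> K \<Longrightarrow> k \<le> A r" by blast
  have "k * (cmod (\<xi> 1))\<^sup>2 \<le> Re (sesq (coeff_1d A r) \<xi> \<xi>)" if "r \<in> K" for r \<xi>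
  proof -
    have "Re (sesq (coeff_1d A r) \<xi> \<xi>) = A r * (cmod (\<xi> 1))\<^sup>2"
      unfolding sesq_1d cmod_power2 by (simp add: power2_eq_square algebra_simps)
    then show ?thesis using k(2)[OF that] by (simp add: mult_right_mono)
  qed
  then show "\<exists>k>0. \<forall>r\<in>K. \<forall>\<xi>. k * (\<Sum>b\<in>Basis. (cmod (\<xi> b))\<^sup>2) \<le> Re (sesq (coeff_1d A r) \<xi> \<xi>)"
    using k(1) by auto
qed (simp add: mult.commute)

lemma le_inf_spectrum_1d_iff:
  assumes "elliptic_form (coeff_1d A) w I"
  shows "ereal b \<le> inf_spectrum (weighted_measure w I) (H_1d A w I)
    \<longleftrightarrow> (\<forall>f\<in>C01 I. b * (L2_norm (weighted_measure w I) f)\<^sup>2 \<le> Re (form_1d A w I f f))"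
proof -
  interpret elliptic_form "coeff_1d A" w I by fact
  interpret q: closable_form "C01 I" "form_1d A w I" "weighted_measure w I"
    by (rule closable_form_cong[OF closable_form_axioms form_1d_eq_grad_form])
  show ?thesis unfolding H_1d_def by (rule q.le_inf_spectrum_iff)
qed

subsection \<open>Norm and energy as integrals of non-negative functions\<close>

context elliptic_form
begin

lemma w_measurable: "w \<in> borel_measurable (restrict_space borel U)"
  by (rule borel_measurable_continuous_on_restrict[OF w_cont])

lemma nn_integral_weighted_real:
  assumes G: "continuous_on U G" "\<And>x. x \<in> U \<Longrightarrow> 0 \<le> G x" "integrable meas G"
  shows "ennreal (\<integral>x. G x \<partial>meas) = (\<integral>\<^sup>+x\<in>U. ennreal (w x * G x) \<partial>lborel)"
proof -
  have space: "space meas = U" by (simp add: weighted_measure_def space_restrict_space)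
  have "ennreal (\<integral>x. G x \<partial>meas) = (\<integral>\<^sup>+x. ennreal (G x) \<partial>meas)"
    using G by (intro nn_integral_eq_integral[symmetric] AE_I2) (auto simp: space)
  also have "\<dots> = (\<integral>\<^sup>+x\<in>U. ennreal (w x) * ennreal (G x) \<partial>lborel)"
    using open_U borel_measurable_continuous_on_restrict[OF G(1)]
    by (intro nn_integral_weighted w_measurable) auto
  also have "\<dots> = (\<integral>\<^sup>+x\<in>U. ennreal (w x * G x) \<partial>lborel)"
    by (intro nn_integral_cong) (auto simp: indicator_def ennreal_mult' w_pos[THEN less_imp_le])
  finally show ?thesis .
qed

lemma nn_integral_scaled_norm:
  assumes "u \<in> C01 U" "c \<ge> 0"
  shows "ennreal (c * (L2_norm meas u)\<^sup>2) = (\<integral>\<^sup>+x\<in>U. ennreal (w x * (c * (cmod (u x))\<^sup>2)) \<partial>lborel)"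
proof -
  have "c * (L2_norm meas u)\<^sup>2 = (\<integral>x. c * (cmod (u x))\<^sup>2 \<partial>meas)" by (simp add: L2_norm_def)
  also have "ennreal \<dots> = (\<integral>\<^sup>+x\<in>U. ennreal (w x * (c * (cmod (u x))\<^sup>2)) \<partial>lborel)"
    using L2_integrable[OF mem_L2[OF assms(1)]] assms(2)
    by (intro nn_integral_weighted_real continuous_intros C01_continuous_on[OF assms(1)]) auto
  finally show ?thesis .
qed

lemma nn_integral_norm:
  "u \<in> C01 U \<Longrightarrow> ennreal ((L2_norm meas u)\<^sup>2) = (\<integral>\<^sup>+x\<in>U. ennreal (w x * (cmod (u x))\<^sup>2) \<partial>lborel)"
  using nn_integral_scaled_norm[of u 1] by simp

text \<open>The factor 2 cancels the 1/2 in the form; it is the origin of the \<open>2 * b\<close>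
  in the later inequalities between integrals.\<close>

lemma nn_integral_energy:
  assumes "u \<in> C01 U"
  shows "ennreal (2 * energy u) = (\<integral>\<^sup>+x\<in>U. ennreal (w x * Re (grad_density u u x)) \<partial>lborel)"
proof -
  have "2 * energy u = (\<integral>x. Re (grad_density u u x) \<partial>meas)" using gf_energy[OF assms] by simp
  also have "ennreal \<dots> = (\<integral>\<^sup>+x\<in>U. ennreal (w x * Re (grad_density u u x)) \<partial>lborel)"
    using density_integrable[OF assms assms] sesq_nonneg
    by (intro nn_integral_weighted_real continuous_intros density_continuous assms) auto
  finally show ?thesis .
qed

end

section \<open>Integrals over the sphere\<close>

lemma nn_integral_sphere_const:
  "(\<integral>\<^sup>+\<phi>. c \<partial>(sphere_measure :: (real^'n::finite) measure)) = of_nat CARD('n) * (c * emeasure lborel (ball (0::real^'n) 1))"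
proof -
  have "emeasure lborel (ball (0::real^'n) 1 - {0}) = emeasure lborel (ball (0::real^'n) 1)"
    by (rule emeasure_Diff_null_set) auto
  then show ?thesis
    by (subst nn_integral_sphere_measure) (auto simp: nn_integral_cmult_indicator)
qed

lemma emeasure_space_sphere:
  "emeasure (sphere_measure :: (real^'n::finite) measure) (space sphere_measure)
    = of_nat CARD('n) * emeasure lborel (ball (0::real^'n) 1)"
  using nn_integral_sphere_const[of 1, where 'n = 'n] by simp

interpretation sphere: finite_measure "sphere_measure :: (real^'n::finite) measure"
proof (rule finite_measureI)
  have "emeasure lborel (ball (0::real^'n) 1) \<noteq> top"
    using emeasure_lborel_ball_finite[of "0::real^'n" 1] by (simp add: less_top)
  then show "emeasure (sphere_measure :: (real^'n) measure) (space sphere_measure) \<noteq> \<infinity>"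
    by (simp add: emeasure_space_sphere ennreal_mult_eq_top_iff)
qed

lemma emeasure_space_sphere_neq_0:
  "emeasure (sphere_measure :: (real^'n::finite) measure) (space sphere_measure) \<noteq> 0"
proof -
  have "unit_ball_vol (real CARD('n)) > 0" by simp
  then have "unit_ball_vol (real CARD('n)) \<noteq> 0" by (metis less_irrefl)
  then show ?thesis unfolding emeasure_space_sphere by (simp add: emeasure_ball)
qed

lemma sphere_id_measurable[measurable]: "(\<lambda>\<phi>. \<phi>) \<in> (sphere_measure :: (real^'n::finite) measure) \<rightarrow>\<^sub>M borel"
  by (simp add: measurable_cong_sets[OF sets_sphere_measure refl] measurable_restrict_space1)

context
  fixes H :: "real \<Rightarrow> real^'n::finite \<Rightarrow> real"
  assumes H: "continuous_on UNIV (\<lambda>(r, \<phi>). H r \<phi>)"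
begin

lemma sphere_section_measurable: "H r \<in> borel_measurable sphere_measure"
proof -
  have "continuous_on UNIV (H r)"
    using continuous_on_compose2[OF H continuous_on_Pair[OF continuous_on_const[of UNIV r] continuous_on_id]]
    by simp
  then show ?thesis by (intro measurable_compose[OF sphere_id_measurable] borel_measurable_continuous_onI)
qed

lemma sphere_section_bounded:
  obtains C where "\<And>r \<phi>. \<bar>r\<bar> \<le> K \<Longrightarrow> \<phi> \<in> sphere 0 1 \<Longrightarrow> \<bar>H r \<phi>\<bar> \<le> C"
proof -
  have "compact ((\<lambda>(r, \<phi>). H r \<phi>) ` ({-K..K} \<times> sphere 0 1))"
    by (intro compact_continuous_image compact_Times) (auto intro: continuous_on_subset[OF H])
  then obtain C where C: "\<And>y. y \<in> (\<lambda>(r, \<phi>). H r \<phi>) ` ({-K..K} \<times> sphere 0 1) \<Longrightarrow> norm y \<le> C"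
    using compact_imp_bounded bounded_iff by metis
  have "\<bar>H r \<phi>\<bar> \<le> C" if "\<bar>r\<bar> \<le> K" "\<phi> \<in> sphere 0 1" for r \<phi>
    using C[of "H r \<phi>"] that by (force simp: abs_le_iff)
  then show ?thesis using that by blast
qed

lemma sphere_integrable: "integrable sphere_measure (H r)"
proof -
  obtain C where C: "\<And>s \<phi>. \<bar>s\<bar> \<le> \<bar>r\<bar> \<Longrightarrow> \<phi> \<in> sphere 0 1 \<Longrightarrow> \<bar>H s \<phi>\<bar> \<le> C"
    by (rule sphere_section_bounded[where K = "\<bar>r\<bar>"], rule that)
  show ?thesis
    by (rule sphere.integrable_const_bound[where B = C])
      (auto intro!: AE_I2 C sphere_section_measurable simp: space_sphere_measure)
qed

text \<open>Dominated convergence: the sphere measure is finite, so the bound of \<open>H\<close> on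
  a compact set of pairs is an integrable majorant.\<close>

lemma continuous_on_sphere_integral: "continuous_on S (\<lambda>r. \<integral>\<phi>. H r \<phi> \<partial>sphere_measure)"
proof (rule continuous_on_sequentiallyI)
  fix u :: "nat \<Rightarrow> real" and r assume u: "u \<longlonglongrightarrow> r"
  obtain K where K: "\<And>n. \<bar>u n\<bar> \<le> K"
    using convergent_imp_Bseq[OF convergentI[OF u]] unfolding Bseq_def real_norm_def by blast
  obtain C where C: "\<And>s \<phi>. \<bar>s\<bar> \<le> K \<Longrightarrow> \<phi> \<in> sphere 0 1 \<Longrightarrow> \<bar>H s \<phi>\<bar> \<le> C"
    by (rule sphere_section_bounded[where K = K], rule that)
  show "(\<lambda>n. \<integral>\<phi>. H (u n) \<phi> \<partial>sphere_measure) \<longlonglongrightarrow> (\<integral>\<phi>. H r \<phi> \<partial>sphere_measure)"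
  proof (rule integral_dominated_convergence[where w = "\<lambda>_. C"])
    show "AE \<phi> in sphere_measure. (\<lambda>n. H (u n) \<phi>) \<longlonglongrightarrow> H r \<phi>"
    proof (rule AE_I2)
      fix \<phi> :: "real^'n"
      have "(\<lambda>n. (\<lambda>(r, \<phi>). H r \<phi>) (u n, \<phi>)) \<longlonglongrightarrow> (\<lambda>(r, \<phi>). H r \<phi>) (r, \<phi>)"
        by (rule continuous_on_tendsto_compose[OF H]) (auto intro!: tendsto_intros u)
      then show "(\<lambda>n. H (u n) \<phi>) \<longlonglongrightarrow> H r \<phi>" by simp
    qed
    show "AE \<phi> in sphere_measure. norm (H (u n) \<phi>) \<le> C" for n
      using C[OF K] by (intro AE_I2) (simp add: space_sphere_measure)
  qed (auto intro: sphere_section_measurable)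
qed

lemma sphere_integral_pos:
  assumes "\<And>\<phi>. \<phi> \<in> sphere 0 1 \<Longrightarrow> H r \<phi> > 0"
  shows "(\<integral>\<phi>. H r \<phi> \<partial>sphere_measure) > 0"
proof -
  have "(\<integral>\<phi>. H r \<phi> \<partial>sphere_measure) \<noteq> 0"
  proof
    assume "(\<integral>\<phi>. H r \<phi> \<partial>sphere_measure) = 0"
    then have "AE \<phi> in sphere_measure. H r \<phi> = 0"
      using sphere_integrable assms
      by (subst (asm) integral_nonneg_eq_0_iff_AE) (auto intro!: AE_I2 simp: space_sphere_measure less_imp_le)
    moreover have "AE \<phi> in sphere_measure. H r \<phi> \<noteq> 0"
      using assms by (intro AE_I2) (force simp: space_sphere_measure)
    \<comment> \<open>Strict positivity together with a zero integral would make almost every point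
      absurd, which is impossible for a nonzero measure.\<close>
    ultimately have "AE \<phi> in (sphere_measure :: (real^'n) measure). False" by eventually_elim simp
    then have "(\<integral>\<^sup>+\<phi>. 1 \<partial>(sphere_measure :: (real^'n) measure)) = (\<integral>\<^sup>+\<phi>. 0 \<partial>(sphere_measure :: (real^'n) measure))"
      by (rule nn_integral_cong_AE[OF eventually_mono]) simp
    then show False using emeasure_space_sphere_neq_0[where 'n = 'n] by simp
  qed
  moreover have "(\<integral>\<phi>. H r \<phi> \<partial>sphere_measure) \<ge> 0"
    using assms by (intro integral_nonneg_AE AE_I2) (simp add: space_sphere_measure less_imp_le)
  ultimately show ?thesis by simp
qed

end

section \<open>The coefficients of the radial operators\<close>

lemma (in coefficients) a_invertible: "invertible (a x)"
proof -
  have "v = 0" if "a x *v v = 0" for v using a_pos[of v x] that by (metis inner_zero_right less_irrefl)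
  then show ?thesis using invertible_left_inverse matrix_left_invertible_ker by blast
qed

lemma (in coefficients) a_matrix_inv: "a x *v (matrix_inv (a x) *v v) = v"
proof -
  have "a x ** matrix_inv (a x) = mat 1"
    using someI_ex[OF a_invertible[of x, unfolded invertible_def]] unfolding matrix_inv_def by blast
  then show ?thesis by (simp add: matrix_vector_mul_assoc)
qed

context coefficients
begin

lemma inverse_form_eq:
  "v \<bullet> (matrix_inv (a x) *v v) = (matrix_inv (a x) *v v) \<bullet> (a x *v (matrix_inv (a x) *v v))"
  by (simp add: a_matrix_inv inner_commute)

lemma inverse_form_pos:
  assumes "v \<noteq> 0"
  shows "v \<bullet> (matrix_inv (a x) *v v) > 0"
proof -
  have "matrix_inv (a x) *v v \<noteq> 0" using a_matrix_inv[of x v] assms by auto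
  then show ?thesis unfolding inverse_form_eq by (rule a_pos)
qed

lemma a_cauchy_schwarz: "(u \<bullet> (a x *v v))\<^sup>2 \<le> (u \<bullet> (a x *v u)) * (v \<bullet> (a x *v v))"
proof (cases "v = 0")
  case False
  define N where "N = v \<bullet> (a x *v v)"
  define c where "c = u \<bullet> (a x *v v)"
  have N: "N > 0" unfolding N_def by (rule a_pos[OF False])
  define t where "t = c / N"
  have "0 \<le> (u - t *\<^sub>R v) \<bullet> (a x *v (u - t *\<^sub>R v))" by (rule a_nonneg)
  also have "\<dots> = u \<bullet> (a x *v u) - 2 * t * c + t\<^sup>2 * N"
    using a_inner_commute[of v x u]
    by (simp add: matrix_vector_mult_diff_distrib matrix_vector_mult_scaleR inner_diff_left inner_diff_right
        c_def N_def power2_eq_square algebra_simps)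
  also have "\<dots> = u \<bullet> (a x *v u) - c\<^sup>2 / N" using N by (simp add: t_def power2_eq_square field_simps)
  finally show ?thesis using N by (simp add: c_def[symmetric] N_def[symmetric] field_simps)
qed simp

text \<open>With \<open>y = a\<inverse> v\<close>, \<open>p \<bullet> v = p \<bullet> a y\<close>, so Cauchy--Schwarz for the inner product of \<open>a\<close> applies.\<close>

lemma inner_le_inverse_form: "(p \<bullet> v)\<^sup>2 \<le> (p \<bullet> (a x *v p)) * (v \<bullet> (matrix_inv (a x) *v v))"
  using a_cauchy_schwarz[of p x "matrix_inv (a x) *v v"] unfolding inverse_form_eq by (simp add: a_matrix_inv)

text \<open>By Cramer's rule the components of \<open>matrix_inv (a x) *v v\<close> are quotients of
  determinants in the entries of \<open>a x\<close>, with nonvanishing denominator.\<close>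

lemma inverse_form_cont:
  assumes g: "continuous_on S g"
  shows "continuous_on S (\<lambda>r. v \<bullet> (matrix_inv (a (g r)) *v v))"
proof -
  have nz: "det (a x) \<noteq> 0" for x using a_invertible invertible_det_nz by blast
  have "matrix_inv (a x) *v v = (\<chi> k. det (\<chi> i j. if j = k then v $ i else a x $ i $ j) / det (a x))" for x
    using cramer[OF nz] a_matrix_inv by blast
  moreover have "continuous_on S (\<lambda>r. if P then c else a (g r) $ i $ j)" for P c i j
    by (cases P) (auto intro!: continuous_intros g)
  ultimately show ?thesis
    unfolding inner_vec_def det_def using nz[unfolded det_def] by (auto intro!: continuous_intros g)
qed

lemma A_rad_har_pos: "\<phi> \<in> sphere 0 1 \<Longrightarrow> A_rad_har a r \<phi> > 0"
  unfolding A_rad_har_def by (intro positive_imp_inverse_positive inverse_form_pos) auto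

lemma A_rad_har_cont:
  assumes "\<phi> \<in> sphere 0 1"
  shows "continuous_on S (\<lambda>r. A_rad_har a r \<phi>)"
proof -
  have "\<phi> \<bullet> (matrix_inv (a x) *v \<phi>) \<noteq> 0" for x using inverse_form_pos[of \<phi> x] assms by force
  then show ?thesis
    unfolding A_rad_har_def by (intro continuous_on_inverse inverse_form_cont continuous_intros) blast
qed

lemma w_rad_har_cont: "continuous_on S (w_rad_har Q \<phi>)"
  unfolding w_rad_har_def by (intro continuous_intros)

lemma elliptic_form_har:
  assumes "\<phi> \<in> sphere 0 1" "l \<ge> 0"
  shows "elliptic_form (coeff_1d (\<lambda>r. A_rad_har a r \<phi>)) (w_rad_har Q \<phi>) {l<..}"
  using assms by (intro elliptic_form_1d w_rad_har_cont A_rad_har_cont A_rad_har_pos) (auto simp: w_rad_har_def)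

text \<open>The harmonic coefficient is the reciprocal of the factor in
  \<open>inner_le_inverse_form\<close>, which is applied to the real and the imaginary part of the
  gradient separately.\<close>

lemma A_rad_har_density_le:
  assumes \<phi>: "\<phi> \<in> sphere 0 1" and u: "u \<in> C01 U"
  shows "A_rad_har a r \<phi> * (cmod (frechet u (r *\<^sub>R \<phi>) \<phi>))\<^sup>2
    \<le> Re (sesq (mat_coeff a (r *\<^sub>R \<phi>)) (frechet u (r *\<^sub>R \<phi>)) (frechet u (r *\<^sub>R \<phi>)))"
proof -
  let ?x = "r *\<^sub>R \<phi>"
  define p :: "real^'n" where "p = (\<chi> i. Re (frechet u ?x (axis i 1)))"
  define s :: "real^'n" where "s = (\<chi> i. Im (frechet u ?x (axis i 1)))"
  have lin: "linear (frechet u ?x)" by (rule has_derivative_linear[OF C01_has_derivative[OF u]])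
  have "\<phi> = (\<Sum>b\<in>Basis. (\<phi> \<bullet> b) *\<^sub>R b)" by (simp add: euclidean_representation)
  then have "frechet u ?x \<phi> = frechet u ?x (\<Sum>b\<in>Basis. (\<phi> \<bullet> b) *\<^sub>R b)" by simp
  also have "\<dots> = (\<Sum>i\<in>UNIV. (\<phi> $ i) *\<^sub>R frechet u ?x (axis i 1))"
    by (simp add: linear_sum[OF lin] linear_scale[OF lin] sum_vec_Basis inner_axis)
  finally have D: "frechet u ?x \<phi> = (\<Sum>i\<in>UNIV. (\<phi> $ i) *\<^sub>R frechet u ?x (axis i 1))" .
  have ReIm: "Re (frechet u ?x \<phi>) = p \<bullet> \<phi>" "Im (frechet u ?x \<phi>) = s \<bullet> \<phi>"
    unfolding D p_def s_def inner_vec_def by (simp_all add: mult.commute)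
  let ?N = "\<phi> \<bullet> (matrix_inv (a ?x) *v \<phi>)"
  have N: "?N > 0" using \<phi> by (intro inverse_form_pos) auto
  have "(cmod (frechet u ?x \<phi>))\<^sup>2 \<le> (p \<bullet> (a ?x *v p) + s \<bullet> (a ?x *v s)) * ?N"
    unfolding cmod_power2 ReIm using inner_le_inverse_form[of p \<phi> ?x] inner_le_inverse_form[of s \<phi> ?x]
    by (simp add: distrib_right)
  then have "inverse ?N * (cmod (frechet u ?x \<phi>))\<^sup>2 \<le> p \<bullet> (a ?x *v p) + s \<bullet> (a ?x *v s)"
    using N by (simp add: field_simps)
  then show ?thesis unfolding A_rad_har_def Re_sesq_mat Let_def p_def s_def .
qed

definition w_mean :: "real \<Rightarrow> real" where
  "w_mean r = (\<integral>\<phi>. exp (2 * Q (r *\<^sub>R \<phi>)) \<partial>sphere_measure)"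

text \<open>An unnormalised integral, like \<open>w_mean\<close>: for \<open>r > 0\<close> the
  product of \<open>w_rad_avg\<close> and \<open>A_rad_avg\<close> is
  \<open>r ^ (CARD('n) - 1) * A_mean r\<close>, which is what the energy of a radial function
  produces.\<close>

definition A_mean :: "real \<Rightarrow> real" where
  "A_mean r = (\<integral>\<phi>. (\<phi> \<bullet> (a (r *\<^sub>R \<phi>) *v \<phi>)) * exp (2 * Q (r *\<^sub>R \<phi>)) \<partial>sphere_measure)"

lemma mean_cont:
  "continuous_on UNIV (\<lambda>(r, \<phi>). exp (2 * Q (r *\<^sub>R \<phi>)))"
  "continuous_on UNIV (\<lambda>(r, \<phi>). (\<phi> \<bullet> (a (r *\<^sub>R \<phi>) *v \<phi>)) * exp (2 * Q (r *\<^sub>R \<phi>)))"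
  unfolding case_prod_beta by (intro continuous_intros)+

lemma w_mean_pos: "w_mean r > 0"
  unfolding w_mean_def by (rule sphere_integral_pos[OF mean_cont(1)]) simp

lemma A_mean_pos: "A_mean r > 0"
  unfolding A_mean_def by (rule sphere_integral_pos[OF mean_cont(2)]) (auto intro!: mult_pos_pos a_pos)

lemma A_rad_avg_eq: "A_rad_avg a Q r = A_mean r / w_mean r"
  by (simp add: A_rad_avg_def A_mean_def w_mean_def)

lemma w_rad_avg_eq:
  assumes "r > 0"
  shows "w_rad_avg Q r = r ^ (CARD('n) - 1) * w_mean r"
proof -
  have "2 * beta Q r = real (CARD('n) - 1) * ln r + ln (w_mean r)"
    by (simp add: beta_def w_mean_def of_nat_diff Suc_leI)
  moreover have "exp (real (CARD('n) - 1) * ln r) = r ^ (CARD('n) - 1)"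
    unfolding exp_of_nat_mult using assms by simp
  ultimately show ?thesis using w_mean_pos[of r] by (simp only: w_rad_avg_def exp_add exp_ln)
qed

lemma elliptic_form_avg:
  assumes "l \<ge> 0"
  shows "elliptic_form (coeff_1d (A_rad_avg a Q)) (w_rad_avg Q) {l<..}"
proof (rule elliptic_form_1d)
  have cont: "continuous_on S w_mean" "continuous_on S A_mean" for S
    unfolding w_mean_def[abs_def] A_mean_def[abs_def] by (intro continuous_on_sphere_integral mean_cont)+
  have "continuous_on {l<..} (\<lambda>r. r ^ (CARD('n) - 1) * w_mean r)" by (intro continuous_intros cont)
  then show "continuous_on {l<..} (w_rad_avg Q)"
    by (rule continuous_on_eq) (use assms in \<open>simp add: w_rad_avg_eq\<close>)
  show "continuous_on {l<..} (A_rad_avg a Q)"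
    unfolding A_rad_avg_eq[abs_def] using w_mean_pos by (intro continuous_intros cont) (auto simp: less_imp_neq[symmetric])
  show "0 < w_rad_avg Q r" for r by (simp add: w_rad_avg_def)
  show "0 < A_rad_avg a Q r" for r using A_mean_pos w_mean_pos by (simp add: A_rad_avg_eq)
qed simp

end

section \<open>Radial test functions: the upper bound\<close>

lemma C01_mono: "U \<subseteq> V \<Longrightarrow> C01 U \<subseteq> C01 V"
  by (auto simp: C01_def)

text \<open>The norm is not differentiable at the origin, but \<open>f\<close> vanishes near 0
  because its compact support lies in \<open>{l<..}\<close> with \<open>l \<ge> 0\<close>.\<close>

lemma radial_C01:
  fixes f :: "real \<Rightarrow> complex"
  assumes f: "f \<in> C01 {l<..}" and l: "l \<ge> 0"
  shows "(\<lambda>x::'a::euclidean_space. f (norm x)) \<in> C01 (- cball 0 l)" (is "?C01")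
    and "x \<noteq> 0 \<Longrightarrow> frechet (\<lambda>x::'a. f (norm x)) x h = (sgn x \<bullet> h) *\<^sub>R frechet f (norm x) 1"
proof -
  let ?u = "\<lambda>x::'a. f (norm x)"
  obtain K where K: "compact K" "K \<subseteq> {l<..}" "\<And>r. r \<notin> K \<Longrightarrow> f r = 0" "\<And>r v. r \<notin> K \<Longrightarrow> frechet f r v = 0"
    by (rule C01_support[OF f], rule that)
  \<comment> \<open>The gradient is written as \<open>g x\<close> times \<open>x\<close>. Near the
    origin \<open>g\<close> vanishes together with the derivative of \<open>f\<close>, so it is
    continuous everywhere.\<close>
  define g where "g x = (1 / norm x) *\<^sub>R frechet f (norm x) 1" for x :: 'a
  define D where "D x = blinfun_scaleR_left (g x) o\<^sub>L blinfun_inner_left x" for x :: 'a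
  have open_K: "open {x::'a. norm x \<notin> K}"
    using open_vimage[of "- K" "norm :: 'a \<Rightarrow> real"] K(1)
    by (simp add: compact_imp_closed open_Compl vimage_def continuous_on_norm continuous_on_id)
  have deriv: "(?u has_derivative (\<lambda>h. (sgn x \<bullet> h) *\<^sub>R frechet f (norm x) 1)) (at x)" if "x \<noteq> 0" for x
    using has_derivative_compose[OF has_derivative_norm[OF that] C01_has_derivative[OF f], unfolded o_def]
      linear_scale[OF has_derivative_linear[OF C01_has_derivative[OF f]], of "norm x" "h \<bullet> sgn x" 1 for h]
    by (simp add: inner_commute[of _ "sgn x"])
  from fun_cong[OF frechet_derivative_at[OF deriv], of x h]
  show "x \<noteq> 0 \<Longrightarrow> frechet ?u x h = (sgn x \<bullet> h) *\<^sub>R frechet f (norm x) 1" by simp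
  have D: "(?u has_derivative blinfun_apply (D x)) (at x)" for x
  proof (cases "x = 0")
    case True
    have "blinfun_apply (D x) = (\<lambda>_. 0)" by (simp add: True D_def fun_eq_iff)
    then have "((\<lambda>_. 0) has_derivative blinfun_apply (D x)) (at x)" by simp
    then show ?thesis
      by (rule has_derivative_transform_within_open[OF _ open_K]) (use K(2,3) l True in auto)
  next
    case False
    have "blinfun_apply (D x) = (\<lambda>h. (sgn x \<bullet> h) *\<^sub>R frechet f (norm x) 1)"
      by (auto simp: fun_eq_iff D_def g_def sgn_div_norm divide_inverse mult.commute inner_commute)
    then show ?thesis using deriv[OF False] by simp
  qed
  have "continuous_on (- {0}) g"
    unfolding g_def
    by (intro continuous_intros continuous_on_compose2[OF C01_continuous_derivative[OF f]]) auto
  moreover have "continuous_on {x::'a. norm x \<notin> K} g"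
    by (rule continuous_on_eq[OF continuous_on_const[of _ 0]]) (simp add: g_def K(4))
  ultimately have "continuous_on (- {0} \<union> {x::'a. norm x \<notin> K}) g"
    using open_K by (intro continuous_on_open_Un) auto
  moreover have "- {0} \<union> {x::'a. norm x \<notin> K} = UNIV" using K(2) l by auto
  ultimately have "continuous_on UNIV g" by simp
  then have "continuous_on UNIV D" unfolding D_def by (intro continuous_intros)
  then have "C1_on UNIV ?u" unfolding C1_on_def using D by blast
  moreover have "compact {x::'a. norm x \<in> K}"
  proof -
    have "closed {x::'a. norm x \<in> K}" using open_K by (simp add: closed_def Compl_eq)
    moreover obtain B where "\<And>r. r \<in> K \<Longrightarrow> norm r \<le> B" using compact_imp_bounded[OF K(1)] bounded_iff by metis
    then have "bounded {x::'a. norm x \<in> K}" by (intro boundedI[of _ B]) force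
    ultimately show ?thesis by (simp add: compact_eq_bounded_closed)
  qed
  ultimately show ?C01
    by (rule C01I) (use K in auto)
qed

text \<open>In polar coordinates \<open>h\<close> carries the test function and \<open>H\<close> the
  coefficients. After the exchange of integrals the sphere integral acts on \<open>H\<close> alone
  and yields \<open>w_mean\<close> or \<open>A_mean\<close>.\<close>

lemma nn_integral_separated:
  fixes G :: "real^'n::finite \<Rightarrow> real" and H :: "real \<Rightarrow> real^'n \<Rightarrow> real"
  assumes G: "continuous_on UNIV G" and H: "continuous_on UNIV (\<lambda>(r, \<phi>). H r \<phi>)" "\<And>r \<phi>. 0 \<le> H r \<phi>"
    and h: "\<And>r. 0 \<le> h r" and GH: "\<And>r \<phi>. r > 0 \<Longrightarrow> \<phi> \<in> sphere 0 1 \<Longrightarrow> G (r *\<^sub>R \<phi>) = h r * H r \<phi>"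
  shows "(\<integral>\<^sup>+x. ennreal (G x) \<partial>lborel)
    = (\<integral>\<^sup>+r\<in>{0<..}. ennreal (r ^ (CARD('n) - 1) * (h r * (\<integral>\<phi>. H r \<phi> \<partial>sphere_measure))) \<partial>lborel)"
proof -
  interpret pair_sigma_finite "sphere_measure :: (real^'n) measure" "lborel :: real measure"
    by (intro pair_sigma_finite.intro sphere.sigma_finite_measure_axioms lborel.sigma_finite_measure_axioms)
  have Gm[measurable]: "G \<in> borel_measurable borel" by (rule borel_measurable_continuous_onI[OF G])
  have "(\<integral>\<^sup>+x. ennreal (G x) \<partial>lborel)
      = (\<integral>\<^sup>+\<phi>. (\<integral>\<^sup>+r. ennreal (r ^ (CARD('n) - 1)) * ennreal (G (r *\<^sub>R \<phi>)) * indicator {0<..} r \<partial>lborel) \<partial>sphere_measure)"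
    by (rule nn_integral_polar) measurable
  also have "\<dots> = (\<integral>\<^sup>+r. (\<integral>\<^sup>+\<phi>. ennreal (r ^ (CARD('n) - 1)) * ennreal (G (r *\<^sub>R \<phi>)) * indicator {0<..} r \<partial>sphere_measure) \<partial>lborel)"
    by (rule Fubini'[symmetric]) (unfold case_prod_beta, measurable)
  also have "\<dots> = (\<integral>\<^sup>+r\<in>{0<..}. ennreal (r ^ (CARD('n) - 1) * (h r * (\<integral>\<phi>. H r \<phi> \<partial>sphere_measure))) \<partial>lborel)"
  proof (rule nn_integral_cong)
    fix r :: real
    show "(\<integral>\<^sup>+\<phi>. ennreal (r ^ (CARD('n) - 1)) * ennreal (G (r *\<^sub>R \<phi>)) * indicator {0<..} r \<partial>sphere_measure)
      = ennreal (r ^ (CARD('n) - 1) * (h r * (\<integral>\<phi>. H r \<phi> \<partial>sphere_measure))) * indicator {0<..} r"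
    proof (cases "r > 0")
      case r: True
      have "(\<integral>\<^sup>+\<phi>. ennreal (r ^ (CARD('n) - 1)) * ennreal (G (r *\<^sub>R \<phi>)) * indicator {0<..} r \<partial>sphere_measure)
          = (\<integral>\<^sup>+\<phi>. ennreal (r ^ (CARD('n) - 1) * h r * H r \<phi>) \<partial>sphere_measure)"
        using r by (intro nn_integral_cong)
          (simp add: space_sphere_measure GH h H(2) ennreal_mult'[symmetric] mult.assoc)
      also have "\<dots> = ennreal (\<integral>\<phi>. r ^ (CARD('n) - 1) * h r * H r \<phi> \<partial>sphere_measure)"
        using r h H(2) by (intro nn_integral_eq_integral integrable_mult_right sphere_integrable[OF H(1)] AE_I2) simp
      finally show ?thesis using r by (simp add: mult.assoc)
    qed simp
  qed
  finally show ?thesis .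
qed

lemma ereal_le_of_real_lower_bounds:
  assumes "\<And>b. ereal b \<le> x \<Longrightarrow> ereal b \<le> y"
  shows "x \<le> y"
proof (rule ccontr)
  assume "\<not> x \<le> y"
  then obtain b where "y < ereal b" "ereal b < x" using ereal_dense2[of y x] by (auto simp: not_le)
  then show False using assms[of b] by (simp add: less_imp_le not_le[symmetric])
qed

lemma ennreal_eq_imp_eq: "ennreal x = ennreal y \<Longrightarrow> 0 \<le> x \<Longrightarrow> 0 \<le> y \<Longrightarrow> x = y"
  by simp

context coefficients
begin

text \<open>The gradient at \<open>r *\<^sub>R \<phi>\<close> is the derivative of \<open>f\<close>
  times \<open>\<phi>\<close>, so only the radial entry of \<open>a\<close> survives, the quantity
  averaged in \<open>A_rad_avg\<close>.\<close>

lemma sesq_radial: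
  assumes "r > 0" "\<phi> \<in> sphere 0 1" and f: "f \<in> C01 {l<..}" "l \<ge> 0"
  shows "Re (sesq (mat_coeff a (r *\<^sub>R \<phi>)) (frechet (\<lambda>x. f (norm x)) (r *\<^sub>R \<phi>)) (frechet (\<lambda>x. f (norm x)) (r *\<^sub>R \<phi>)))
    = (cmod (frechet f r 1))\<^sup>2 * (\<phi> \<bullet> (a (r *\<^sub>R \<phi>) *v \<phi>))"
proof -
  let ?x = "r *\<^sub>R \<phi>" and ?c = "frechet f r 1"
  have x: "?x \<noteq> 0" "norm ?x = r" "sgn ?x = \<phi>" using assms by (auto simp: sgn_div_norm)
  have D: "frechet (\<lambda>x. f (norm x)) ?x h = (\<phi> \<bullet> h) *\<^sub>R ?c" for h
    using radial_C01(2)[OF f x(1)] by (simp only: x)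
  have "(\<chi> i. Re (frechet (\<lambda>x. f (norm x)) ?x (axis i 1))) = Re ?c *\<^sub>R \<phi>"
    "(\<chi> i. Im (frechet (\<lambda>x. f (norm x)) ?x (axis i 1))) = Im ?c *\<^sub>R \<phi>"
    by (simp_all add: D vec_eq_iff inner_axis)
  then show ?thesis
    unfolding Re_sesq_mat Let_def cmod_power2
    by (simp add: matrix_vector_mult_scaleR power2_eq_square algebra_simps)
qed

text \<open>Keeping \<open>U\<close> and \<open>l\<close> separate covers the whole space, with
  \<open>l = 0\<close> and \<open>U = UNIV\<close>, as well as the exterior of a ball.\<close>

lemma radial_energy:
  assumes f: "f \<in> C01 {l<..}" and l: "l \<ge> 0" and U: "open U" "- cball 0 l \<subseteq> U"
  defines "u \<equiv> \<lambda>x::real^'n. f (norm x)"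
  shows "u \<in> C01 U"
    and "(L2_norm (measure_D Q U) u)\<^sup>2 = (L2_norm (weighted_measure (w_rad_avg Q) {l<..}) f)\<^sup>2"
    and "Re (form_D a Q U u u) = Re (form_1d (A_rad_avg a Q) (w_rad_avg Q) {l<..} f f)"
proof -
  show uU: "u \<in> C01 U" using radial_C01(1)[OF f l] C01_mono[OF U(2)] unfolding u_def by blast
  interpret D: elliptic_form "mat_coeff a" "\<lambda>x. exp (2 * Q x)" U by (rule elliptic_form_D[OF U(1)])
  \<comment> \<open>Polar coordinates need an integrand on the whole space. Extended by zero,
    \<open>u\<close> is a test function on \<open>UNIV\<close>, and this second instance gives
    continuity of the density there.\<close>
  interpret T: elliptic_form "mat_coeff a" "\<lambda>x. exp (2 * Q x)" UNIV by (rule elliptic_form_D) simp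
  interpret avg: elliptic_form "coeff_1d (A_rad_avg a Q)" "w_rad_avg Q" "{l<..}"
    by (rule elliptic_form_avg[OF l])
  obtain K where K: "K \<subseteq> {l<..}" "\<And>r. r \<notin> K \<Longrightarrow> f r = 0" "\<And>r v. r \<notin> K \<Longrightarrow> frechet f r v = 0"
    by (rule C01_support[OF f], rule that)
  obtain K' where K': "K' \<subseteq> U" "\<And>x. x \<notin> K' \<Longrightarrow> u x = 0" "\<And>x v. x \<notin> K' \<Longrightarrow> frechet u x v = 0"
    by (rule C01_support[OF uU], rule that)
  have u0: "frechet u x v = 0" if "x \<notin> U" for x v using K' that by blast
  have uT: "u \<in> C01 UNIV" using uU C01_mono[of U UNIV] by blast
  let ?d = "CARD('n) - 1"
  show "(L2_norm (measure_D Q U) u)\<^sup>2 = (L2_norm (weighted_measure (w_rad_avg Q) {l<..}) f)\<^sup>2"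
  proof (rule ennreal_eq_imp_eq)
    have "ennreal ((L2_norm D.meas u)\<^sup>2) = (\<integral>\<^sup>+x. ennreal (exp (2 * Q x) * (cmod (u x))\<^sup>2) \<partial>lborel)"
      unfolding D.nn_integral_norm[OF uU] using K' by (intro nn_integral_cong) (auto simp: indicator_def)
    also have "\<dots> = (\<integral>\<^sup>+r\<in>{0<..}. ennreal (r ^ ?d * ((cmod (f r))\<^sup>2 * w_mean r)) \<partial>lborel)"
      unfolding w_mean_def
      by (rule nn_integral_separated)
        (auto simp: u_def intro!: continuous_intros mean_cont C01_continuous_on[OF uT, unfolded u_def])
    also have "\<dots> = (\<integral>\<^sup>+r\<in>{l<..}. ennreal (w_rad_avg Q r * (cmod (f r))\<^sup>2) \<partial>lborel)"
    proof (intro nn_integral_cong)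
      fix r :: real
      show "ennreal (r ^ ?d * ((cmod (f r))\<^sup>2 * w_mean r)) * indicator {0<..} r
        = ennreal (w_rad_avg Q r * (cmod (f r))\<^sup>2) * indicator {l<..} r"
      proof (cases "r > l")
        case True
        then show ?thesis using l by (simp add: w_rad_avg_eq mult_ac)
      next
        case False
        then have "f r = 0" using K(1,2) by auto
        then show ?thesis by simp
      qed
    qed
    also have "\<dots> = ennreal ((L2_norm avg.meas f)\<^sup>2)" by (rule avg.nn_integral_norm[OF f, symmetric])
    finally show "ennreal ((L2_norm D.meas u)\<^sup>2) = ennreal ((L2_norm avg.meas f)\<^sup>2)" .
  qed auto
  have "2 * D.energy u = 2 * avg.energy f"
  proof (rule ennreal_eq_imp_eq)
    have "ennreal (2 * D.energy u) = (\<integral>\<^sup>+x. ennreal (exp (2 * Q x) * Re (D.grad_density u u x)) \<partial>lborel)"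
      unfolding D.nn_integral_energy[OF uU] using u0 by (intro nn_integral_cong) (auto simp: indicator_def sesq_def)
    also have "\<dots> = (\<integral>\<^sup>+r\<in>{0<..}. ennreal (r ^ ?d * ((cmod (frechet f r 1))\<^sup>2 * A_mean r)) \<partial>lborel)"
      unfolding A_mean_def
    proof (rule nn_integral_separated)
      show "continuous_on UNIV (\<lambda>x. exp (2 * Q x) * Re (D.grad_density u u x))"
        by (intro continuous_intros T.density_continuous uT)
      show "exp (2 * Q (r *\<^sub>R \<phi>)) * Re (D.grad_density u u (r *\<^sub>R \<phi>))
        = (cmod (frechet f r 1))\<^sup>2 * ((\<phi> \<bullet> (a (r *\<^sub>R \<phi>) *v \<phi>)) * exp (2 * Q (r *\<^sub>R \<phi>)))"
        if "r > 0" "\<phi> \<in> sphere 0 1" for r \<phi>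
        unfolding u_def sesq_radial[OF that f l] by simp
    qed (auto intro!: mean_cont mult_nonneg_nonneg a_nonneg)
    also have "\<dots> = (\<integral>\<^sup>+r\<in>{l<..}. ennreal (w_rad_avg Q r * Re (avg.grad_density f f r)) \<partial>lborel)"
    proof (intro nn_integral_cong)
      fix r :: real
      have *: "r ^ ?d * ((cmod (frechet f r 1))\<^sup>2 * A_mean r) = w_rad_avg Q r * Re (avg.grad_density f f r)" if "r > l"
      proof -
        have "Re (avg.grad_density f f r) = A_rad_avg a Q r * (cmod (frechet f r 1))\<^sup>2"
          unfolding sesq_1d cmod_power2 by (simp add: power2_eq_square algebra_simps)
        then show ?thesis using that l w_mean_pos[of r] by (simp add: w_rad_avg_eq A_rad_avg_eq)
      qed
      show "ennreal (r ^ ?d * ((cmod (frechet f r 1))\<^sup>2 * A_mean r)) * indicator {0<..} r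
        = ennreal (w_rad_avg Q r * Re (avg.grad_density f f r)) * indicator {l<..} r"
      proof (cases "r > l")
        case True
        then show ?thesis using * l by simp
      next
        case False
        then have "frechet f r 1 = 0" using K(1,3) by auto
        then show ?thesis using False by simp
      qed
    qed
    also have "\<dots> = ennreal (2 * avg.energy f)" by (rule avg.nn_integral_energy[OF f, symmetric])
    finally show "ennreal (2 * D.energy u) = ennreal (2 * avg.energy f)" .
  qed (use D.nonneg[OF uU] avg.nonneg[OF f] in auto)
  then show "Re (form_D a Q U u u) = Re (form_1d (A_rad_avg a Q) (w_rad_avg Q) {l<..} f f)"
    by (simp add: form_D_eq_grad_form form_1d_eq_grad_form[OF f f])
qed

lemma inf_spec_D_le_avg:
  assumes l: "l \<ge> 0" and U: "open U" "- cball 0 l \<subseteq> U"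
  shows "inf_spec_D a Q U \<le> inf_spec_rad_avg a Q {l<..}"
proof (rule ereal_le_of_real_lower_bounds)
  fix b assume "ereal b \<le> inf_spec_D a Q U"
  then have D: "b * (L2_norm (measure_D Q U) u)\<^sup>2 \<le> Re (form_D a Q U u u)" if "u \<in> C01 U" for u
    using that unfolding le_inf_spec_D_iff[OF U(1)] by blast
  show "ereal b \<le> inf_spec_rad_avg a Q {l<..}"
    unfolding H_rad_avg_def le_inf_spectrum_1d_iff[OF elliptic_form_avg[OF l]]
  proof
    fix f assume f: "f \<in> C01 {l<..}"
    show "b * (L2_norm (weighted_measure (w_rad_avg Q) {l<..}) f)\<^sup>2
        \<le> Re (form_1d (A_rad_avg a Q) (w_rad_avg Q) {l<..} f f)"
      using D[OF radial_energy(1)[OF f l U]] unfolding radial_energy(2,3)[OF f l U] .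
  qed
qed

end

section \<open>Restriction to rays: the lower bound\<close>

text \<open>The derivative is known on \<open>S\<close> only. Off \<open>K\<close> the function is
  locally zero, and uniqueness of derivatives forces \<open>f'\<close> to vanish on
  \<open>S - K\<close>, so its extension by zero is continuous.\<close>

lemma C01_real_glueI:
  fixes f :: "real \<Rightarrow> complex"
  assumes S: "open S" and K: "compact K" "K \<subseteq> S" "K \<subseteq> I" "\<And>r. r \<notin> K \<Longrightarrow> f r = 0"
    and f': "\<And>r. r \<in> S \<Longrightarrow> (f has_vector_derivative f' r) (at r)" "continuous_on S f'"
  shows "f \<in> C01 I" and "r \<in> S \<Longrightarrow> frechet f r 1 = f' r"
proof -
  let ?g = "\<lambda>r. if r \<in> S then f' r else 0"
  have zero: "(f has_vector_derivative 0) (at r)" if "r \<notin> K" for r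
  proof (rule has_vector_derivative_transform_within_open[of "\<lambda>_. 0" _ _ "- K"])
    show "open (- K)" using K(1) by (simp add: compact_imp_closed open_Compl)
  qed (use that K(4) in auto)
  have "f' r = 0" if "r \<in> S" "r \<notin> K" for r
    using vector_derivative_unique_at[OF f'(1)[OF that(1)] zero[OF that(2)]] .
  then have cont: "continuous_on UNIV ?g" by (intro continuous_on_zero_extension[OF S K(1,2) f'(2)])
  have deriv: "(f has_vector_derivative ?g r) (at r)" for r
    using f'(1)[of r] zero[of r] K(2) by auto
  have "C1_on UNIV f"
    unfolding C1_on_def
  proof (intro exI conjI ballI)
    show "(f has_derivative blinfun_apply (blinfun_scaleR_left (?g r))) (at r)" for r
      using deriv[of r] unfolding has_vector_derivative_def blinfun_scaleR_left.rep_eq .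
    show "continuous_on UNIV (\<lambda>r. blinfun_scaleR_left (?g r))" using cont by (intro continuous_intros)
  qed
  then show fI: "f \<in> C01 I" by (rule C01I[OF _ K(1,3,4)])
  show "frechet f r 1 = f' r" if "r \<in> S"
    by (rule vector_derivative_unique_at[OF C01_vector_derivative[OF fI] f'(1)[OF that]])
qed

section \<open>A logarithmic cutoff near the origin\<close>

lemma DERIV_max_0_power2: "((\<lambda>t::real. (max 0 t)\<^sup>2) has_real_derivative 2 * max 0 t) (at t)"
proof -
  consider "t < 0" | "t > 0" | "t = 0" by linarith
  then show ?thesis
  proof cases
    case 1
    have "((\<lambda>t::real. 0) has_real_derivative 2 * max 0 t) (at t)" using 1 by simp
    then show ?thesis by (rule has_field_derivative_transform_within_open[of _ _ _ "{..<0}"]) (use 1 in auto)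
  next
    case 2
    have "((\<lambda>t::real. t\<^sup>2) has_real_derivative 2 * max 0 t) (at t)"
      using 2 by (auto intro!: derivative_eq_intros)
    then show ?thesis by (rule has_field_derivative_transform_within_open[of _ _ _ "{0<..}"]) (use 2 in auto)
  next
    case 3
    have "((\<lambda>h::real. max 0 h) \<longlongrightarrow> max 0 0) (at 0)" by (intro tendsto_intros)
    moreover have "((max 0 (0 + h))\<^sup>2 - (max 0 0)\<^sup>2) / h = max 0 h" if "h \<noteq> 0" for h :: real
      using that by (simp add: max_def power2_eq_square)
    ultimately have "(\<lambda>h::real. ((max 0 (0 + h))\<^sup>2 - (max 0 0)\<^sup>2) / h) \<midarrow>0\<rightarrow> max 0 0"
      by (subst LIM_equal[of 0 _ "\<lambda>h. max 0 h"]) auto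
    then show ?thesis unfolding 3 DERIV_def by simp
  qed
qed

text \<open>The quadratic B-spline of integral 1 on \<open>[0, 1]\<close> and its antiderivative, as combinations of powers of
  truncated linear functions, so that differentiability reduces to that of \<open>max 0 t\<^sup>2\<close>.\<close>

definition smoothstep :: "real \<Rightarrow> real" where
  "smoothstep t = 2 * (max 0 t)\<^sup>2 - 4 * (max 0 (t - 1/2))\<^sup>2 + 2 * (max 0 (t - 1))\<^sup>2"

definition smoothstep' :: "real \<Rightarrow> real" where
  "smoothstep' t = 4 * max 0 t - 8 * max 0 (t - 1/2) + 4 * max 0 (t - 1)"

lemma DERIV_smoothstep: "(smoothstep has_real_derivative smoothstep' t) (at t)"
proof -
  have shift: "((\<lambda>t::real. (max 0 (t - c))\<^sup>2) has_real_derivative 2 * max 0 (t - c)) (at t)" for c t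
  proof -
    have "((\<lambda>t::real. t - c) has_real_derivative 1) (at t)" by (auto intro!: derivative_eq_intros)
    from DERIV_chain2[where f = "\<lambda>t. (max 0 t)\<^sup>2", OF DERIV_max_0_power2 this] show ?thesis by simp
  qed
  show ?thesis
    unfolding smoothstep_def[abs_def] smoothstep'_def
    by (rule derivative_eq_intros DERIV_max_0_power2 shift refl)+ simp
qed

lemma smoothstep_eq_0: "t \<le> 0 \<Longrightarrow> smoothstep t = 0"
  by (simp add: smoothstep_def)

lemma smoothstep'_eq_0: "t \<le> 0 \<or> t \<ge> 1 \<Longrightarrow> smoothstep' t = 0"
  by (auto simp: smoothstep'_def max_def)

lemma smoothstep_eq_1: "t \<ge> 1 \<Longrightarrow> smoothstep t = 1"
  by (simp add: smoothstep_def max_def power2_eq_square algebra_simps)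

lemma smoothstep_bounds: "0 \<le> smoothstep t" "smoothstep t \<le> 1"
proof -
  consider "t \<le> 0" | "0 < t" "t \<le> 1/2" | "1/2 < t" "t < 1" | "t \<ge> 1" by linarith
  then have "0 \<le> smoothstep t \<and> smoothstep t \<le> 1"
  proof cases
    case 2
    then have "smoothstep t = 2 * t\<^sup>2" by (simp add: smoothstep_def max_def)
    moreover have "t\<^sup>2 \<le> (1/2)\<^sup>2" using 2 by (intro power_mono) auto
    ultimately show ?thesis by (simp add: power2_eq_square)
  next
    case 3
    then have "smoothstep t = 1 - 2 * (1 - t)\<^sup>2" by (simp add: smoothstep_def max_def power2_eq_square algebra_simps)
    moreover have "(1 - t)\<^sup>2 \<le> (1/2)\<^sup>2" using 3 by (intro power_mono) auto
    ultimately show ?thesis by (simp add: power2_eq_square)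
  qed (simp_all add: smoothstep_eq_0 smoothstep_eq_1)
  then show "0 \<le> smoothstep t" "smoothstep t \<le> 1" by auto
qed

text \<open>The derivative is a hat function on \<open>[0, 1]\<close> with peak value 2 at
  1/2.\<close>

lemma smoothstep'_bound: "\<bar>smoothstep' t\<bar> \<le> 2"
  by (simp add: smoothstep'_def max_def abs_le_iff)

lemma nn_integral_inverse_interval:
  assumes "0 < s" "s \<le> t"
  shows "(\<integral>\<^sup>+r\<in>{s..t}. ennreal (inverse r) \<partial>lborel) = ennreal (ln t - ln s)"
  using assms by (intro nn_integral_FTC_Icc) (auto intro!: derivative_eq_intros simp: divide_inverse)

text \<open>The argument of \<open>smoothstep\<close> runs from 0 to 1 while \<open>ln r\<close>
  runs from \<open>-2 * m\<close> to \<open>-m\<close>, a transition of length \<open>m\<close> on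
  the logarithmic scale. For \<open>r \<le> 0\<close> the value is fixed at 0 independently of what
  \<open>ln\<close> returns.\<close>

definition log_cutoff :: "real \<Rightarrow> real \<Rightarrow> real" where
  "log_cutoff m r = (if r > 0 then smoothstep (2 + ln r / m) else 0)"

text \<open>Points have zero capacity in dimension at least two: the logarithmic cutoffs, which vanish on \<open>(0, e\<^sup>-\<^sup>2\<^sup>m]\<close>
  and equal 1 on \<open>[e\<^sup>-\<^sup>m, \<infinity>)\<close>, satisfy \<open>\<integral> |\<chi>'|\<^sup>2 r dr = O(1/m)\<close>.\<close>

lemma log_cutoff_extension:
  fixes v v' :: "real \<Rightarrow> complex" and w A :: "real \<Rightarrow> real"
  assumes H: "\<And>g. g \<in> C01 {0<..} \<Longrightarrow> (\<integral>\<^sup>+r\<in>{0<..}. ennreal (c * (w r * (cmod (g r))\<^sup>2)) \<partial>lborel)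
      \<le> (\<integral>\<^sup>+r\<in>{0<..}. ennreal (w r * (A r * (cmod (frechet g r 1))\<^sup>2)) \<partial>lborel)"
    and v: "\<And>r. (v has_vector_derivative v' r) (at r)" "continuous_on UNIV v'" "\<And>r. r > B \<Longrightarrow> v r = 0"
    and V: "\<And>r. 0 < r \<Longrightarrow> r < 1 \<Longrightarrow> cmod (v r) \<le> V"
    and cont: "continuous_on UNIV w" "continuous_on UNIV A" and pos: "\<And>r. 0 < r \<Longrightarrow> 0 \<le> w r" "\<And>r. 0 < r \<Longrightarrow> 0 \<le> A r"
    and C: "C \<ge> 0" "\<And>r. 0 < r \<Longrightarrow> r < 1 \<Longrightarrow> w r * A r \<le> C * r" and c: "c \<ge> 0"
  shows "(\<integral>\<^sup>+r\<in>{0<..}. ennreal (c * (w r * (cmod (v r))\<^sup>2)) \<partial>lborel)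
      \<le> (\<integral>\<^sup>+r\<in>{0<..}. ennreal (w r * (A r * (cmod (v' r))\<^sup>2)) \<partial>lborel)" (is "?X \<le> ?Y")
proof -
  have cv: "continuous_on UNIV v" using v(1) by (meson continuous_at_imp_continuous_on has_vector_derivative_continuous)
  have [measurable]: "v \<in> borel_measurable borel" "v' \<in> borel_measurable borel"
    "w \<in> borel_measurable borel" "A \<in> borel_measurable borel"
    using cv v(2) cont by (auto intro: borel_measurable_continuous_onI)
  \<comment> \<open>The weight \<open>1 / real (Suc k)\<close> in Young's inequality multiplies the
    cutoff term by \<open>1 + real (Suc k)\<close>. That term is of order \<open>1 / m k\<close>, so
    a square makes the product tend to 0.\<close>
  define m where "m k = (real (Suc k))\<^sup>2" for k
  have m: "m k > 0" for k by (simp add: m_def)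
  let ?E = "\<lambda>r z. w r * (A r * (cmod z)\<^sup>2)"
  define cut where "cut k = log_cutoff (m k)" for k
  define cut' where "cut' k r = smoothstep' (2 + ln r / m k) * (inverse r / m k)" for k r
  \<comment> \<open>The 4 is the square of the bound 2 for \<open>smoothstep'\<close>;
    \<open>C\<close> and \<open>V\<close> bound the weight and the function near the origin.\<close>
  define M where "M = 4 * C * V\<^sup>2"
  have M: "M \<ge> 0" using C by (simp add: M_def)
  let ?f = "\<lambda>k r. ennreal (c * (w r * (cut k r * cmod (v r))\<^sup>2))"
  have cut_deriv: "(cut k has_real_derivative cut' k r) (at r)" if "r > 0" for k r
  proof -
    have "((\<lambda>r. 2 + ln r / m k) has_real_derivative (inverse r / m k)) (at r)"
      using that m[of k] by (auto intro!: derivative_eq_intros simp: divide_inverse)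
    from DERIV_chain2[OF DERIV_smoothstep this]
    have "((\<lambda>r. smoothstep (2 + ln r / m k)) has_real_derivative cut' k r) (at r)" by (simp add: cut'_def)
    then show ?thesis
      by (rule has_field_derivative_transform_within_open[of _ _ _ "{0<..}"])
        (use that in \<open>auto simp: cut_def log_cutoff_def\<close>)
  qed
  have cut_bounds: "0 \<le> cut k r" "cut k r \<le> 1" for k r by (auto simp: cut_def log_cutoff_def smoothstep_bounds)
  have cut_0: "cut k r = 0" if "r < exp (- 2 * m k)" for k r
  proof (cases "r > 0")
    case True
    then have "ln r < - 2 * m k" using that ln_less_cancel_iff[of r "exp (- 2 * m k)"] by simp
    then have "2 + ln r / m k \<le> 0" using m[of k] by (simp add: field_simps)
    then show ?thesis using True by (simp add: cut_def log_cutoff_def smoothstep_eq_0)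
  qed (simp add: cut_def log_cutoff_def)
  have bound: "(\<integral>\<^sup>+r\<in>{0<..}. ?f k r \<partial>lborel)
      \<le> ennreal (1 + 1 / real (Suc k)) * ?Y + ennreal ((1 + real (Suc k)) * M / m k)" for k
  proof -
    let ?g = "\<lambda>r. complex_of_real (cut k r) * v r"
    let ?g' = "\<lambda>r. complex_of_real (cut k r) * v' r + complex_of_real (cut' k r) * v r"
    let ?N = "real (Suc k)"
    let ?I = "{exp (- 2 * m k)..exp (- m k)}"
    have split: "ennreal (p * e + q * (t * indicator I x)) = ennreal p * ennreal e + ennreal q * (ennreal t * indicator I x)"
      if "0 \<le> p" "0 \<le> e" "0 \<le> q" "0 \<le> t" for p e q t x :: real and I
      using that by (cases "x \<in> I") (simp_all add: ennreal_mult ennreal_plus)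
    have cut_cont: "continuous_on {0<..} (cut k)"
      using cut_deriv by (intro continuous_at_imp_continuous_on ballI) (auto dest: DERIV_isCont)
    have cut'_cont: "continuous_on {0<..} (cut' k)"
      unfolding cut'_def smoothstep'_def using m[of k] by (intro continuous_intros) auto
    have g_deriv: "(?g has_vector_derivative ?g' r) (at r)" if r: "r \<in> {0<..}" for r
    proof -
      have "(cut k has_vector_derivative cut' k r) (at r)"
        using cut_deriv[of r k] r by (simp add: has_real_derivative_iff_has_vector_derivative)
      then have "((\<lambda>r. complex_of_real (cut k r)) has_vector_derivative complex_of_real (cut' k r)) (at r)"
        by (rule bounded_linear.has_vector_derivative[OF bounded_linear_of_real])
      from has_vector_derivative_mult[OF this v(1)] show ?thesis .
    qed
    have g'_cont: "continuous_on {0<..} ?g'"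
      by (intro continuous_intros cut_cont cut'_cont continuous_on_subset[OF v(2)] continuous_on_subset[OF cv]) auto
    have g: "?g \<in> C01 {0<..}" "\<And>r. r \<in> {0<..} \<Longrightarrow> frechet ?g r 1 = ?g' r"
      by (rule C01_real_glueI[where K = "{exp (- 2 * m k)..B}" and f' = ?g' and S = "{0<..}"];
          use g_deriv g'_cont cut_0 v(3) in \<open>force intro: less_le_trans[OF exp_gt_zero] simp: not_le\<close>)+
    have "(\<integral>\<^sup>+r\<in>{0<..}. ?f k r \<partial>lborel)
        = (\<integral>\<^sup>+r\<in>{0<..}. ennreal (c * (w r * (cmod (?g r))\<^sup>2)) \<partial>lborel)"
      using cut_bounds[of k] by (simp add: norm_mult)
    also have "\<dots> \<le> (\<integral>\<^sup>+r\<in>{0<..}. ennreal (?E r (frechet ?g r 1)) \<partial>lborel)" by (rule H[OF g(1)])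
    also have "\<dots> \<le> (\<integral>\<^sup>+r. ennreal (1 + 1 / ?N) * (ennreal (?E r (v' r)) * indicator {0<..} r)
        + ennreal ((1 + ?N) * M / (m k)\<^sup>2) * (ennreal (inverse r) * indicator ?I r) \<partial>lborel)"
    proof (rule nn_integral_mono)
      fix r :: real
      show "ennreal (?E r (frechet ?g r 1)) * indicator {0<..} r
        \<le> ennreal (1 + 1 / ?N) * (ennreal (?E r (v' r)) * indicator {0<..} r)
          + ennreal ((1 + ?N) * M / (m k)\<^sup>2) * (ennreal (inverse r) * indicator ?I r)"
      proof (cases "r > 0")
        case r: True
        have wA: "0 \<le> w r * A r" using pos[OF r] by simp
        have "(cmod (?g' r))\<^sup>2 \<le> (1 + 1 / ?N) * (cmod (complex_of_real (cut k r) * v' r))\<^sup>2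
            + (1 + 1 / (1 / ?N)) * (cmod (complex_of_real (cut' k r) * v r))\<^sup>2"
          by (rule cmod_add_power2_le_weighted) simp
        also have "\<dots> \<le> (1 + 1 / ?N) * (cmod (v' r))\<^sup>2 + (1 + ?N) * ((cut' k r)\<^sup>2 * (cmod (v r))\<^sup>2)"
        proof (intro add_mono mult_left_mono)
          show "(cmod (complex_of_real (cut k r) * v' r))\<^sup>2 \<le> (cmod (v' r))\<^sup>2"
            using cut_bounds[of k r] by (intro power_mono) (auto simp: norm_mult mult_left_le_one_le)
        qed (auto simp: norm_mult power_mult_distrib)
        finally have "w r * A r * (cmod (?g' r))\<^sup>2
            \<le> w r * A r * ((1 + 1 / ?N) * (cmod (v' r))\<^sup>2 + (1 + ?N) * ((cut' k r)\<^sup>2 * (cmod (v r))\<^sup>2))"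
          by (rule mult_left_mono[OF _ wA])
        also have "\<dots> = (1 + 1 / ?N) * (?E r (v' r))
            + (1 + ?N) * (w r * A r * ((cut' k r)\<^sup>2 * (cmod (v r))\<^sup>2))"
          by (simp add: algebra_simps)
        \<comment> \<open>On the transition interval the squared derivative of the cutoff is at most
          \<open>4 / (r * m k)\<^sup>2\<close>; with \<open>w r * A r \<le> C * r\<close> this
          leaves \<open>1 / r\<close>, whose integral over the interval is \<open>m k\<close>. Off
          the interval the derivative vanishes.\<close>
        also have "\<dots> \<le> (1 + 1 / ?N) * (?E r (v' r)) + (1 + ?N) * (M / (m k)\<^sup>2 * (inverse r * indicator ?I r))"
        proof (intro add_left_mono mult_left_mono)
          show "w r * A r * ((cut' k r)\<^sup>2 * (cmod (v r))\<^sup>2) \<le> M / (m k)\<^sup>2 * (inverse r * indicator ?I r)"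
          proof (cases "r \<in> ?I")
            case True
            have "exp (- m k) < 1" using m[of k] by simp
            moreover have "r \<le> exp (- m k)" using True by simp
            ultimately have r1: "r < 1" by linarith
            have "(smoothstep' (2 + ln r / m k))\<^sup>2 \<le> 2\<^sup>2"
              using smoothstep'_bound[of "2 + ln r / m k"] abs_le_square_iff by fastforce
            then have "(cut' k r)\<^sup>2 \<le> 2\<^sup>2 * (inverse r / m k)\<^sup>2"
              unfolding cut'_def power_mult_distrib by (intro mult_right_mono) auto
            moreover have "(cmod (v r))\<^sup>2 \<le> V\<^sup>2" using V[OF r r1] by (intro power_mono) auto
            ultimately have "(cut' k r)\<^sup>2 * (cmod (v r))\<^sup>2 \<le> 2\<^sup>2 * (inverse r / m k)\<^sup>2 * V\<^sup>2"
              by (intro mult_mono) auto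
            then have "w r * A r * ((cut' k r)\<^sup>2 * (cmod (v r))\<^sup>2) \<le> C * r * (2\<^sup>2 * (inverse r / m k)\<^sup>2 * V\<^sup>2)"
              using C(1) r by (intro mult_mono[OF C(2)[OF r r1]]) auto
            also have "\<dots> = M / (m k)\<^sup>2 * inverse r"
              using r m[of k] by (simp add: M_def power2_eq_square field_simps)
            finally show ?thesis using True by simp
          next
            case False
            then have "ln r < - 2 * m k \<or> ln r > - m k"
              using ln_less_cancel_iff[OF r exp_gt_zero, of "- 2 * m k"]
                ln_less_cancel_iff[OF exp_gt_zero r, of "- m k"] by auto
            then have "2 + ln r / m k \<le> 0 \<or> 2 + ln r / m k \<ge> 1" using m[of k] by (auto simp: field_simps)
            then have "cut' k r = 0" by (simp add: cut'_def smoothstep'_eq_0)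
            then show ?thesis using False by simp
          qed
        qed simp
        finally have "?E r (frechet ?g r 1)
            \<le> (1 + 1 / ?N) * (?E r (v' r)) + (1 + ?N) * (M / (m k)\<^sup>2 * (inverse r * indicator ?I r))"
          using g(2) r by (simp add: mult.assoc)
        then have "ennreal (?E r (frechet ?g r 1))
            \<le> ennreal ((1 + 1 / ?N) * (?E r (v' r)) + (1 + ?N) * M / (m k)\<^sup>2 * (inverse r * indicator ?I r))"
          by (intro ennreal_leI) (simp add: mult.assoc)
        also have "\<dots> = ennreal (1 + 1 / ?N) * ennreal (?E r (v' r))
            + ennreal ((1 + ?N) * M / (m k)\<^sup>2) * (ennreal (inverse r) * indicator ?I r)"
          using pos[OF r] r M by (intro split) auto
        finally show ?thesis using r by simp
      qed simp
    qed
    also have "\<dots> = ennreal (1 + 1 / ?N) * ?Y + ennreal ((1 + ?N) * M / (m k)\<^sup>2) * (\<integral>\<^sup>+r\<in>?I. ennreal (inverse r) \<partial>lborel)"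
      by (subst nn_integral_add) (auto simp: nn_integral_cmult)
    also have "(\<integral>\<^sup>+r\<in>?I. ennreal (inverse r) \<partial>lborel) = ennreal (m k)"
      using m[of k] by (subst nn_integral_inverse_interval) auto
    also have "ennreal ((1 + ?N) * M / (m k)\<^sup>2) * ennreal (m k) = ennreal ((1 + ?N) * M / m k)"
      using m[of k] M by (simp add: ennreal_mult'[symmetric] power2_eq_square)
    finally show ?thesis .
  qed
  \<comment> \<open>Preparation for Fatou's lemma: for fixed \<open>r > 0\<close> the cutoff is
    eventually equal to 1, since \<open>m k\<close> tends to infinity.\<close>
  have "?X = (\<integral>\<^sup>+r. liminf (\<lambda>k. ?f k r * indicator {0<..} r) \<partial>lborel)"
  proof (rule nn_integral_cong)
    fix r :: real
    show "ennreal (c * (w r * (cmod (v r))\<^sup>2)) * indicator {0<..} r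
      = liminf (\<lambda>k. ?f k r * indicator {0<..} r)"
    proof (cases "r > 0")
      case r: True
      have "cut k r = 1" if k: "real k \<ge> \<bar>ln r\<bar>" for k
      proof -
        have "real k \<le> m k" by (simp add: m_def power2_eq_square algebra_simps)
        then have "- m k \<le> ln r" using k by linarith
        then have "2 + ln r / m k \<ge> 1" using m[of k] by (simp add: field_simps)
        then show ?thesis using r by (simp add: cut_def log_cutoff_def smoothstep_eq_1)
      qed
      then have "eventually (\<lambda>k. cut k r = 1) sequentially"
        using eventually_ge_at_top[of "nat \<lceil>\<bar>ln r\<bar>\<rceil>"] by (auto elim!: eventually_mono simp: nat_ceiling_le_eq)
      then have "(\<lambda>k. ?f k r * indicator {0<..} r)
          \<longlonglongrightarrow> ennreal (c * (w r * (cmod (v r))\<^sup>2)) * indicator {0<..} r"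
        by (intro tendsto_eventually) (auto elim: eventually_mono)
      then show ?thesis by (intro lim_imp_Liminf[symmetric]) auto
    qed (simp add: Liminf_const)
  qed
  also have "\<dots> \<le> liminf (\<lambda>k. \<integral>\<^sup>+r\<in>{0<..}. ?f k r \<partial>lborel)"
  proof (rule nn_integral_liminf)
    have "cut k \<in> borel_measurable borel" for k
      unfolding cut_def log_cutoff_def[abs_def] smoothstep_def by measurable
    then show "(\<lambda>r. ?f k r * indicator {0<..} r) \<in> borel_measurable lborel" for k
      by measurable
  qed
  also have "\<dots> \<le> liminf (\<lambda>k. ennreal (1 + 1 / real (Suc k)) * ?Y + ennreal ((1 + real (Suc k)) * M / m k))"
    by (intro Liminf_mono always_eventually allI bound)
  also have "\<dots> \<le> ?Y"
  proof (cases "?Y = \<infinity>")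
    case False
    then obtain y where y: "y \<ge> 0" "?Y = ennreal y" by (cases ?Y) auto
    have inv: "(\<lambda>k. inverse (real (Suc k))) \<longlonglongrightarrow> 0" by (rule LIMSEQ_inverse_real_of_nat)
    have "(\<lambda>k. (1 + inverse (real (Suc k))) * y + M * (inverse (real (Suc k)) * inverse (real (Suc k)) + inverse (real (Suc k))))
        \<longlonglongrightarrow> (1 + 0) * y + M * (0 * 0 + 0)"
      by (intro tendsto_intros inv)
    then have "(\<lambda>k. ennreal ((1 + inverse (real (Suc k))) * y + M * (inverse (real (Suc k)) * inverse (real (Suc k)) + inverse (real (Suc k)))))
        \<longlonglongrightarrow> ennreal y"
      by (intro tendsto_ennrealI) simp
    moreover have "ennreal (1 + 1 / real (Suc k)) * ennreal y + ennreal ((1 + real (Suc k)) * M / m k)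
        = ennreal ((1 + inverse (real (Suc k))) * y + M * (inverse (real (Suc k)) * inverse (real (Suc k)) + inverse (real (Suc k))))" for k
    proof -
      define N where "N = real (Suc k)"
      have N: "N > 0" by (simp add: N_def)
      have e: "(1 + N) * M / m k = M * (inverse N * inverse N + inverse N)"
        using N unfolding m_def N_def[symmetric] by (simp add: power2_eq_square field_simps)
      have "0 \<le> M * (inverse N * inverse N + inverse N)" using M N by simp
      then show ?thesis
        unfolding N_def[symmetric] e using y(1) N by (subst ennreal_plus) (auto simp: ennreal_mult divide_inverse)
    qed
    ultimately show ?thesis unfolding y(2) by (simp add: lim_imp_Liminf)
  qed simp
  finally show ?thesis .
qed

text \<open>The spectral bound in the shape needed for integration over directions. The sign of
  \<open>b\<close> matters because \<open>ennreal\<close> truncates negative numbers.\<close>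

lemma nn_integral_form_1d_bound:
  assumes form: "elliptic_form (coeff_1d A) w I"
    and b: "b \<ge> 0" "ereal b \<le> inf_spectrum (weighted_measure w I) (H_1d A w I)" and g: "g \<in> C01 I"
  shows "(\<integral>\<^sup>+r\<in>I. ennreal (2 * b * (w r * (cmod (g r))\<^sup>2)) \<partial>lborel)
    \<le> (\<integral>\<^sup>+r\<in>I. ennreal (w r * (A r * (cmod (frechet g r 1))\<^sup>2)) \<partial>lborel)"
proof -
  interpret elliptic_form "coeff_1d A" w I by fact
  have "b * (L2_norm meas g)\<^sup>2 \<le> energy g"
    using b(2) g unfolding le_inf_spectrum_1d_iff[OF form] form_1d_eq_grad_form[OF g g, symmetric] by blast
  then have "ennreal (2 * b * (L2_norm meas g)\<^sup>2) \<le> ennreal (2 * energy g)" by (intro ennreal_leI) simp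
  moreover have "ennreal (2 * b * (L2_norm meas g)\<^sup>2) = (\<integral>\<^sup>+r\<in>I. ennreal (2 * b * (w r * (cmod (g r))\<^sup>2)) \<partial>lborel)"
    using nn_integral_scaled_norm[OF g, of "2 * b"] b(1) by (simp add: mult.left_commute)
  moreover have "ennreal (2 * energy g) = (\<integral>\<^sup>+r\<in>I. ennreal (w r * (A r * (cmod (frechet g r 1))\<^sup>2)) \<partial>lborel)"
  proof -
    have "Re (grad_density g g r) = A r * (cmod (frechet g r 1))\<^sup>2" for r
      unfolding sesq_1d cmod_power2 by (simp add: power2_eq_square algebra_simps)
    then show ?thesis using nn_integral_energy[OF g] by (simp only:)
  qed
  ultimately show ?thesis by simp
qed

section \<open>Estimates on single rays and their integration over the sphere\<close>

lemma ray_has_vector_derivative: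
  fixes u :: "'a::real_normed_vector \<Rightarrow> complex"
  assumes "u \<in> C01 U"
  shows "((\<lambda>r. u (r *\<^sub>R \<phi>)) has_vector_derivative frechet u (r *\<^sub>R \<phi>) \<phi>) (at r)"
proof -
  have "((\<lambda>r. r *\<^sub>R \<phi>) has_derivative (\<lambda>s. s *\<^sub>R \<phi>)) (at r)" by (auto intro!: derivative_eq_intros)
  from has_derivative_compose[OF this C01_has_derivative[OF assms]]
  show ?thesis
    unfolding has_vector_derivative_def
    by (simp add: linear_scale[OF has_derivative_linear[OF C01_has_derivative[OF assms]]])
qed

context coefficients
begin

text \<open>Both integrals run over the whole ray even for the exterior problem, where
  \<open>u\<close> vanishes up to radius \<open>l\<close>; the integration over directions is thus
  the same in both cases.\<close>

definition ray_bound :: "real \<Rightarrow> real^'n \<Rightarrow> (real^'n \<Rightarrow> complex) \<Rightarrow> bool" where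
  "ray_bound b \<phi> u \<longleftrightarrow> (\<integral>\<^sup>+r\<in>{0<..}. ennreal (2 * b * (w_rad_har Q \<phi> r * (cmod (u (r *\<^sub>R \<phi>)))\<^sup>2)) \<partial>lborel)
    \<le> (\<integral>\<^sup>+r\<in>{0<..}. ennreal (w_rad_har Q \<phi> r * (A_rad_har a r \<phi> * (cmod (frechet u (r *\<^sub>R \<phi>) \<phi>))\<^sup>2)) \<partial>lborel)"

text \<open>The support of \<open>u\<close> keeps a positive distance from the closed ball, so the
  restriction to the ray has compact support in \<open>{l<..}\<close> and is itself an admissible
  test function.\<close>

lemma ray_bound_exterior:
  assumes \<phi>: "\<phi> \<in> sphere 0 1" and l: "l \<ge> 0" and b: "b \<ge> 0" "ereal b \<le> inf_spec_rad_har a Q \<phi> {l<..}"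
    and u: "u \<in> C01 (- cball 0 l)"
  shows "ray_bound b \<phi> u"
proof -
  let ?A = "\<lambda>r. A_rad_har a r \<phi>" and ?w = "w_rad_har Q \<phi>" and ?u' = "\<lambda>r. frechet u (r *\<^sub>R \<phi>) \<phi>"
  obtain K where K: "compact K" "K \<subseteq> - cball 0 l" "\<And>x. x \<notin> K \<Longrightarrow> u x = 0" "\<And>x v. x \<notin> K \<Longrightarrow> frechet u x v = 0"
    by (rule C01_support[OF u], rule that)
  have norm: "norm (r *\<^sub>R \<phi>) = \<bar>r\<bar>" for r using \<phi> by simp
  define K1 where "K1 = {0..} \<inter> (\<lambda>r. r *\<^sub>R \<phi>) -` K"
  have "closed ((\<lambda>r. r *\<^sub>R \<phi>) -` K)"
    using K(1) by (intro closed_vimage continuous_intros compact_imp_closed)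
  then have "closed K1" unfolding K1_def by (intro closed_Int) auto
  moreover obtain B where B: "\<And>x. x \<in> K \<Longrightarrow> norm x \<le> B" using compact_imp_bounded[OF K(1)] bounded_iff by metis
  have "bounded K1" by (rule boundedI[of _ B]) (use B norm in \<open>force simp: K1_def\<close>)
  ultimately have K1: "compact K1" by (simp add: compact_eq_bounded_closed)
  have out: "r *\<^sub>R \<phi> \<notin> K" if "0 \<le> r" "r \<le> l" for r using K(2) norm[of r] that by auto
  have K1l: "K1 \<subseteq> {l<..}"
  proof
    fix r assume "r \<in> K1"
    then have "0 \<le> r" "r *\<^sub>R \<phi> \<in> K" by (auto simp: K1_def)
    then show "r \<in> {l<..}" using out[of r] by force
  qed
  \<comment> \<open>Negative \<open>r\<close> would run along the opposite ray, where
    \<open>u\<close> need not vanish.\<close>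
  define g where "g r = (if r > 0 then u (r *\<^sub>R \<phi>) else 0)" for r
  have glue: "(g has_vector_derivative ?u' r) (at r)" if "r \<in> {0<..}" for r
    by (rule has_vector_derivative_transform_within_open[OF ray_has_vector_derivative[OF u], of "{0<..}"])
      (use that in \<open>auto simp: g_def\<close>)
  have cont: "continuous_on {0<..} (\<lambda>r. ?u' r)"
    by (intro continuous_on_compose2[OF C01_continuous_derivative[OF u, of UNIV]] continuous_intros) auto
  have K1_0: "K1 \<subseteq> {0<..}" using K1l l by (meson greaterThan_subset_iff order_trans)
  have g0: "g r = 0" if "r \<notin> K1" for r using that K(3) by (auto simp: g_def K1_def)
  note glueI = C01_real_glueI[OF open_greaterThan K1 K1_0 K1l g0 glue cont]
  have g: "g \<in> C01 {l<..}" by (rule glueI(1))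
  have g': "frechet g r 1 = ?u' r" if "r > 0" for r using glueI(2) that by simp
  have "(\<integral>\<^sup>+r\<in>{0<..}. ennreal (2 * b * (?w r * (cmod (u (r *\<^sub>R \<phi>)))\<^sup>2)) \<partial>lborel)
      = (\<integral>\<^sup>+r\<in>{l<..}. ennreal (2 * b * (?w r * (cmod (g r))\<^sup>2)) \<partial>lborel)"
  proof (intro nn_integral_cong)
    fix r
    show "ennreal (2 * b * (?w r * (cmod (u (r *\<^sub>R \<phi>)))\<^sup>2)) * indicator {0<..} r
      = ennreal (2 * b * (?w r * (cmod (g r))\<^sup>2)) * indicator {l<..} r"
      using out[of r] K(3)[of "r *\<^sub>R \<phi>"] l by (cases "r > l"; cases "r > 0") (auto simp: g_def)
  qed
  also have "\<dots> \<le> (\<integral>\<^sup>+r\<in>{l<..}. ennreal (?w r * (?A r * (cmod (frechet g r 1))\<^sup>2)) \<partial>lborel)"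
    using b(2) unfolding H_rad_har_def by (rule nn_integral_form_1d_bound[OF elliptic_form_har[OF \<phi> l] b(1) _ g])
  also have "\<dots> = (\<integral>\<^sup>+r\<in>{0<..}. ennreal (?w r * (?A r * (cmod (?u' r))\<^sup>2)) \<partial>lborel)"
  proof (intro nn_integral_cong)
    fix r
    show "ennreal (?w r * (?A r * (cmod (frechet g r 1))\<^sup>2)) * indicator {l<..} r
      = ennreal (?w r * (?A r * (cmod (?u' r))\<^sup>2)) * indicator {0<..} r"
      using out[of r] K(4)[of "r *\<^sub>R \<phi>" \<phi>] l g'[of r] by (cases "r > l"; cases "r > 0") auto
  qed
  finally show ?thesis unfolding ray_bound_def .
qed

lemma ray_bound_full:
  assumes dim: "CARD('n) \<ge> 2" and \<phi>: "\<phi> \<in> sphere 0 1"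
    and b: "b \<ge> 0" "ereal b \<le> inf_spec_rad_har a Q \<phi> {0<..}" and u: "u \<in> C01 UNIV"
  shows "ray_bound b \<phi> u"
  unfolding ray_bound_def
proof -
  let ?A = "\<lambda>r. A_rad_har a r \<phi>" and ?w = "w_rad_har Q \<phi>" and ?u' = "\<lambda>r. frechet u (r *\<^sub>R \<phi>) \<phi>"
  obtain K where K: "compact K" "\<And>x. x \<notin> K \<Longrightarrow> u x = 0" by (rule C01_support[OF u], rule that)
  obtain B where B: "\<And>x. x \<in> K \<Longrightarrow> norm x \<le> B" using compact_imp_bounded[OF K(1)] bounded_iff by metis
  have "bounded (u ` K)"
    by (intro compact_imp_bounded compact_continuous_image C01_continuous_on[OF u] K(1))
  then obtain V where V: "V > 0" "\<And>x. x \<in> K \<Longrightarrow> cmod (u x) \<le> V" unfolding bounded_pos by blast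
  have A_pos: "?A r > 0" for r by (rule A_rad_har_pos[OF \<phi>])
  let ?E = "\<lambda>r. exp (2 * Q (r *\<^sub>R \<phi>)) * ?A r"
  have "continuous_on {0..1} ?E" by (intro continuous_intros A_rad_har_cont[OF \<phi>])
  then have "bounded (?E ` {0..1})" by (intro compact_imp_bounded compact_continuous_image) auto
  then obtain C where C: "C > 0" "\<And>r. r \<in> {0..1} \<Longrightarrow> norm (?E r) \<le> C" unfolding bounded_pos by blast
  show "(\<integral>\<^sup>+r\<in>{0<..}. ennreal (2 * b * (?w r * (cmod (u (r *\<^sub>R \<phi>)))\<^sup>2)) \<partial>lborel)
    \<le> (\<integral>\<^sup>+r\<in>{0<..}. ennreal (?w r * (?A r * (cmod (?u' r))\<^sup>2)) \<partial>lborel)"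
  proof (rule log_cutoff_extension[where B = B and V = V and C = C])
    show "(\<integral>\<^sup>+r\<in>{0<..}. ennreal (2 * b * (?w r * (cmod (g r))\<^sup>2)) \<partial>lborel)
      \<le> (\<integral>\<^sup>+r\<in>{0<..}. ennreal (?w r * (?A r * (cmod (frechet g r 1))\<^sup>2)) \<partial>lborel)" if "g \<in> C01 {0<..}" for g
      using b(2) unfolding H_rad_har_def
      by (rule nn_integral_form_1d_bound[OF elliptic_form_har[OF \<phi> order_refl] b(1) _ that])
    show "((\<lambda>r. u (r *\<^sub>R \<phi>)) has_vector_derivative ?u' r) (at r)" for r
      by (rule ray_has_vector_derivative[OF u])
    show "continuous_on UNIV (\<lambda>r. ?u' r)"
      by (intro continuous_on_compose2[OF C01_continuous_derivative[OF u, of UNIV]] continuous_intros) auto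
    show "u (r *\<^sub>R \<phi>) = 0" if "r > B" for r
    proof -
      have "norm (r *\<^sub>R \<phi>) = \<bar>r\<bar>" using \<phi> by simp
      then have "r *\<^sub>R \<phi> \<notin> K" using B[of "r *\<^sub>R \<phi>"] that by auto
      then show ?thesis by (rule K(2))
    qed
    show "cmod (u (r *\<^sub>R \<phi>)) \<le> V" for r using V K(2)[of "r *\<^sub>R \<phi>"] by (cases "r *\<^sub>R \<phi> \<in> K") auto
    show "continuous_on UNIV ?w" by (rule w_rad_har_cont)
    show "continuous_on UNIV ?A" by (rule A_rad_har_cont[OF \<phi>])
    show "0 \<le> ?w r" if "0 < r" for r using that by (simp add: w_rad_har_def)
    show "0 \<le> ?A r" for r using A_pos[of r] by simp
    show "?w r * ?A r \<le> C * r" if r: "0 < r" "r < 1" for r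
    proof -
      \<comment> \<open>Here the dimension enters: near the origin the radial weight is dominated by
        \<open>r\<close>, the weight for which logarithmic cutoffs have vanishing energy.\<close>
      have "r ^ (CARD('n) - 1) \<le> r ^ 1" using r dim by (intro power_decreasing) auto
      moreover have "?E r \<le> C" using C(2)[of r] r A_pos[of r] by (simp add: abs_mult)
      ultimately have "r ^ (CARD('n) - 1) * ?E r \<le> r ^ 1 * C"
        using r A_pos[of r] by (intro mult_mono) (auto simp: less_imp_le)
      then show ?thesis by (simp add: w_rad_har_def mult_ac)
    qed
  qed (use C(1) b(1) in auto)
qed

lemma D_bound_of_rays:
  assumes U: "open U" and b: "b \<ge> 0" and u: "u \<in> C01 U"
    and rays: "\<And>\<phi>. \<phi> \<in> sphere 0 1 \<Longrightarrow> ray_bound b \<phi> u"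
  shows "b * (L2_norm (measure_D Q U) u)\<^sup>2 \<le> Re (form_D a Q U u u)"
proof -
  interpret D: elliptic_form "mat_coeff a" "\<lambda>x. exp (2 * Q x)" U by (rule elliptic_form_D[OF U])
  interpret T: elliptic_form "mat_coeff a" "\<lambda>x. exp (2 * Q x)" UNIV by (rule elliptic_form_D) simp
  obtain K where K: "K \<subseteq> U" "\<And>x. x \<notin> K \<Longrightarrow> u x = 0" "\<And>x v. x \<notin> K \<Longrightarrow> frechet u x v = 0"
    by (rule C01_support[OF u], rule that)
  have uT: "u \<in> C01 UNIV" using u C01_mono[of U UNIV] by blast
  let ?d = "CARD('n) - 1"
  let ?F = "\<lambda>x. exp (2 * Q x) * (2 * b * (cmod (u x))\<^sup>2)"
  let ?e = "\<lambda>\<phi> r. A_rad_har a r \<phi> * (cmod (frechet u (r *\<^sub>R \<phi>) \<phi>))\<^sup>2"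
  let ?ray = "\<lambda>F \<phi>. \<integral>\<^sup>+r\<in>{0<..}. ennreal (r ^ ?d) * ennreal (F (r *\<^sub>R \<phi>)) \<partial>lborel"
  let ?G = "\<lambda>x. exp (2 * Q x) * Re (D.grad_density u u x)"
  have zero: "?F x = 0" "?G x = 0" if "x \<notin> U" for x
  proof -
    have "x \<notin> K" using that K(1) by blast
    then show "?F x = 0" "?G x = 0" by (simp_all add: K(2,3) sesq_def)
  qed
  have Fm: "(\<lambda>x. ennreal (?F x)) \<in> borel_measurable borel"
    by (intro measurable_compose[OF _ measurable_ennreal] borel_measurable_continuous_onI continuous_intros
        C01_continuous_on[OF uT])
  have Gm: "(\<lambda>x. ennreal (?G x)) \<in> borel_measurable borel"
    by (intro measurable_compose[OF _ measurable_ennreal] borel_measurable_continuous_onI continuous_intros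
        T.density_continuous uT)
  have "ennreal (2 * b * (L2_norm D.meas u)\<^sup>2) = (\<integral>\<^sup>+x. ennreal (?F x) \<partial>lborel)"
    using b zero by (subst D.nn_integral_scaled_norm[OF u]) (auto intro!: nn_integral_cong simp: indicator_def)
  also have "\<dots> = (\<integral>\<^sup>+\<phi>. ?ray ?F \<phi> \<partial>sphere_measure)"
    by (rule nn_integral_polar[OF Fm])
  also have "\<dots> \<le> (\<integral>\<^sup>+\<phi>. ?ray ?G \<phi> \<partial>sphere_measure)"
  proof (rule nn_integral_mono)
    fix \<phi> assume "\<phi> \<in> space (sphere_measure :: (real^'n) measure)"
    then have \<phi>: "\<phi> \<in> sphere 0 1" by (simp add: space_sphere_measure)
    have "?ray ?F \<phi>
        = (\<integral>\<^sup>+r\<in>{0<..}. ennreal (2 * b * (w_rad_har Q \<phi> r * (cmod (u (r *\<^sub>R \<phi>)))\<^sup>2)) \<partial>lborel)"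
      by (intro nn_integral_cong) (auto simp: indicator_def w_rad_har_def ennreal_mult'[symmetric] mult_ac)
    also have "\<dots> \<le> (\<integral>\<^sup>+r\<in>{0<..}. ennreal (w_rad_har Q \<phi> r * (?e \<phi> r)) \<partial>lborel)"
      using rays[OF \<phi>] by (simp only: ray_bound_def)
    also have "\<dots> \<le> ?ray ?G \<phi>"
    proof (rule nn_integral_mono)
      fix r :: real
      show "ennreal (w_rad_har Q \<phi> r * (?e \<phi> r)) * indicator {0<..} r
        \<le> ennreal (r ^ ?d) * ennreal (?G (r *\<^sub>R \<phi>)) * indicator {0<..} r"
      proof (cases "r > 0")
        case r: True
        \<comment> \<open>Only now is the one-dimensional energy density compared with the full
          gradient; the spectral bound has already been used on the ray.\<close>
        have "w_rad_har Q \<phi> r * (?e \<phi> r)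
            \<le> w_rad_har Q \<phi> r * Re (D.grad_density u u (r *\<^sub>R \<phi>))"
          using r by (intro mult_left_mono A_rad_har_density_le[OF \<phi> u]) (simp add: w_rad_har_def)
        also have "\<dots> = r ^ ?d * ?G (r *\<^sub>R \<phi>)" by (simp add: w_rad_har_def)
        finally have "ennreal (w_rad_har Q \<phi> r * (?e \<phi> r))
            \<le> ennreal (r ^ ?d * ?G (r *\<^sub>R \<phi>))" by (rule ennreal_leI)
        also have "\<dots> = ennreal (r ^ ?d) * ennreal (?G (r *\<^sub>R \<phi>))" using r by (intro ennreal_mult') simp
        finally show ?thesis using r by simp
      qed simp
    qed
    finally show "?ray ?F \<phi>
      \<le> ?ray ?G \<phi>" .
  qed
  also have "\<dots> = (\<integral>\<^sup>+x. ennreal (?G x) \<partial>lborel)" by (rule nn_integral_polar[OF Gm, symmetric])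
  also have "\<dots> = ennreal (2 * D.energy u)"
    unfolding D.nn_integral_energy[OF u]
    using zero(2) by (intro nn_integral_cong) (simp add: indicator_def del: mult_eq_0_iff)
  finally have "2 * b * (L2_norm D.meas u)\<^sup>2 \<le> 2 * D.energy u"
    using D.nonneg[OF u] by (subst (asm) ennreal_le_iff) auto
  then show ?thesis by (simp add: form_D_eq_grad_form)
qed

lemma inf_spec_har_le_D:
  assumes U: "open U"
    and rays: "\<And>b \<phi> u. b \<ge> 0 \<Longrightarrow> \<phi> \<in> sphere 0 1 \<Longrightarrow> ereal b \<le> inf_spec_rad_har a Q \<phi> I \<Longrightarrow> u \<in> C01 U \<Longrightarrow> ray_bound b \<phi> u"
  shows "(INF \<phi>\<in>sphere 0 1. inf_spec_rad_har a Q \<phi> I) \<le> inf_spec_D a Q U"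
proof (rule ereal_le_of_real_lower_bounds)
  fix b assume b: "ereal b \<le> (INF \<phi>\<in>sphere 0 1. inf_spec_rad_har a Q \<phi> I)"
  interpret D: elliptic_form "mat_coeff a" "\<lambda>x. exp (2 * Q x)" U by (rule elliptic_form_D[OF U])
  show "ereal b \<le> inf_spec_D a Q U"
    unfolding le_inf_spec_D_iff[OF U]
  proof
    fix u assume u: "u \<in> C01 U"
    show "b * (L2_norm (measure_D Q U) u)\<^sup>2 \<le> Re (form_D a Q U u u)"
    proof (cases "b \<ge> 0")
      \<comment> \<open>Only \<open>b \<ge> 0\<close> goes through the rays; otherwise the left-hand
        side is nonpositive and the form is non-negative.\<close>
      case True
      then show ?thesis using b rays u by (intro D_bound_of_rays[OF U True u]) (auto simp: le_INF_iff)
    next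
      case False
      then have "b * (L2_norm (measure_D Q U) u)\<^sup>2 \<le> 0" by (simp add: mult_nonpos_nonneg)
      also have "0 \<le> Re (form_D a Q U u u)" using D.nonneg[OF u] by (simp add: form_D_eq_grad_form)
      finally show ?thesis .
    qed
  qed
qed

end

theorem theorem4:
  fixes a :: "real^'n \<Rightarrow> real^'n^'n" and Q :: "real^'n \<Rightarrow> real"
  assumes "CARD('n) \<ge> 2"
    and "C1_on UNIV a"
    and "\<And>x. transpose (a x) = a x"
    and "\<And>x v. v \<noteq> 0 \<Longrightarrow> v \<bullet> (a x *v v) > 0"
    and "C1_on UNIV Q"
  shows "((INF \<phi>\<in>sphere 0 1. inf_spec_rad_har a Q \<phi> {0<..}) \<le> inf_spec_D a Q UNIV \<and>
          inf_spec_D a Q UNIV \<le> inf_spec_rad_avg a Q {0<..}) \<and>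
         (\<forall>l>0. (INF \<phi>\<in>sphere 0 1. inf_spec_rad_har a Q \<phi> {l<..}) \<le> inf_spec_D a Q (- cball 0 l) \<and>
                inf_spec_D a Q (- cball 0 l) \<le> inf_spec_rad_avg a Q {l<..})"
proof -
  interpret coefficients a Q by standard (use assms in auto)
  have "(INF \<phi>\<in>sphere 0 1. inf_spec_rad_har a Q \<phi> {0<..}) \<le> inf_spec_D a Q UNIV"
    by (rule inf_spec_har_le_D) (auto intro: ray_bound_full[OF assms(1)])
  \<comment> \<open>The case \<open>l = 0\<close>: the complement of \<open>cball 0 0\<close> is the
    punctured space, which is contained in \<open>UNIV\<close>.\<close>
  moreover have "inf_spec_D a Q UNIV \<le> inf_spec_rad_avg a Q {0<..}"
    by (rule inf_spec_D_le_avg) auto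
  moreover have "(INF \<phi>\<in>sphere 0 1. inf_spec_rad_har a Q \<phi> {l<..}) \<le> inf_spec_D a Q (- cball 0 l)" if "l > 0" for l
    by (rule inf_spec_har_le_D[OF open_Compl[OF closed_cball] ray_bound_exterior])
      (use that in \<open>auto simp: less_imp_le\<close>)
  moreover have "inf_spec_D a Q (- cball 0 l) \<le> inf_spec_rad_avg a Q {l<..}" if "l > 0" for l
    by (rule inf_spec_D_le_avg) (use that in auto)
  ultimately show ?thesis by blast
qed

end
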